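(* Let $M$ be a connected smooth manifold of dimension $n\ge 2$ with a Riemannian conformal structure $c$. Let $g\in c$, let $\gamma$ be an admissible family, with associated $\delta>0$, and let $(\widetilde M,\widetilde g)$ be the Lorentzian manifold constructed from $g$ and $\gamma$. Let $u\in C^\infty(M)$ and let $\Psi^u\colon M\to\widetilde M$, $\Psi^u(x)=(e^{u(x)},0,x)$, with lightlike normal vector field $\xi^u=e^u\,\partial_t|_{\Psi^u}$. Let $$\bigl(\Psi^{u*}(T\widetilde M),\ \mathrm{Span}(\xi^u),\ \widetilde g^u,\ \widetilde\nabla^u\bigr)$$ be the tractor bundle associated with the pair $(\Psi^u,\xi^u)$, where $\widetilde g^u$ is the restriction of $\widetilde g$ along $\Psi^u$ and $\widetilde\nabla^u$ is the connection induced along $\Psi^u$ by the Levi-Civita connection of $\widetilde g$. Then $\bigl(\Psi^{u*}(T\widetilde M),\mathrm{Span}(\xi^u),\widetilde g^u,\widetilde\nabla^u\bigr)$ is the normal conformal tractor bundle of $(M,c)$ if and only if: - in case $n=2$: $\mathrm{trace}(\dot\gamma(0))=2K^g$, where $K^g$ is the Gauss curvature of $g$; - in case $n\ge3$: $g(\dot\gamma(0)(-),-)=2P^g$, where $P^g$ is the Schouten tensor of $g$.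
   Context: **Schouten tensor** ($n\ge3$). $P^g=\frac1{n-2}\Bigl(\mathrm{Ric}^g-\frac{\mathrm S^g}{2(n-1)}g\Bigr)$, with $\mathrm{Ric}^g$ and $\mathrm S^g$ the Ricci and scalar curvatures of $g$. **Admissible family.** Given a Riemannian conformal structure $(M,c)$, a smooth one-parameter family $\gamma$ of $(1,1)$-tensor fields $\gamma(r)$, $r\in\mathbb R$, on $M$ is admissible if: (1) each $\gamma(r)$ is self-adjoint with respect to any metric of $c$; (2) $\gamma(0)=\mathrm{Id}$; (3) there is $\delta>0$ such that $\gamma(r)$ is nonsingular for all $|r|<\delta$. We write $\dot\gamma(r)(V_x)=\lim_{\varepsilon\to0}\frac{\gamma(r+\varepsilon)(V_x)-\gamma(r)(V_x)}{\varepsilon}$; in particular $\dot\gamma(0)$ is a $(1,1)$-tensor field on $M$. **The Lorentzian manifold.** For $g\in c$ put $\langle V,W\rangle^g_r=g(\gamma(r)(V),W)$, which is positive definite for $|r|<\delta$. Let $\widetilde M=\mathbb R_{>0}\times(-\delta,\delta)\times M$, with coordinates $(t,r)$ on the first two factors, and $$\widetilde g=d(rt)\otimes dt+dt\otimes d(rt)+t^2\langle-,-\rangle^g_r .$$ **The immersion.** $\Psi^u$ is a spacelike immersion with $\Psi^{u*}(\widetilde g)=e^{2u}g$. The field $\xi^u$ is normal and lightlike, it is parallel for the normal connection, and its Weingarten endomorphism is $-\mathrm{Id}$. **Conformal tractor bundles.** A conformal tractor bundle on $M^n$ is a rank $n+2$ real vector bundle $\mathcal T\to M$ with a Lorentzian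 bundle metric $\mathbf h$ and a distinguished oriented lightlike line subbundle $\mathcal T^1\subset\mathcal T$. A tractor connection is a linear connection $\nabla^{\mathcal T}$ on $\mathcal T$ with $\nabla^{\mathcal T}\mathbf h=0$ such that $\beta\colon TM\to\mathrm{Hom}(\mathcal T^1,(\mathcal T^1)^\perp/\mathcal T^1)$, $\beta(V_x)(\sigma(x))=\nabla^{\mathcal T}_{V_x}\sigma+\mathcal T^1_x$ for $\sigma\in\Gamma(\mathcal T^1)$, is a vector bundle isomorphism. Each nonvanishing local section $\sigma$ of $\mathcal T^1$ gives an isomorphism $\beta_\sigma\colon TM\to(\mathcal T^1)^\perp/\mathcal T^1$, $V\mapsto\nabla^{\mathcal T}_V\sigma+\mathcal T^1$, and a Riemannian metric $\mathbf h^\sigma(V,W)=\mathbf h(\beta_\sigma V,\beta_\sigma W)$. These metrics, for different $\sigma$, are conformally related, so they determine a conformal class. If this class is $c$, then $(\mathcal T,\mathcal T^1,\mathbf h,\nabla^{\mathcal T})$ is called a standard conformal tractor bundle for $(M,c)$. **Normality.** A standard conformal tractor bundle with tractor connection is the normal conformal tractor bundle of $(M,c)$ if the curvature $R$ of $\nabla^{\mathcal T}$ satisfies the following normalization conditions. (i) $R(V,W)(\mathcal T^1)\subset\mathcal T^1$ for all $V,W$. Then, since $\nabla^{\mathcal T}\mathbf h=0$, $R(V,W)$ preserves $(\mathcal T^1)^\perp$ and induces an endomorphism of $(\mathcal T^1)^\perp/\mathcal T^1$. Via $\beta_\sigma$ this gives an endomorphism $\mathcal W(V,W)$ of $TM$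 that does not depend on $\sigma$. (ii) $\mathrm{trace}\bigl(V\mapsto\mathcal W(V,W)Z\bigr)=0$ for all $W,Z$. For $n\ge3$ these conditions determine $(\mathcal T,\mathcal T^1,\mathbf h,\nabla^{\mathcal T})$ uniquely up to isomorphism. For $n=2$ they make sense but do not give uniqueness, and "is the normal conformal tractor bundle" then means only that the conditions hold. **Tractor bundle associated with a pair.** Let $\Psi\colon M^n\to(\widetilde M^{n+2},\widetilde g)$ be a spacelike immersion into a Lorentzian manifold with a global lightlike normal frame $\{\xi,\ell\}$, $\widetilde g(\xi,\ell)=-1$, such that the Weingarten endomorphism of $\xi$ is $-\mathrm{Id}$ and $\nabla^\perp\xi=0$. The tractor bundle associated with $(\Psi,\xi)$ is the standard conformal tractor bundle $(\Psi^*(T\widetilde M),\mathrm{Span}(\xi),\widetilde g,\widetilde\nabla)$ of $(M,[\Psi^*\widetilde g])$, where $\mathrm{Span}(\xi)$ plays the role of $\mathcal T^1$ (oriented by $\xi$), the bundle metric is the one induced by $\widetilde g$, and the connection is the pullback of the Levi-Civita connection of $\widetilde g$. *)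

theory Defs
  imports "HOL-Analysis.Analysis" "HOL-Library.Function_Algebras"
begin

section \<open>Linear algebra on subspaces\<close>

instantiation "fun" :: (type, real_vector) real_vector
begin

definition scaleR_fun :: "real \<Rightarrow> ('a \<Rightarrow> 'b) \<Rightarrow> 'a \<Rightarrow> 'b"
  where "scaleR_fun c f = (\<lambda>x. c *\<^sub>R f x)"

instance
  by standard (simp_all add: scaleR_fun_def fun_eq_iff scaleR_add_right scaleR_add_left)

end

definition lin_on :: "'a::real_vector set \<Rightarrow> ('a \<Rightarrow> 'b::real_vector) \<Rightarrow> bool"
  where "lin_on S F \<longleftrightarrow>
    (\<forall>x\<in>S. \<forall>y\<in>S. F (x + y) = F x + F y) \<and> (\<forall>c. \<forall>x\<in>S. F (c *\<^sub>R x) = c *\<^sub>R F x)"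

text \<open>Trace of an endomorphism of a finite-dimensional subspace; it does not depend on the basis.\<close>

definition trace_on :: "'a::real_vector set \<Rightarrow> ('a \<Rightarrow> 'a) \<Rightarrow> real"
  where "trace_on S L =
    (let B = (SOME B. independent B \<and> span B = S) in \<Sum>b\<in>B. representation B (L b) b)"

section \<open>Smooth manifolds\<close>

text \<open>On an open set of a Euclidean space, a map is of class C^(k+1) iff it is differentiable
  and all its directional derivatives are of class C^k.\<close>

primrec Ck_on :: "nat \<Rightarrow> 'a::euclidean_space set \<Rightarrow> ('a \<Rightarrow> 'b::real_normed_vector) \<Rightarrow> bool"
  where
    "Ck_on 0 S f \<longleftrightarrow> continuous_on S f"
  | "Ck_on (Suc k) S f \<longleftrightarrow> (\<forall>x\<in>S. f differentiable (at x)) \<and>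
       (\<forall>v. Ck_on k S (\<lambda>x. frechet_derivative f (at x) v))"

definition smooth_on :: "'a::euclidean_space set \<Rightarrow> ('a \<Rightarrow> 'b::real_normed_vector) \<Rightarrow> bool"
  where "smooth_on S f \<longleftrightarrow> (\<forall>k. Ck_on k S f)"

text \<open>A manifold is given by a (not necessarily maximal) smooth atlas, a set of charts
  (domain, coordinate map) with values in the model space 'e; its dimension is DIM('e).
  Its underlying set is the union of the chart domains, an open subset of the type 'm, which is
  Hausdorff and second countable.\<close>

type_synonym ('m, 'e) atlas = "('m set \<times> ('m \<Rightarrow> 'e)) set"

definition carrier :: "('m, 'e) atlas \<Rightarrow> 'm set"
  where "carrier A = (\<Union>(U, \<phi>)\<in>A. U)"

definition smooth_manifold ::
    "('m::{t2_space, second_countable_topology}, 'e::euclidean_space) atlas \<Rightarrow> bool"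
  where "smooth_manifold A \<longleftrightarrow>
    (\<forall>(U, \<phi>)\<in>A. open U \<and> open (\<phi> ` U) \<and> homeomorphism U (\<phi> ` U) \<phi> (inv_into U \<phi>)) \<and>
    (\<forall>(U, \<phi>)\<in>A. \<forall>(V, \<psi>)\<in>A. smooth_on (\<phi> ` (U \<inter> V)) (\<psi> \<circ> inv_into U \<phi>))"

definition open_atlas :: "'e set \<Rightarrow> ('e, 'e) atlas"
  where "open_atlas S = {(S, id)}"

definition prod_atlas :: "('m, 'e) atlas \<Rightarrow> ('n, 'f) atlas \<Rightarrow> ('m \<times> 'n, 'e \<times> 'f) atlas"
  where "prod_atlas A B = {(U \<times> V, map_prod \<phi> \<psi>) |U \<phi> V \<psi>. (U, \<phi>) \<in> A \<and> (V, \<psi>) \<in> B}"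

definition open_in :: "('m::topological_space, 'e) atlas \<Rightarrow> 'm set \<Rightarrow> bool"
  where "open_in A U \<longleftrightarrow> open U \<and> U \<subseteq> carrier A"

definition smooth_fun ::
    "('m, 'e::euclidean_space) atlas \<Rightarrow> 'm set \<Rightarrow> ('m \<Rightarrow> 'b::real_normed_vector) \<Rightarrow> bool"
  where "smooth_fun A U f \<longleftrightarrow>
    (\<forall>(V, \<phi>)\<in>A. smooth_on (\<phi> ` (U \<inter> V)) (f \<circ> inv_into V \<phi>))"

definition smooth_near ::
    "('m::topological_space, 'e::euclidean_space) atlas \<Rightarrow> 'm \<Rightarrow> ('m \<Rightarrow> real) \<Rightarrow> bool"
  where "smooth_near A p f \<longleftrightarrow> (\<exists>U. open_in A U \<and> p \<in> U \<and> smooth_fun A U f)"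

text \<open>A tangent vector at p is a directional derivative: it acts on the functions that are smooth
  near p. On all other functions it is set to 0, so that tangent vectors are determined by their
  action on germs of smooth functions.\<close>

type_synonym 'm tvec = "('m \<Rightarrow> real) \<Rightarrow> real"

definition tangent_space ::
    "('m::topological_space, 'e::euclidean_space) atlas \<Rightarrow> 'm \<Rightarrow> 'm tvec set"
  where "tangent_space A p =
    {X. \<exists>(U, \<phi>)\<in>A. p \<in> U \<and> (\<exists>v. X = (\<lambda>f. if smooth_near A p f
          then frechet_derivative (f \<circ> inv_into U \<phi>) (at (\<phi> p)) v else 0))}"

definition differential ::
    "('n::topological_space, 'f::euclidean_space) atlas \<Rightarrow> ('m \<Rightarrow> 'n) \<Rightarrow> 'm \<Rightarrow> 'm tvec \<Rightarrow> 'n tvec"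
  where "differential B F p X = (\<lambda>f. if smooth_near B (F p) f then X (f \<circ> F) else 0)"

section \<open>Vector bundles and connections\<close>

text \<open>A vector bundle with model fibre 'f is given by its fibres, which are linear subspaces of
  an ambient real vector space 'w, and by local trivializations (domain, fibrewise isomorphism
  onto 'f) with smooth transition maps. The ambient space carries no further structure.\<close>

record ('m, 'w, 'f) vbundle =
  fib :: "'m \<Rightarrow> 'w set"
  trivs :: "('m set \<times> ('m \<Rightarrow> 'w \<Rightarrow> 'f)) set"

definition vector_bundle ::
    "('m::topological_space, 'e::euclidean_space) atlas \<Rightarrow>
     ('m, 'w::real_vector, 'f::euclidean_space) vbundle \<Rightarrow> bool"
  where "vector_bundle A B \<longleftrightarrow>
    (\<forall>p\<in>carrier A. subspace (fib B p)) \<and>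
    (\<Union>(U, \<Theta>)\<in>trivs B. U) = carrier A \<and>
    (\<forall>(U, \<Theta>)\<in>trivs B. open U \<and>
       (\<forall>p\<in>U. lin_on (fib B p) (\<Theta> p) \<and> bij_betw (\<Theta> p) (fib B p) UNIV)) \<and>
    (\<forall>(U, \<Theta>)\<in>trivs B. \<forall>(V, \<Theta>')\<in>trivs B. \<forall>y.
       smooth_fun A (U \<inter> V) (\<lambda>p. \<Theta>' p (inv_into (fib B p) (\<Theta> p) y)))"

definition smooth_section ::
    "('m, 'e::euclidean_space) atlas \<Rightarrow>
     ('m, 'w, 'f::euclidean_space) vbundle \<Rightarrow> 'm set \<Rightarrow> ('m \<Rightarrow> 'w) \<Rightarrow> bool"
  where "smooth_section A B U s \<longleftrightarrow>
    (\<forall>p\<in>U. s p \<in> fib B p) \<and>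
    (\<forall>(V, \<Theta>)\<in>trivs B. smooth_fun A (U \<inter> V) (\<lambda>p. \<Theta> p (s p)))"

definition section_near ::
    "('m::topological_space, 'e::euclidean_space) atlas \<Rightarrow>
     ('m, 'w, 'f::euclidean_space) vbundle \<Rightarrow> 'm \<Rightarrow> ('m \<Rightarrow> 'w) \<Rightarrow> bool"
  where "section_near A B p s \<longleftrightarrow> (\<exists>U. open_in A U \<and> p \<in> U \<and> smooth_section A B U s)"

text \<open>The trivialization of the tangent bundle induced by a chart sends X to the vector whose
  components are the values of X on the coordinate functions.\<close>

definition tangent_bundle ::
    "('m::topological_space, 'e::euclidean_space) atlas \<Rightarrow> ('m, 'm tvec, 'e) vbundle"
  where "tangent_bundle A =
    \<lparr>fib = tangent_space A,
     trivs = {(U, \<lambda>p X. \<Sum>b\<in>Basis. X (\<lambda>q. \<phi> q \<bullet> b) *\<^sub>R b) |U \<phi>. (U, \<phi>) \<in> A}\<rparr>"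

definition pullback_bundle ::
    "('m, 'e) atlas \<Rightarrow> ('m \<Rightarrow> 'n) \<Rightarrow> ('n, 'w, 'f) vbundle \<Rightarrow> ('m, 'w, 'f) vbundle"
  where "pullback_bundle A \<Psi> B =
    \<lparr>fib = (\<lambda>p. fib B (\<Psi> p)),
     trivs = {(\<Psi> -` V \<inter> carrier A, \<lambda>p. \<Theta> (\<Psi> p)) |V \<Theta>. (V, \<Theta>) \<in> trivs B}\<rparr>"

text \<open>The covariant derivative D p v s of a section s in the direction v at p depends only on the
  germ of s at p; nothing is required of its value when s is not smooth near p.\<close>

definition is_connection ::
    "('m::topological_space, 'e::euclidean_space) atlas \<Rightarrow>
     ('m, 'w::real_vector, 'f::euclidean_space) vbundle \<Rightarrow>
     ('m \<Rightarrow> 'm tvec \<Rightarrow> ('m \<Rightarrow> 'w) \<Rightarrow> 'w) \<Rightarrow> bool"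
  where "is_connection A B D \<longleftrightarrow>
    (\<forall>p\<in>carrier A. \<forall>s. section_near A B p s \<longrightarrow>
       lin_on (tangent_space A p) (\<lambda>v. D p v s) \<and>
       (\<forall>v\<in>tangent_space A p.
          D p v s \<in> fib B p \<and>
          (\<forall>s'. section_near A B p s' \<longrightarrow> D p v (\<lambda>q. s q + s' q) = D p v s + D p v s') \<and>
          (\<forall>f. smooth_near A p f \<longrightarrow> D p v (\<lambda>q. f q *\<^sub>R s q) = v f *\<^sub>R s p + f p *\<^sub>R D p v s) \<and>
          (\<forall>s'. section_near A B p s' \<and> (\<forall>\<^sub>F q in nhds p. s q = s' q) \<longrightarrow>
             D p v s = D p v s'))) \<and>
    (\<forall>U V s. open_in A U \<and> smooth_section A (tangent_bundle A) U V \<and> smooth_section A B U s \<longrightarrow>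
       smooth_section A B U (\<lambda>p. D p (V p) s))"

definition lie_bracket ::
    "('m::topological_space, 'e::euclidean_space) atlas \<Rightarrow>
     ('m \<Rightarrow> 'm tvec) \<Rightarrow> ('m \<Rightarrow> 'm tvec) \<Rightarrow> 'm \<Rightarrow> 'm tvec"
  where "lie_bracket A V W p =
    (\<lambda>f. if smooth_near A p f then V p (\<lambda>q. W q f) - W p (\<lambda>q. V q f) else 0)"

text \<open>R(V,W)s = D_V D_W s - D_W D_V s - D_[V,W] s, evaluated at p on arbitrary local extensions of
  the given vectors v, w and x.\<close>

definition curvature ::
    "('m::topological_space, 'e::euclidean_space) atlas \<Rightarrow>
     ('m, 'w::real_vector, 'f::euclidean_space) vbundle \<Rightarrow>
     ('m \<Rightarrow> 'm tvec \<Rightarrow> ('m \<Rightarrow> 'w) \<Rightarrow> 'w) \<Rightarrow> 'm \<Rightarrow> 'm tvec \<Rightarrow> 'm tvec \<Rightarrow> 'w \<Rightarrow> 'w"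
  where "curvature A B D p v w x = (THE z. \<exists>V W s.
     section_near A (tangent_bundle A) p V \<and> V p = v \<and>
     section_near A (tangent_bundle A) p W \<and> W p = w \<and>
     section_near A B p s \<and> s p = x \<and>
     z = D p v (\<lambda>q. D q (W q) s) - D p w (\<lambda>q. D q (V q) s) - D p (lie_bracket A V W p) s)"

definition is_pullback_connection ::
    "('m::topological_space, 'e::euclidean_space) atlas \<Rightarrow>
     ('n::topological_space, 'k::euclidean_space) atlas \<Rightarrow> ('m \<Rightarrow> 'n) \<Rightarrow>
     ('n, 'w::real_vector, 'f::euclidean_space) vbundle \<Rightarrow>
     ('n \<Rightarrow> 'n tvec \<Rightarrow> ('n \<Rightarrow> 'w) \<Rightarrow> 'w) \<Rightarrow> ('m \<Rightarrow> 'm tvec \<Rightarrow> ('m \<Rightarrow> 'w) \<Rightarrow> 'w) \<Rightarrow> bool"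
  where "is_pullback_connection A N \<Psi> B D D' \<longleftrightarrow>
    is_connection A (pullback_bundle A \<Psi> B) D' \<and>
    (\<forall>p\<in>carrier A. \<forall>v\<in>tangent_space A p. \<forall>Z. section_near N B (\<Psi> p) Z \<longrightarrow>
       D' p v (\<lambda>q. Z (\<Psi> q)) = D (\<Psi> p) (differential N \<Psi> p v) Z)"

section \<open>Riemannian geometry\<close>

definition bundle_metric ::
    "('m::topological_space, 'e::euclidean_space) atlas \<Rightarrow>
     ('m, 'w::real_vector, 'f::euclidean_space) vbundle \<Rightarrow> ('m \<Rightarrow> 'w \<Rightarrow> 'w \<Rightarrow> real) \<Rightarrow> bool"
  where "bundle_metric A B h \<longleftrightarrow>
    (\<forall>p\<in>carrier A. \<forall>x\<in>fib B p.
       lin_on (fib B p) (h p x) \<and>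
       (\<forall>y\<in>fib B p. h p x y = h p y x) \<and>
       ((\<forall>y\<in>fib B p. h p x y = 0) \<longrightarrow> x = 0)) \<and>
    (\<forall>U s s'. open_in A U \<and> smooth_section A B U s \<and> smooth_section A B U s' \<longrightarrow>
       smooth_fun A U (\<lambda>p. h p (s p) (s' p)))"

definition riemannian_metric ::
    "('m::topological_space, 'e::euclidean_space) atlas \<Rightarrow> ('m \<Rightarrow> 'm tvec \<Rightarrow> 'm tvec \<Rightarrow> real) \<Rightarrow> bool"
  where "riemannian_metric A g \<longleftrightarrow> bundle_metric A (tangent_bundle A) g \<and>
    (\<forall>p\<in>carrier A. \<forall>v\<in>tangent_space A p. v \<noteq> 0 \<longrightarrow> g p v v > 0)"

text \<open>Index one: there is a negative vector whose orthogonal complement is positive definite.\<close>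

definition lorentzian_bundle_metric ::
    "('m::topological_space, 'e::euclidean_space) atlas \<Rightarrow>
     ('m, 'w::real_vector, 'f::euclidean_space) vbundle \<Rightarrow> ('m \<Rightarrow> 'w \<Rightarrow> 'w \<Rightarrow> real) \<Rightarrow> bool"
  where "lorentzian_bundle_metric A B h \<longleftrightarrow> bundle_metric A B h \<and>
    (\<forall>p\<in>carrier A. \<exists>x\<in>fib B p. h p x x < 0 \<and>
       (\<forall>y\<in>fib B p. h p x y = 0 \<and> y \<noteq> 0 \<longrightarrow> h p y y > 0))"

definition metric_connection ::
    "('m::topological_space, 'e::euclidean_space) atlas \<Rightarrow>
     ('m, 'w::real_vector, 'f::euclidean_space) vbundle \<Rightarrow> ('m \<Rightarrow> 'w \<Rightarrow> 'w \<Rightarrow> real) \<Rightarrow>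
     ('m \<Rightarrow> 'm tvec \<Rightarrow> ('m \<Rightarrow> 'w) \<Rightarrow> 'w) \<Rightarrow> bool"
  where "metric_connection A B h D \<longleftrightarrow> is_connection A B D \<and>
    (\<forall>p\<in>carrier A. \<forall>v\<in>tangent_space A p. \<forall>s s'. section_near A B p s \<and> section_near A B p s' \<longrightarrow>
       v (\<lambda>q. h q (s q) (s' q)) = h p (D p v s) (s' p) + h p (s p) (D p v s'))"

definition levi_civita ::
    "('m::topological_space, 'e::euclidean_space) atlas \<Rightarrow> ('m \<Rightarrow> 'm tvec \<Rightarrow> 'm tvec \<Rightarrow> real) \<Rightarrow>
     ('m \<Rightarrow> 'm tvec \<Rightarrow> ('m \<Rightarrow> 'm tvec) \<Rightarrow> 'm tvec) \<Rightarrow> bool"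
  where "levi_civita A g D \<longleftrightarrow> metric_connection A (tangent_bundle A) g D \<and>
    (\<forall>p\<in>carrier A. \<forall>V W.
       section_near A (tangent_bundle A) p V \<and> section_near A (tangent_bundle A) p W \<longrightarrow>
       D p (V p) W - D p (W p) V = lie_bracket A V W p)"

text \<open>In the following definitions D is the Levi-Civita connection of g.\<close>

definition ricci ::
    "('m::topological_space, 'e::euclidean_space) atlas \<Rightarrow>
     ('m \<Rightarrow> 'm tvec \<Rightarrow> ('m \<Rightarrow> 'm tvec) \<Rightarrow> 'm tvec) \<Rightarrow> 'm \<Rightarrow> 'm tvec \<Rightarrow> 'm tvec \<Rightarrow> real"
  where "ricci A D p v w =
    trace_on (tangent_space A p) (\<lambda>z. curvature A (tangent_bundle A) D p z v w)"

text \<open>The scalar curvature is the trace of the Ricci endomorphism.\<close>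

definition scalar_curvature ::
    "('m::topological_space, 'e::euclidean_space) atlas \<Rightarrow> ('m \<Rightarrow> 'm tvec \<Rightarrow> 'm tvec \<Rightarrow> real) \<Rightarrow>
     ('m \<Rightarrow> 'm tvec \<Rightarrow> ('m \<Rightarrow> 'm tvec) \<Rightarrow> 'm tvec) \<Rightarrow> 'm \<Rightarrow> real"
  where "scalar_curvature A g D p = trace_on (tangent_space A p)
    (\<lambda>v. THE w. w \<in> tangent_space A p \<and> (\<forall>z\<in>tangent_space A p. g p w z = ricci A D p v z))"

definition schouten ::
    "('m::topological_space, 'e::euclidean_space) atlas \<Rightarrow> ('m \<Rightarrow> 'm tvec \<Rightarrow> 'm tvec \<Rightarrow> real) \<Rightarrow>
     ('m \<Rightarrow> 'm tvec \<Rightarrow> ('m \<Rightarrow> 'm tvec) \<Rightarrow> 'm tvec) \<Rightarrow> 'm \<Rightarrow> 'm tvec \<Rightarrow> 'm tvec \<Rightarrow> real"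
  where "schouten A g D p v w =
    1 / (real DIM('e) - 2) *
    (ricci A D p v w - scalar_curvature A g D p / (2 * (real DIM('e) - 1)) * g p v w)"

text \<open>In dimension two, k is the sectional curvature of the tangent plane.\<close>

definition gauss_curvature ::
    "('m::topological_space, 'e::euclidean_space) atlas \<Rightarrow> ('m \<Rightarrow> 'm tvec \<Rightarrow> 'm tvec \<Rightarrow> real) \<Rightarrow>
     ('m \<Rightarrow> 'm tvec \<Rightarrow> ('m \<Rightarrow> 'm tvec) \<Rightarrow> 'm tvec) \<Rightarrow> 'm \<Rightarrow> real"
  where "gauss_curvature A g D p = (THE k. \<forall>v\<in>tangent_space A p. \<forall>w\<in>tangent_space A p.
    g p (curvature A (tangent_bundle A) D p v w w) v = k * (g p v v * g p w w - (g p v w)\<^sup>2))"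

definition conformal_on ::
    "('m::topological_space, 'e::euclidean_space) atlas \<Rightarrow> 'm set \<Rightarrow>
     ('m \<Rightarrow> 'm tvec \<Rightarrow> 'm tvec \<Rightarrow> real) \<Rightarrow> ('m \<Rightarrow> 'm tvec \<Rightarrow> 'm tvec \<Rightarrow> real) \<Rightarrow> bool"
  where "conformal_on A U g g' \<longleftrightarrow> (\<exists>f. smooth_fun A U f \<and>
    (\<forall>p\<in>U. \<forall>v\<in>tangent_space A p. \<forall>w\<in>tangent_space A p. g' p v w = exp (2 * f p) * g p v w))"

definition conformal_structure ::
    "('m::topological_space, 'e::euclidean_space) atlas \<Rightarrow>
     ('m \<Rightarrow> 'm tvec \<Rightarrow> 'm tvec \<Rightarrow> real) set \<Rightarrow> bool"
  where "conformal_structure A c \<longleftrightarrow> (\<exists>g. riemannian_metric A g \<and>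
    c = {g'. riemannian_metric A g' \<and> conformal_on A (carrier A) g g'})"

section \<open>Conformal tractor bundles\<close>

text \<open>An oriented line subbundle is given by its rays: L p is the open half-line of positive
  vectors, and the line itself is the span of L p.\<close>

definition oriented_line_subbundle ::
    "('m::topological_space, 'e::euclidean_space) atlas \<Rightarrow>
     ('m, 'w::real_vector, 'f::euclidean_space) vbundle \<Rightarrow> ('m \<Rightarrow> 'w set) \<Rightarrow> bool"
  where "oriented_line_subbundle A B L \<longleftrightarrow>
    (\<forall>p\<in>carrier A. \<exists>U \<sigma>. open_in A U \<and> p \<in> U \<and> smooth_section A B U \<sigma> \<and>
       (\<forall>q\<in>U. \<sigma> q \<noteq> 0 \<and> L q = {a *\<^sub>R \<sigma> q |a. a > 0}))"

definition line_section ::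
    "('m, 'e::euclidean_space) atlas \<Rightarrow> ('m, 'w::real_vector, 'f::euclidean_space) vbundle \<Rightarrow>
     ('m \<Rightarrow> 'w set) \<Rightarrow> 'm set \<Rightarrow> ('m \<Rightarrow> 'w) \<Rightarrow> bool"
  where "line_section A B L U \<sigma> \<longleftrightarrow> smooth_section A B U \<sigma> \<and> (\<forall>p\<in>U. \<sigma> p \<in> span (L p))"

definition conformal_tractor_bundle ::
    "('m::topological_space, 'e::euclidean_space) atlas \<Rightarrow>
     ('m, 'w::real_vector, 'f::euclidean_space) vbundle \<Rightarrow>
     ('m \<Rightarrow> 'w set) \<Rightarrow> ('m \<Rightarrow> 'w \<Rightarrow> 'w \<Rightarrow> real) \<Rightarrow> bool"
  where "conformal_tractor_bundle A B L h \<longleftrightarrow>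
    vector_bundle A B \<and> DIM('f) = DIM('e) + 2 \<and>
    lorentzian_bundle_metric A B h \<and>
    oriented_line_subbundle A B L \<and>
    (\<forall>p\<in>carrier A. \<forall>x\<in>L p. h p x x = 0)"

definition line_perp ::
    "('m, 'w::real_vector, 'f) vbundle \<Rightarrow> ('m \<Rightarrow> 'w set) \<Rightarrow> ('m \<Rightarrow> 'w \<Rightarrow> 'w \<Rightarrow> real) \<Rightarrow> 'm \<Rightarrow> 'w set"
  where "line_perp B L h p = {x \<in> fib B p. \<forall>y\<in>span (L p). h p x y = 0}"

definition line_coset :: "('m \<Rightarrow> 'w::real_vector set) \<Rightarrow> 'm \<Rightarrow> 'w \<Rightarrow> 'w set"
  where "line_coset L p x = {x + y |y. y \<in> span (L p)}"

text \<open>Linear maps from the line to its orthogonal complement modulo the line, extended by the empty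
  set outside the line. Every linear map to the quotient lifts to a linear map F.\<close>

definition line_quotient_hom ::
    "('m, 'w::real_vector, 'f) vbundle \<Rightarrow> ('m \<Rightarrow> 'w set) \<Rightarrow> ('m \<Rightarrow> 'w \<Rightarrow> 'w \<Rightarrow> real) \<Rightarrow> 'm \<Rightarrow>
     ('w \<Rightarrow> 'w set) set"
  where "line_quotient_hom B L h p =
    {(\<lambda>y. if y \<in> span (L p) then line_coset L p (F y) else {}) |F.
       lin_on (span (L p)) F \<and> F ` span (L p) \<subseteq> line_perp B L h p}"

text \<open>All local sections through the same vector y give the same coset, so the union consists of a
  single coset if y is in the line; it is empty if y is not in the line.\<close>

definition tractor_beta ::
    "('m::topological_space, 'e::euclidean_space) atlas \<Rightarrow>
     ('m, 'w::real_vector, 'f::euclidean_space) vbundle \<Rightarrow> ('m \<Rightarrow> 'w set) \<Rightarrow>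
     ('m \<Rightarrow> 'm tvec \<Rightarrow> ('m \<Rightarrow> 'w) \<Rightarrow> 'w) \<Rightarrow> 'm \<Rightarrow> 'm tvec \<Rightarrow> 'w \<Rightarrow> 'w set"
  where "tractor_beta A B L D p v y =
    \<Union>{line_coset L p (D p v \<sigma>) |\<sigma> U. open_in A U \<and> p \<in> U \<and> line_section A B L U \<sigma> \<and> \<sigma> p = y}"

text \<open>The map beta is linear in v and smooth because D is, so it is an isomorphism of vector bundles
  iff it is bijective in each fibre.\<close>

definition tractor_connection ::
    "('m::topological_space, 'e::euclidean_space) atlas \<Rightarrow>
     ('m, 'w::real_vector, 'f::euclidean_space) vbundle \<Rightarrow> ('m \<Rightarrow> 'w set) \<Rightarrow>
     ('m \<Rightarrow> 'w \<Rightarrow> 'w \<Rightarrow> real) \<Rightarrow> ('m \<Rightarrow> 'm tvec \<Rightarrow> ('m \<Rightarrow> 'w) \<Rightarrow> 'w) \<Rightarrow> bool"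
  where "tractor_connection A B L h D \<longleftrightarrow> metric_connection A B h D \<and>
    (\<forall>p\<in>carrier A.
       bij_betw (tractor_beta A B L D p) (tangent_space A p) (line_quotient_hom B L h p))"

text \<open>The metric that h induces on the quotient of the orthogonal complement of the line is evaluated
  on representatives of the cosets.\<close>

definition tractor_metric ::
    "('m \<Rightarrow> 'w \<Rightarrow> 'w \<Rightarrow> real) \<Rightarrow> ('m \<Rightarrow> 'm tvec \<Rightarrow> ('m \<Rightarrow> 'w) \<Rightarrow> 'w) \<Rightarrow> ('m \<Rightarrow> 'w) \<Rightarrow>
     'm \<Rightarrow> 'm tvec \<Rightarrow> 'm tvec \<Rightarrow> real"
  where "tractor_metric h D \<sigma> p v w = h p (D p v \<sigma>) (D p w \<sigma>)"

definition standard_conformal_tractor_bundle ::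
    "('m::topological_space, 'e::euclidean_space) atlas \<Rightarrow>
     ('m \<Rightarrow> 'm tvec \<Rightarrow> 'm tvec \<Rightarrow> real) set \<Rightarrow>
     ('m, 'w::real_vector, 'f::euclidean_space) vbundle \<Rightarrow> ('m \<Rightarrow> 'w set) \<Rightarrow>
     ('m \<Rightarrow> 'w \<Rightarrow> 'w \<Rightarrow> real) \<Rightarrow> ('m \<Rightarrow> 'm tvec \<Rightarrow> ('m \<Rightarrow> 'w) \<Rightarrow> 'w) \<Rightarrow> bool"
  where "standard_conformal_tractor_bundle A c B L h D \<longleftrightarrow>
    conformal_tractor_bundle A B L h \<and> tractor_connection A B L h D \<and>
    (\<forall>U \<sigma>. open_in A U \<and> line_section A B L U \<sigma> \<and> (\<forall>p\<in>U. \<sigma> p \<noteq> 0) \<longrightarrow>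
       (\<forall>g\<in>c. conformal_on A U g (tractor_metric h D \<sigma>)))"

text \<open>The endomorphism of the tangent space that corresponds, via beta evaluated at a nonvanishing
  local section \<open>\<sigma>\<close> of the line, to the one induced by R(v,w) on the quotient: its value at z is
  the y with beta(y)(\<open>\<sigma>\<close>) = R(v,w) beta(z)(\<open>\<sigma>\<close>).\<close>

definition tractor_weyl ::
    "('m::topological_space, 'e::euclidean_space) atlas \<Rightarrow>
     ('m, 'w::real_vector, 'f::euclidean_space) vbundle \<Rightarrow> ('m \<Rightarrow> 'w set) \<Rightarrow>
     ('m \<Rightarrow> 'm tvec \<Rightarrow> ('m \<Rightarrow> 'w) \<Rightarrow> 'w) \<Rightarrow> 'm \<Rightarrow> 'm tvec \<Rightarrow> 'm tvec \<Rightarrow> 'm tvec \<Rightarrow> 'm tvec"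
  where "tractor_weyl A B L D p v w z = (THE y. y \<in> tangent_space A p \<and>
    (\<exists>U \<sigma>. open_in A U \<and> p \<in> U \<and> line_section A B L U \<sigma> \<and> \<sigma> p \<noteq> 0 \<and>
       line_coset L p (D p y \<sigma>) = line_coset L p (curvature A B D p v w (D p z \<sigma>))))"

definition normal_conformal_tractor_bundle ::
    "('m::topological_space, 'e::euclidean_space) atlas \<Rightarrow>
     ('m \<Rightarrow> 'm tvec \<Rightarrow> 'm tvec \<Rightarrow> real) set \<Rightarrow>
     ('m, 'w::real_vector, 'f::euclidean_space) vbundle \<Rightarrow> ('m \<Rightarrow> 'w set) \<Rightarrow>
     ('m \<Rightarrow> 'w \<Rightarrow> 'w \<Rightarrow> real) \<Rightarrow> ('m \<Rightarrow> 'm tvec \<Rightarrow> ('m \<Rightarrow> 'w) \<Rightarrow> 'w) \<Rightarrow> bool"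
  where "normal_conformal_tractor_bundle A c B L h D \<longleftrightarrow>
    standard_conformal_tractor_bundle A c B L h D \<and>
    (\<forall>p\<in>carrier A. \<forall>v\<in>tangent_space A p. \<forall>w\<in>tangent_space A p. \<forall>x\<in>span (L p).
       curvature A B D p v w x \<in> span (L p)) \<and>
    (\<forall>p\<in>carrier A. \<forall>w\<in>tangent_space A p. \<forall>z\<in>tangent_space A p.
       trace_on (tangent_space A p) (\<lambda>v. tractor_weyl A B L D p v w z) = 0)"

section \<open>Admissible families and the Lorentzian manifold\<close>

definition admissible_family ::
    "('m::topological_space, 'e::euclidean_space) atlas \<Rightarrow>
     ('m \<Rightarrow> 'm tvec \<Rightarrow> 'm tvec \<Rightarrow> real) set \<Rightarrow> (real \<Rightarrow> 'm \<Rightarrow> 'm tvec \<Rightarrow> 'm tvec) \<Rightarrow> real \<Rightarrow> bool"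
  where "admissible_family A c \<gamma> \<delta> \<longleftrightarrow>
    (\<forall>r. \<forall>p\<in>carrier A. lin_on (tangent_space A p) (\<gamma> r p) \<and>
       \<gamma> r p ` tangent_space A p \<subseteq> tangent_space A p) \<and>
    (\<forall>U V. open_in A U \<and> smooth_section A (tangent_bundle A) U V \<longrightarrow>
       (\<forall>(W, \<Theta>)\<in>trivs (tangent_bundle A).
          smooth_fun (prod_atlas (open_atlas (UNIV :: real set)) A) (UNIV \<times> (U \<inter> W))
            (\<lambda>(r, p). \<Theta> p (\<gamma> r p (V p))))) \<and>
    (\<forall>g\<in>c. \<forall>r. \<forall>p\<in>carrier A. \<forall>v\<in>tangent_space A p. \<forall>w\<in>tangent_space A p.
       g p (\<gamma> r p v) w = g p v (\<gamma> r p w)) \<and>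
    (\<forall>p\<in>carrier A. \<forall>v\<in>tangent_space A p. \<gamma> 0 p v = v) \<and>
    \<delta> > 0 \<and>
    (\<forall>r. \<bar>r\<bar> < \<delta> \<longrightarrow>
       (\<forall>p\<in>carrier A. bij_betw (\<gamma> r p) (tangent_space A p) (tangent_space A p)))"

text \<open>The limit of the difference quotients in the finite-dimensional tangent space is taken
  pointwise, on each function f.\<close>

definition family_deriv ::
    "(real \<Rightarrow> 'm \<Rightarrow> 'm tvec \<Rightarrow> 'm tvec) \<Rightarrow> real \<Rightarrow> 'm \<Rightarrow> 'm tvec \<Rightarrow> 'm tvec"
  where "family_deriv \<gamma> r p v =
    (\<lambda>f. Lim (at 0) (\<lambda>\<epsilon>. (\<gamma> (r + \<epsilon>) p v f - \<gamma> r p v f) / \<epsilon>))"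

definition ambient_atlas ::
    "('m, 'e::euclidean_space) atlas \<Rightarrow> real \<Rightarrow> (real \<times> real \<times> 'm, real \<times> real \<times> 'e) atlas"
  where "ambient_atlas A \<delta> =
    prod_atlas (open_atlas {0<..}) (prod_atlas (open_atlas {-\<delta><..<\<delta>}) A)"

text \<open>The differential of a function f evaluated on X is X f, so the first two summands are
  the symmetrized tensor product of d(rt) and dt.\<close>

definition ambient_metric ::
    "('m::topological_space, 'e::euclidean_space) atlas \<Rightarrow>
     ('m \<Rightarrow> 'm tvec \<Rightarrow> 'm tvec \<Rightarrow> real) \<Rightarrow> (real \<Rightarrow> 'm \<Rightarrow> 'm tvec \<Rightarrow> 'm tvec) \<Rightarrow>
     real \<times> real \<times> 'm \<Rightarrow> (real \<times> real \<times> 'm) tvec \<Rightarrow> (real \<times> real \<times> 'm) tvec \<Rightarrow> real"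
  where "ambient_metric A g \<gamma> = (\<lambda>(t, r, x) X Y.
     X (\<lambda>(t, r, x). r * t) * Y (\<lambda>(t, r, x). t) +
     X (\<lambda>(t, r, x). t) * Y (\<lambda>(t, r, x). r * t) +
     t\<^sup>2 * g x (\<gamma> r x (differential A (\<lambda>(t, r, x). x) (t, r, x) X))
              (differential A (\<lambda>(t, r, x). x) (t, r, x) Y))"

definition ambient_dt ::
    "('m::topological_space, 'e::euclidean_space) atlas \<Rightarrow> real \<Rightarrow>
     real \<times> real \<times> 'm \<Rightarrow> (real \<times> real \<times> 'm) tvec"
  where "ambient_dt A \<delta> = (\<lambda>(t, r, x) f.
     if smooth_near (ambient_atlas A \<delta>) (t, r, x) f then deriv (\<lambda>s. f (s, r, x)) t else 0)"

definition Psi :: "('m \<Rightarrow> real) \<Rightarrow> 'm \<Rightarrow> real \<times> real \<times> 'm"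
  where "Psi u x = (exp (u x), 0, x)"

definition xi ::
    "('m::topological_space, 'e::euclidean_space) atlas \<Rightarrow> real \<Rightarrow> ('m \<Rightarrow> real) \<Rightarrow>
     'm \<Rightarrow> (real \<times> real \<times> 'm) tvec"
  where "xi A \<delta> u x = exp (u x) *\<^sub>R ambient_dt A \<delta> (Psi u x)"

definition ray :: "('m \<Rightarrow> 'w::real_vector) \<Rightarrow> 'm \<Rightarrow> 'w set"
  where "ray \<xi> p = {a *\<^sub>R \<xi> p |a. a > 0}"

end

(* With S half the derivative of \<gamma> at r = 0, the Koszul formula determines the Levi-Civita connection of the ambient
   metric at the points with r = 0.  In the frame along Psi u obtained from \<partial>_t, \<partial>_r and the horizontal lifts
   by rescaling the last two with exp (- u), the induced connection no longer depends on u: it is the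
   usual tractor connection

     D_v (a, b, Z) = (v a - g(S v, Z), v b - g(v, Z), D_v Z + a v + b S v),

   with S in place of the Schouten endomorphism.  Its curvature annihilates the line spanned by \<xi>, and the
   induced endomorphism W(v, w) of the tangent space is

     z \<mapsto> R(v, w) z - g(S w, z) v + g(S v, z) w - g(w, z) S v + g(v, z) S w,

   so that the normalization condition reads Ric = (n - 2) g(S -, -) + trace(S) g.  For n = 2 this is
   K = trace(S), because Ric = K g; for n >= 3 taking traces gives trace(S) = scal / (2 (n - 1)), that is, g(S -, -) = P. *)

theory Submission
  imports Defs
begin

section \<open>Smooth maps between Euclidean spaces\<close>

text \<open>The connections are given by axioms only, on germs of sections, and
  \<open>curvature\<close> is a definite description over all extensions of three vectors. So
  curvature has no usable value before tensoriality is known, and \<open>D_u\<close> is directly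
  accessible only on restrictions of ambient vector fields. This dictates the test fields: they have
  to live on open sets of the ambient manifold, their brackets should come from M, and they should
  respect the fact that the metric is homogeneous of degree two in t. The fields a t \<partial>_t +
  b \<partial>_r + V have these properties. They also explain the rescaling of the frame: restricted
  to the graph of u and multiplied by exp (- u) they give exactly that frame, and the derivative of
  exp (- u) cancels the motion of the immersion along the Euler field t \<partial>_t. The immersion
  stays inside r = 0, where \<gamma> is the identity. Nondegeneracy and symmetry of the ambient
  metric are therefore established only there, and of the family only the first derivative at r = 0
  can enter.\<close>

lemma frechet_derivative_cong_open:
  assumes "open S" "x \<in> S" "\<And>y. y \<in> S \<Longrightarrow> f y = g y"
  shows "frechet_derivative f (at x) = frechet_derivative g (at x)"
proof -
  have "(f has_derivative D) (at x) \<longleftrightarrow> (g has_derivative D) (at x)" for D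
    using has_derivative_transform_within_open[of f D x UNIV S g]
      has_derivative_transform_within_open[of g D x UNIV S f] assms
    by (metis (full_types))
  \<comment> \<open>\<open>frechet_derivative\<close> is a choice among all derivatives. Equal sets
    of candidates give equal choices, even where there is no derivative at all.\<close>
  then show ?thesis by (simp add: frechet_derivative_def)
qed

lemma frechet_derivative_eqI: "(f has_derivative D) (at x) \<Longrightarrow> frechet_derivative f (at x) = D"
  by (rule frechet_derivative_at[symmetric])

lemma Ck_on_cong:
  assumes "open S" "\<And>y. y \<in> S \<Longrightarrow> f y = g y" "Ck_on k S f"
  shows "Ck_on k S g"
  using assms(2,3)
proof (induction k arbitrary: f g)
  case 0
  then show ?case by (simp cong: continuous_on_cong)
next
  case (Suc k)
  have "f differentiable at x \<Longrightarrow> g differentiable at x" if "x \<in> S" for x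
    using has_derivative_transform_within_open[of f _ x UNIV S g, OF _ assms(1) that Suc.prems(1)]
    unfolding differentiable_def by blast
  moreover have "Ck_on k S (\<lambda>x. frechet_derivative g (at x) v)" for v
  proof (rule Suc.IH)
    show "frechet_derivative f (at y) v = frechet_derivative g (at y) v" if "y \<in> S" for y
      by (simp only: frechet_derivative_cong_open[OF assms(1) that Suc.prems(1)])
  qed (use Suc.prems in simp)
  ultimately show ?case using Suc.prems by simp
qed

lemma Ck_on_subset: "Ck_on k S f \<Longrightarrow> T \<subseteq> S \<Longrightarrow> Ck_on k T f"
  by (induction k arbitrary: f) (auto intro: continuous_on_subset)

lemma Ck_on_Suc_imp: "Ck_on (Suc k) S f \<Longrightarrow> Ck_on k S f"
proof (induction k arbitrary: f)
  case 0
  then show ?case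
    by (auto intro!: continuous_at_imp_continuous_on differentiable_imp_continuous_within)
next
  case (Suc k)
  then show ?case by (metis Ck_on.simps(2))
qed

text \<open>Derivatives are taken at x in the whole space and never within S, so an open
  neighbourhood T decides continuity and differentiability at x. This makes smoothness a pointwise
  matter, which \<open>smooth_fun_iff\<close> exploits.\<close>

lemma Ck_on_local:
  assumes "\<And>x. x \<in> S \<Longrightarrow> \<exists>T. open T \<and> x \<in> T \<and> Ck_on k T f"
  shows "Ck_on k S f"
  using assms
proof (induction k arbitrary: f)
  case 0
  then have "isCont f x" if "x \<in> S" for x
    using that by (force simp: continuous_on_eq_continuous_at)
  then show ?case by (simp add: continuous_at_imp_continuous_on)
next
  case (Suc k)
  have "f differentiable at x" if "x \<in> S" for x
    using Suc.prems[OF that] by auto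
  moreover have "Ck_on k S (\<lambda>x. frechet_derivative f (at x) v)" for v
  proof (rule Suc.IH)
    show "\<exists>T. open T \<and> x \<in> T \<and> Ck_on k T (\<lambda>x. frechet_derivative f (at x) v)" if "x \<in> S" for x
      using Suc.prems[OF that] by auto
  qed
  ultimately show ?case by simp
qed

lemma Ck_on_const: "Ck_on k S (\<lambda>x. c)"
  by (induction k arbitrary: c) (simp_all add: frechet_derivative_const)

lemma Ck_on_bounded_linear: "bounded_linear L \<Longrightarrow> Ck_on k S L"
proof (cases k)
  case (Suc j)
  assume L: "bounded_linear L"
  then have "frechet_derivative L (at x) = L" for x
    by (intro frechet_derivative_eqI bounded_linear_imp_has_derivative)
  with Suc L show ?thesis by (simp add: Ck_on_const bounded_linear_imp_differentiable)
qed (simp add: linear_continuous_on)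

lemma Ck_on_linear_image:
  assumes "open S" "bounded_linear L" "Ck_on k S f"
  shows "Ck_on k S (\<lambda>x. L (f x))"
  using assms(3)
proof (induction k arbitrary: f)
  case 0
  then show ?case by (simp add: assms(2) bounded_linear.continuous_on)
next
  case (Suc k)
  have D: "((\<lambda>x. L (f x)) has_derivative (\<lambda>v. L (frechet_derivative f (at x) v))) (at x)" if "x \<in> S" for x
    using Suc.prems that
    by (auto intro!: bounded_linear.has_derivative[OF assms(2)] simp: frechet_derivative_works[symmetric])
  have "Ck_on k S (\<lambda>x. frechet_derivative (\<lambda>x. L (f x)) (at x) v)" for v
  proof (rule Ck_on_cong[OF assms(1) _ Suc.IH])
    show "L (frechet_derivative f (at y) v) = frechet_derivative (\<lambda>x. L (f x)) (at y) v" if "y \<in> S" for y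
      using frechet_derivative_eqI[OF D[OF that]] by simp
  qed (use Suc.prems in simp)
  then show ?case using D by (auto simp: differentiable_def)
qed

lemma Ck_on_add:
  assumes "open S" "Ck_on k S f" "Ck_on k S g"
  shows "Ck_on k S (\<lambda>x. f x + g x)"
  using assms(2,3)
proof (induction k arbitrary: f g)
  case 0
  then show ?case by (simp add: continuous_on_add)
next
  case (Suc k)
  have D: "((\<lambda>x. f x + g x) has_derivative
      (\<lambda>v. frechet_derivative f (at x) v + frechet_derivative g (at x) v)) (at x)" if "x \<in> S" for x
    using Suc.prems that by (auto intro!: has_derivative_add simp: frechet_derivative_works[symmetric])
  have "Ck_on k S (\<lambda>x. frechet_derivative (\<lambda>x. f x + g x) (at x) v)" for v
  proof (rule Ck_on_cong[OF assms(1) _ Suc.IH])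
    show "frechet_derivative f (at y) v + frechet_derivative g (at y) v
        = frechet_derivative (\<lambda>x. f x + g x) (at y) v" if "y \<in> S" for y
      using frechet_derivative_eqI[OF D[OF that]] by simp
  qed (use Suc.prems in simp_all)
  then show ?case using D by (auto simp: differentiable_def)
qed

lemma Ck_on_sum:
  assumes "open S" "\<And>i. i \<in> I \<Longrightarrow> Ck_on k S (f i)"
  shows "Ck_on k S (\<lambda>x. \<Sum>i\<in>I. f i x)"
  using assms(2) by (induction I rule: infinite_finite_induct) (simp_all add: Ck_on_const Ck_on_add[OF assms(1)])

text \<open>The product rule writes the derivative as two bilinear terms of the same kind. The
  factor that is not differentiated has one order to spare, hence the use of
  \<open>Ck_on_Suc_imp\<close>. A general bilinear map serves multiplication and scaling
  alike.\<close>

lemma Ck_on_bilinear: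
  assumes "open S" "bounded_bilinear B" "Ck_on k S f" "Ck_on k S g"
  shows "Ck_on k S (\<lambda>x. B (f x) (g x))"
  using assms(3,4)
proof (induction k arbitrary: f g)
  case 0
  then show ?case by (simp add: bounded_bilinear.continuous_on[OF assms(2)])
next
  case (Suc k)
  have D: "((\<lambda>x. B (f x) (g x)) has_derivative
      (\<lambda>v. B (f x) (frechet_derivative g (at x) v) + B (frechet_derivative f (at x) v) (g x))) (at x)"
    if "x \<in> S" for x
    using Suc.prems that
    by (auto intro!: bounded_bilinear.FDERIV[OF assms(2)] simp: frechet_derivative_works[symmetric])
  have "Ck_on k S (\<lambda>x. frechet_derivative (\<lambda>x. B (f x) (g x)) (at x) v)" for v
  proof (rule Ck_on_cong[OF assms(1)])
    show "B (f y) (frechet_derivative g (at y) v) + B (frechet_derivative f (at y) v) (g y)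
        = frechet_derivative (\<lambda>x. B (f x) (g x)) (at y) v" if "y \<in> S" for y
      using frechet_derivative_eqI[OF D[OF that]] by simp
    show "Ck_on k S (\<lambda>y. B (f y) (frechet_derivative g (at y) v)
        + B (frechet_derivative f (at y) v) (g y))"
      using Suc.prems by (intro Ck_on_add[OF assms(1)] Suc.IH Ck_on_Suc_imp[of k S f] Ck_on_Suc_imp[of k S g]) auto
  qed
  then show ?case using D by (auto simp: differentiable_def)
qed

lemma linear_basis_expansion:
  fixes w :: "'a::euclidean_space"
  assumes "linear L" shows "L w = (\<Sum>b\<in>Basis. (w \<bullet> b) *\<^sub>R L b)"
proof -
  have "L w = L (\<Sum>b\<in>Basis. (w \<bullet> b) *\<^sub>R b)" by (simp add: euclidean_representation)
  also have "\<dots> = (\<Sum>b\<in>Basis. (w \<bullet> b) *\<^sub>R L b)"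
    by (simp add: linear_sum[OF assms] linear_cmul[OF assms])
  finally show ?thesis .
qed

text \<open>The chain rule evaluates the derivative of g in the direction Df(v), which moves with x,
  whereas \<open>Ck_on\<close> controls only fixed directions. Expanding Df(v) in
  \<open>Basis\<close> separates scalar coefficients from derivatives of g in fixed directions, and
  the induction hypothesis composes the latter with f.\<close>

lemma Ck_on_compose:
  fixes f :: "'a::euclidean_space \<Rightarrow> 'b::euclidean_space" and g :: "'b \<Rightarrow> 'c::real_normed_vector"
  assumes "open S" "open T" "f ` S \<subseteq> T" "Ck_on k S f" "Ck_on k T g"
  shows "Ck_on k S (\<lambda>x. g (f x))"
  using assms(4,5)
proof (induction k arbitrary: g)
  case 0
  then show ?case using assms(3) by (auto intro: continuous_on_compose2)
next
  case (Suc k)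
  have D: "((\<lambda>x. g (f x)) has_derivative
      (\<lambda>v. frechet_derivative g (at (f x)) (frechet_derivative f (at x) v))) (at x)" if "x \<in> S" for x
  proof -
    have "(f has_derivative frechet_derivative f (at x)) (at x)"
      using Suc.prems that by (simp add: frechet_derivative_works[symmetric])
    moreover have "(g has_derivative frechet_derivative g (at (f x))) (at (f x))"
      using Suc.prems that assms(3) by (auto simp: frechet_derivative_works[symmetric])
    ultimately show ?thesis by (rule has_derivative_compose)
  qed
  have lin: "linear (frechet_derivative g (at (f x)))" if "x \<in> S" for x
    using Suc.prems that assms(3) by (auto intro!: linear_frechet_derivative)
  have "Ck_on k S (\<lambda>x. frechet_derivative (\<lambda>x. g (f x)) (at x) v)" for v
  proof (rule Ck_on_cong[OF assms(1)])
    show "(\<Sum>b\<in>Basis. (frechet_derivative f (at y) v \<bullet> b) *\<^sub>R frechet_derivative g (at (f y)) b)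
        = frechet_derivative (\<lambda>x. g (f x)) (at y) v" if "y \<in> S" for y
      unfolding frechet_derivative_eqI[OF D[OF that]]
      by (rule linear_basis_expansion[OF lin[OF that], symmetric])
    show "Ck_on k S (\<lambda>y. \<Sum>b\<in>Basis. (frechet_derivative f (at y) v \<bullet> b) *\<^sub>R frechet_derivative g (at (f y)) b)"
    proof (intro Ck_on_sum[OF assms(1)] Ck_on_bilinear[OF assms(1) bounded_bilinear_scaleR])
      fix b :: 'b
      show "Ck_on k S (\<lambda>y. frechet_derivative f (at y) v \<bullet> b)"
        using Suc.prems by (intro Ck_on_linear_image[OF assms(1) bounded_linear_inner_left]) simp
      have "Ck_on k S f" using Suc.prems(1) by (rule Ck_on_Suc_imp)
      then show "Ck_on k S (\<lambda>y. frechet_derivative g (at (f y)) b)"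
        by (rule Suc.IH) (use Suc.prems(2) in simp)
    qed
  qed
  then show ?case using D by (auto simp: differentiable_def)
qed

lemma smooth_on_cong:
  "\<lbrakk>open S; \<And>y. y \<in> S \<Longrightarrow> f y = g y; smooth_on S f\<rbrakk> \<Longrightarrow> smooth_on S g"
  unfolding smooth_on_def using Ck_on_cong by blast

lemma smooth_on_subset: "smooth_on S f \<Longrightarrow> T \<subseteq> S \<Longrightarrow> smooth_on T f"
  unfolding smooth_on_def using Ck_on_subset by blast

lemma smooth_on_local:
  assumes "\<And>x. x \<in> S \<Longrightarrow> \<exists>T. open T \<and> x \<in> T \<and> smooth_on T f"
  shows "smooth_on S f"
  unfolding smooth_on_def
proof
  show "Ck_on k S f" for k
    using assms by (intro Ck_on_local) (metis smooth_on_def)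
qed

lemma smooth_on_const: "smooth_on S (\<lambda>x. c)"
  by (simp add: smooth_on_def Ck_on_const)

lemma smooth_on_bounded_linear: "bounded_linear L \<Longrightarrow> smooth_on S L"
  by (simp add: smooth_on_def Ck_on_bounded_linear)

lemma smooth_on_id: "smooth_on S (\<lambda>x. x)"
  by (rule smooth_on_bounded_linear[OF bounded_linear_ident])

lemma smooth_on_linear_image:
  "\<lbrakk>open S; bounded_linear L; smooth_on S f\<rbrakk> \<Longrightarrow> smooth_on S (\<lambda>x. L (f x))"
  by (simp add: smooth_on_def Ck_on_linear_image)

lemma smooth_on_add: "\<lbrakk>open S; smooth_on S f; smooth_on S g\<rbrakk> \<Longrightarrow> smooth_on S (\<lambda>x. f x + g x)"
  by (simp add: smooth_on_def Ck_on_add)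

lemma smooth_on_sum:
  "\<lbrakk>open S; \<And>i. i \<in> I \<Longrightarrow> smooth_on S (f i)\<rbrakk> \<Longrightarrow> smooth_on S (\<lambda>x. \<Sum>i\<in>I. f i x)"
  by (simp add: smooth_on_def Ck_on_sum)

lemma smooth_on_bilinear:
  "\<lbrakk>open S; bounded_bilinear B; smooth_on S f; smooth_on S g\<rbrakk> \<Longrightarrow> smooth_on S (\<lambda>x. B (f x) (g x))"
  by (simp add: smooth_on_def Ck_on_bilinear)

lemma smooth_on_compose:
  fixes f :: "'a::euclidean_space \<Rightarrow> 'b::euclidean_space" and g :: "'b \<Rightarrow> 'c::real_normed_vector"
  shows "\<lbrakk>open S; open T; f ` S \<subseteq> T; smooth_on S f; smooth_on T g\<rbrakk> \<Longrightarrow> smooth_on S (\<lambda>x. g (f x))"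
  using Ck_on_compose unfolding smooth_on_def by blast

lemma smooth_on_Pair:
  assumes "open S" "smooth_on S f" "smooth_on S g"
  shows "smooth_on S (\<lambda>x. (f x, g x))"
proof -
  have "smooth_on S (\<lambda>x. (f x, 0) + (0, g x))"
    by (intro smooth_on_add smooth_on_linear_image[of S "\<lambda>y. (y, 0)"]
        smooth_on_linear_image[of S "\<lambda>y. (0, y)"] assms bounded_linear_Pair bounded_linear_ident
        bounded_linear_zero)
  then show ?thesis by simp
qed

lemma smooth_on_continuous: "smooth_on S f \<Longrightarrow> continuous_on S f"
  unfolding smooth_on_def by (metis Ck_on.simps(1))

lemma smooth_on_differentiable: "smooth_on S f \<Longrightarrow> x \<in> S \<Longrightarrow> f differentiable at x"
  unfolding smooth_on_def by (metis Ck_on.simps(2))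

lemma smooth_on_has_derivative:
  "smooth_on S f \<Longrightarrow> x \<in> S \<Longrightarrow> (f has_derivative frechet_derivative f (at x)) (at x)"
  using smooth_on_differentiable frechet_derivative_works by blast

lemma smooth_on_derivative: "smooth_on S f \<Longrightarrow> smooth_on S (\<lambda>x. frechet_derivative f (at x) v)"
  unfolding smooth_on_def by (metis Ck_on.simps(2))

text \<open>The same expansion in \<open>Basis\<close> handles a direction that depends on the
  point. It is what makes the action of a smooth vector field on a smooth function smooth.\<close>

lemma smooth_on_derivative_field:
  fixes f :: "'a::euclidean_space \<Rightarrow> 'b::real_normed_vector"
  assumes "open S" "smooth_on S f" "smooth_on S w"
  shows "smooth_on S (\<lambda>x. frechet_derivative f (at x) (w x))"
proof (rule smooth_on_cong[OF assms(1)])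
  show "(\<Sum>b\<in>Basis. (w y \<bullet> b) *\<^sub>R frechet_derivative f (at y) b) = frechet_derivative f (at y) (w y)"
    if "y \<in> S" for y
    using linear_basis_expansion[OF linear_frechet_derivative[OF smooth_on_differentiable[OF assms(2) that]], of "w y"]
    by simp
  show "smooth_on S (\<lambda>y. \<Sum>b\<in>Basis. (w y \<bullet> b) *\<^sub>R frechet_derivative f (at y) b)"
    by (intro smooth_on_sum smooth_on_bilinear[OF _ bounded_bilinear_scaleR] assms smooth_on_derivative
        smooth_on_linear_image[OF _ bounded_linear_inner_left])
qed

text \<open>The derivative in a fixed direction is a constant multiple of \<open>exp\<close> itself,
  so the induction closes; for \<open>inverse\<close> below it is a constant multiple of its
  square.\<close>

lemma smooth_on_exp: "smooth_on S (exp :: real \<Rightarrow> real)"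
proof -
  have D: "frechet_derivative exp (at x) v = exp x * v" for x v :: real
  proof -
    have "(exp has_derivative (\<lambda>v. exp x * v)) (at x)"
      using DERIV_exp[of x] by (simp add: has_field_derivative_def)
    then show ?thesis by (simp add: frechet_derivative_eqI)
  qed
  have "Ck_on k UNIV (exp :: real \<Rightarrow> real)" for k
  proof (induction k)
    case (Suc k)
    have "Ck_on k UNIV (\<lambda>x. exp x * v :: real)" for v
      by (intro Ck_on_bilinear[OF _ bounded_bilinear_mult] Suc Ck_on_const) simp
    moreover have "exp differentiable at x" for x :: real
      using DERIV_exp[of x] by (auto simp: has_field_derivative_def differentiable_def)
    ultimately show ?case by (simp add: D)
  qed (simp add: continuous_on_exp)
  then show ?thesis unfolding smooth_on_def using Ck_on_subset by blast
qed

lemma smooth_on_inverse: "smooth_on (- {0}) (inverse :: real \<Rightarrow> real)"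
proof -
  have d: "(inverse has_derivative (\<lambda>v. - (inverse x * v * inverse x))) (at x)" if "x \<noteq> 0" for x :: real
    using that by (rule has_derivative_inverse')
  have "Ck_on k (- {0}) (inverse :: real \<Rightarrow> real)" for k
  proof (induction k)
    case 0
    show ?case by (simp add: continuous_on_inverse)
  next
    case (Suc k)
    have o: "open (- {0} :: real set)" by (rule open_Compl) simp
    have "Ck_on k (- {0}) (\<lambda>x. frechet_derivative inverse (at x) v)" for v :: real
    proof (rule Ck_on_cong[OF o])
      show "- v * (inverse x * inverse x) = frechet_derivative inverse (at x) v" if "x \<in> - {0}" for x
        using frechet_derivative_eqI[OF d] that by simp
      show "Ck_on k (- {0}) (\<lambda>x. - v * (inverse x * inverse x))"
        by (intro Ck_on_bilinear[OF o bounded_bilinear_mult] Suc Ck_on_const)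
    qed
    then show ?case using d by (auto simp: differentiable_def)
  qed
  then show ?thesis by (simp add: smooth_on_def)
qed

text \<open>The derivative is a multiple of \<open>inverse\<close>, already known to be smooth, so a
  case distinction replaces the induction. The logarithm serves to write a conformal factor as an
  exponential.\<close>

lemma smooth_on_ln: "smooth_on {0<..} (ln :: real \<Rightarrow> real)"
proof -
  have d: "(ln has_derivative (\<lambda>v. inverse x * v)) (at x)" if "x > 0" for x :: real
    using DERIV_ln[OF that] by (simp add: has_field_derivative_def)
  have "Ck_on k {0<..} (ln :: real \<Rightarrow> real)" for k
  proof (cases k)
    case 0
    show ?thesis unfolding 0 by (auto intro!: continuous_on_ln continuous_on_id)
  next
    case (Suc j)
    have "Ck_on j {0<..} (\<lambda>x. frechet_derivative ln (at x) v)" for v :: real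
    proof (rule Ck_on_cong)
      show "inverse x * v = frechet_derivative ln (at x) v" if "x \<in> {0<..}" for x
        using frechet_derivative_eqI[OF d] that by simp
      have "Ck_on j {0<..} (inverse :: real \<Rightarrow> real)"
        using smooth_on_inverse unfolding smooth_on_def by (rule allE) (auto intro: Ck_on_subset)
      then show "Ck_on j {0<..} (\<lambda>x. inverse x * v)"
        by (intro Ck_on_bilinear[OF _ bounded_bilinear_mult] Ck_on_const) simp_all
    qed simp
    then show ?thesis using d Suc by (auto simp: differentiable_def)
  qed
  then show ?thesis by (simp add: smooth_on_def)
qed

section \<open>Smooth functions and tangent vectors on a manifold\<close>

lemma sum_fun_apply: "(\<Sum>i\<in>I. f i) x = (\<Sum>i\<in>I. f i x)" for f :: "'i \<Rightarrow> 'a \<Rightarrow> 'b::comm_monoid_add"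
  by (induction I rule: infinite_finite_induct) simp_all

lemma scaleR_fun_apply: "(c *\<^sub>R f) x = c *\<^sub>R f x" for f :: "'a \<Rightarrow> 'b::real_vector"
  by (simp add: scaleR_fun_def)

text \<open>\<open>smooth_near\<close> for values in any normed space, as charts and components of
  sections require.\<close>

definition smooth_at ::
    "('m::topological_space, 'e::euclidean_space) atlas \<Rightarrow> 'm \<Rightarrow> ('m \<Rightarrow> 'b::real_normed_vector) \<Rightarrow> bool"
  where "smooth_at A p f \<longleftrightarrow> (\<exists>U. open_in A U \<and> p \<in> U \<and> smooth_fun A U f)"

lemma smooth_near_eq: "smooth_near A p f \<longleftrightarrow> smooth_at A p f"
  by (simp add: smooth_near_def smooth_at_def)

definition chart_tvec ::
    "('m::topological_space, 'e::euclidean_space) atlas \<Rightarrow> 'm set \<Rightarrow> ('m \<Rightarrow> 'e) \<Rightarrow> 'm \<Rightarrow> 'e \<Rightarrow> 'm tvec"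
  where "chart_tvec A U \<phi> p v =
    (\<lambda>f. if smooth_at A p f then frechet_derivative (f \<circ> inv_into U \<phi>) (at (\<phi> p)) v else 0)"

lemma tangent_space_eq: "tangent_space A p = (\<Union>(U, \<phi>)\<in>{(U, \<phi>) \<in> A. p \<in> U}. range (chart_tvec A U \<phi> p))"
  by (force simp: tangent_space_def chart_tvec_def smooth_near_eq)

lemma smooth_fun_subset: "smooth_fun A U f \<Longrightarrow> U' \<subseteq> U \<Longrightarrow> smooth_fun A U' f"
  unfolding smooth_fun_def by (fast intro: smooth_on_subset)

lemma smooth_section_subset: "smooth_section A B U s \<Longrightarrow> U' \<subseteq> U \<Longrightarrow> smooth_section A B U' s"
  unfolding smooth_section_def by (fast intro: smooth_fun_subset)

lemma open_in_Int: "open_in A U \<Longrightarrow> open_in A V \<Longrightarrow> open_in A (U \<inter> V)"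
  by (auto simp: open_in_def)

lemma smooth_at_carrier: "smooth_at A p f \<Longrightarrow> p \<in> carrier A"
  by (auto simp: smooth_at_def open_in_def)

lemma smooth_at_eventually: "smooth_at A p f \<Longrightarrow> \<forall>\<^sub>F q in nhds p. smooth_at A q f"
  unfolding smooth_at_def eventually_nhds open_in_def by blast

lemma section_near_carrier: "section_near A B p f \<Longrightarrow> p \<in> carrier A"
  by (auto simp: section_near_def open_in_def)

lemma section_near_eventually: "section_near A B p s \<Longrightarrow> \<forall>\<^sub>F q in nhds p. section_near A B q s"
  unfolding section_near_def eventually_nhds open_in_def by blast

lemma section_near_fib: "section_near A B p s \<Longrightarrow> s p \<in> fib B p"
  by (auto simp: section_near_def smooth_section_def)

lemma section_near_connection:
  assumes D: "is_connection A B D"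
    and V: "section_near A (tangent_bundle A) p V" and s: "section_near A B p s"
  shows "section_near A B p (\<lambda>q. D q (V q) s)"
proof -
  obtain U where U: "open_in A U" "p \<in> U" "smooth_section A (tangent_bundle A) U V"
    using V by (auto simp: section_near_def)
  obtain U' where U': "open_in A U'" "p \<in> U'" "smooth_section A B U' s"
    using s by (auto simp: section_near_def)
  have "open_in A (U \<inter> U')" using U U' open_in_Int by blast
  moreover have "smooth_section A (tangent_bundle A) (U \<inter> U') V" "smooth_section A B (U \<inter> U') s"
    using U U' smooth_section_subset by blast+
  ultimately have "smooth_section A B (U \<inter> U') (\<lambda>q. D q (V q) s)"
    using D unfolding is_connection_def by blast
  then show ?thesis
    unfolding section_near_def using \<open>open_in A (U \<inter> U')\<close> U U' by blast
qed

lemma fib_tangent_bundle [simp]: "fib (tangent_bundle A) = tangent_space A"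
  by (simp add: tangent_bundle_def)

lemma trivs_tangent_bundle:
  "trivs (tangent_bundle A) = {(U, \<lambda>p X. \<Sum>b\<in>Basis. X (\<lambda>q. \<phi> q \<bullet> b) *\<^sub>R b) |U \<phi>. (U, \<phi>) \<in> A}"
  by (simp add: tangent_bundle_def)

locale manifold =
  fixes A :: "('m::{t2_space, second_countable_topology}, 'e::euclidean_space) atlas"
  assumes mfd: "smooth_manifold A"
begin

abbreviation TM :: "'m \<Rightarrow> 'm tvec set"
  where "TM \<equiv> tangent_space A"

lemma
  assumes "(U, \<phi>) \<in> A"
  shows chart_open: "open U"
    and chart_image_open: "open (\<phi> ` U)"
    and chart_homeomorphism: "homeomorphism U (\<phi> ` U) \<phi> (inv_into U \<phi>)"
  using mfd assms unfolding smooth_manifold_def by auto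

lemma chart_inv: "(U, \<phi>) \<in> A \<Longrightarrow> q \<in> U \<Longrightarrow> inv_into U \<phi> (\<phi> q) = q"
  using chart_homeomorphism by (auto simp: homeomorphism_def)

lemma chart_inv_mem: "y \<in> \<phi> ` U \<Longrightarrow> inv_into U \<phi> y \<in> U"
  by (rule inv_into_into)

lemma chart_inv2: "y \<in> \<phi> ` U \<Longrightarrow> \<phi> (inv_into U \<phi> y) = y"
  by (rule f_inv_into_f)

lemma chart_subset_carrier: "(U, \<phi>) \<in> A \<Longrightarrow> U \<subseteq> carrier A"
  by (auto simp: carrier_def)

lemma chart_at: assumes "p \<in> carrier A" obtains U \<phi> where "(U, \<phi>) \<in> A" "p \<in> U"
  using assms by (auto simp: carrier_def)

lemma open_carrier: "open (carrier A)"
  unfolding carrier_def using chart_open by (intro open_UN) auto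

lemma chart_image_subset_open:
  assumes "(U, \<phi>) \<in> A" "open W" shows "open (\<phi> ` (U \<inter> W))"
proof -
  have "\<phi> ` (U \<inter> W) = \<phi> ` U \<inter> inv_into U \<phi> -` W"
    using chart_inv[OF assms(1)] by force
  moreover have "continuous_on (\<phi> ` U) (inv_into U \<phi>)"
    using chart_homeomorphism[OF assms(1)] by (simp add: homeomorphism_def)
  ultimately show ?thesis
    using continuous_open_preimage[OF _ chart_image_open[OF assms(1)] assms(2)] by metis
qed

lemma chart_inv_image_open:
  assumes "(U, \<phi>) \<in> A" "open W" "W \<subseteq> \<phi> ` U" shows "open (inv_into U \<phi> ` W)"
proof -
  have "inv_into U \<phi> ` W = U \<inter> \<phi> -` W"
    using chart_inv[OF assms(1)] chart_inv_mem[of _ \<phi> U] chart_inv2[of _ \<phi> U] assms(3) by force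
  moreover have "continuous_on U \<phi>"
    using chart_homeomorphism[OF assms(1)] by (simp add: homeomorphism_def)
  ultimately show ?thesis
    using continuous_open_preimage[OF _ chart_open[OF assms(1)] assms(2)] by metis
qed

lemma transition_smooth:
  "(U, \<phi>) \<in> A \<Longrightarrow> (V, \<psi>) \<in> A \<Longrightarrow> smooth_on (\<phi> ` (U \<inter> V)) (\<psi> \<circ> inv_into U \<phi>)"
  using mfd unfolding smooth_manifold_def by blast

lemma smooth_atE:
  assumes "smooth_at A p f" "(U, \<phi>) \<in> A" "p \<in> U"
  obtains W where "open W" "\<phi> p \<in> W" "W \<subseteq> \<phi> ` U" "smooth_on W (f \<circ> inv_into U \<phi>)"
proof -
  obtain U0 where U0: "open_in A U0" "p \<in> U0" "smooth_fun A U0 f"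
    using assms(1) by (auto simp: smooth_at_def)
  then have "smooth_on (\<phi> ` (U0 \<inter> U)) (f \<circ> inv_into U \<phi>)"
    using assms(2) by (auto simp: smooth_fun_def)
  moreover have "open (\<phi> ` (U0 \<inter> U))"
    using chart_image_subset_open[OF assms(2), of U0] U0 by (simp add: open_in_def Int_commute)
  ultimately show ?thesis using U0 assms that by blast
qed

text \<open>Smoothness in one chart passes to every other chart by composition with a transition
  map. From here on a single chart around p decides.\<close>

lemma smooth_atI:
  assumes c: "(U, \<phi>) \<in> A" "p \<in> U"
    and W: "open W" "\<phi> p \<in> W" "W \<subseteq> \<phi> ` U" "smooth_on W (f \<circ> inv_into U \<phi>)"
  shows "smooth_at A p f"
proof -
  define U0 where "U0 = inv_into U \<phi> ` W"
  have "open U0" using chart_inv_image_open c W by (simp add: U0_def)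
  have "U0 \<subseteq> U" using W chart_inv_mem[of _ \<phi> U] by (auto simp: U0_def)
  have "p \<in> U0" using chart_inv[OF c] W by (force simp: U0_def)
  have "smooth_on (\<theta> ` (U0 \<inter> V)) (f \<circ> inv_into V \<theta>)" if d: "(V, \<theta>) \<in> A" for V \<theta>
  proof -
    have o: "open (\<theta> ` (U0 \<inter> V))"
      using chart_image_subset_open[OF d \<open>open U0\<close>] by (simp add: Int_commute)
    have t: "smooth_on (\<theta> ` (U0 \<inter> V)) (\<phi> \<circ> inv_into V \<theta>)"
      using transition_smooth[OF d c(1)] \<open>U0 \<subseteq> U\<close> by (auto elim!: smooth_on_subset)
    have i: "(\<phi> \<circ> inv_into V \<theta>) ` (\<theta> ` (U0 \<inter> V)) \<subseteq> W"
      using chart_inv[OF d] chart_inv2[of _ \<phi> U] W(3) by (auto simp: U0_def)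
    have "smooth_on (\<theta> ` (U0 \<inter> V)) (\<lambda>y. (f \<circ> inv_into U \<phi>) ((\<phi> \<circ> inv_into V \<theta>) y))"
      by (rule smooth_on_compose[OF o W(1) i t W(4)])
    then show ?thesis
    proof (rule smooth_on_cong[OF o, rotated])
      fix y assume "y \<in> \<theta> ` (U0 \<inter> V)"
      then have "inv_into V \<theta> y \<in> U"
        using chart_inv[OF d] \<open>U0 \<subseteq> U\<close> by auto
      then show "(f \<circ> inv_into U \<phi>) ((\<phi> \<circ> inv_into V \<theta>) y) = (f \<circ> inv_into V \<theta>) y"
        using chart_inv[OF c(1)] by simp
    qed
  qed
  then have "smooth_fun A U0 f" by (auto simp: smooth_fun_def)
  moreover have "open_in A U0"
    using \<open>open U0\<close> \<open>U0 \<subseteq> U\<close> chart_subset_carrier[OF c(1)] by (auto simp: open_in_def)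
  ultimately show ?thesis using \<open>p \<in> U0\<close> by (auto simp: smooth_at_def)
qed

text \<open>With smoothness reduced to a condition at points, later arguments can shrink
  neighbourhoods through \<open>eventually\<close> instead of tracking open sets.\<close>

lemma smooth_fun_iff:
  assumes "open U"
  shows "smooth_fun A U f \<longleftrightarrow> (\<forall>p\<in>U \<inter> carrier A. smooth_at A p f)"
proof
  assume f: "smooth_fun A U f"
  have "open_in A (U \<inter> carrier A)" using assms open_carrier by (auto simp: open_in_def)
  then show "\<forall>p\<in>U \<inter> carrier A. smooth_at A p f"
    unfolding smooth_at_def using smooth_fun_subset[OF f] by blast
next
  assume f: "\<forall>p\<in>U \<inter> carrier A. smooth_at A p f"
  have "smooth_on (\<phi> ` (U \<inter> V)) (f \<circ> inv_into V \<phi>)" if c: "(V, \<phi>) \<in> A" for V \<phi>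
  proof (rule smooth_on_local)
    fix x assume "x \<in> \<phi> ` (U \<inter> V)"
    then obtain p where p: "p \<in> U" "p \<in> V" "x = \<phi> p" by blast
    then have "smooth_at A p f" using f chart_subset_carrier[OF c] by blast
    then show "\<exists>T. open T \<and> x \<in> T \<and> smooth_on T (f \<circ> inv_into V \<phi>)"
      using smooth_atE[OF _ c p(2)] p(3) by metis
  qed
  then show "smooth_fun A U f" by (auto simp: smooth_fun_def)
qed

lemma smooth_at_cong:
  assumes "smooth_at A p f" "\<forall>\<^sub>F q in nhds p. f q = h q"
  shows "smooth_at A p h"
proof -
  obtain U \<phi> where c: "(U, \<phi>) \<in> A" "p \<in> U"
    using chart_at smooth_at_carrier assms(1) by blast
  obtain W where W: "open W" "\<phi> p \<in> W" "W \<subseteq> \<phi> ` U" "smooth_on W (f \<circ> inv_into U \<phi>)"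
    using smooth_atE[OF assms(1) c] .
  obtain N where N: "open N" "p \<in> N" "\<And>q. q \<in> N \<Longrightarrow> f q = h q"
    using assms(2) by (auto simp: eventually_nhds)
  show ?thesis
  proof (rule smooth_atI[OF c])
    have "open (\<phi> ` (U \<inter> N))" using chart_image_subset_open[OF c(1) N(1)] .
    then show o': "open (W \<inter> \<phi> ` (U \<inter> N))" using W by blast
    show "\<phi> p \<in> W \<inter> \<phi> ` (U \<inter> N)" "W \<inter> \<phi> ` (U \<inter> N) \<subseteq> \<phi> ` U" using W N c by auto
    show "smooth_on (W \<inter> \<phi> ` (U \<inter> N)) (h \<circ> inv_into U \<phi>)"
    proof (rule smooth_on_cong[OF o'])
      show "smooth_on (W \<inter> \<phi> ` (U \<inter> N)) (f \<circ> inv_into U \<phi>)"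
        using W(4) smooth_on_subset by blast
    qed (use N chart_inv[OF c(1)] in auto)
  qed
qed

lemma smooth_at_const: "p \<in> carrier A \<Longrightarrow> smooth_at A p (\<lambda>q. c)"
proof -
  assume "p \<in> carrier A"
  then obtain U \<phi> where c: "(U, \<phi>) \<in> A" "p \<in> U" by (rule chart_at)
  then show ?thesis
    by (intro smooth_atI[OF c chart_image_open[OF c(1)]]) (auto simp: comp_def smooth_on_const)
qed

lemma smooth_at_bilinear:
  assumes "bounded_bilinear B" "smooth_at A p f" "smooth_at A p h"
  shows "smooth_at A p (\<lambda>q. B (f q) (h q))"
proof -
  obtain U \<phi> where c: "(U, \<phi>) \<in> A" "p \<in> U"
    using chart_at smooth_at_carrier assms(2) by blast
  obtain W where W: "open W" "\<phi> p \<in> W" "W \<subseteq> \<phi> ` U" "smooth_on W (f \<circ> inv_into U \<phi>)"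
    using smooth_atE[OF assms(2) c] .
  obtain W' where W': "open W'" "\<phi> p \<in> W'" "W' \<subseteq> \<phi> ` U" "smooth_on W' (h \<circ> inv_into U \<phi>)"
    using smooth_atE[OF assms(3) c] .
  have "smooth_on (W \<inter> W') (\<lambda>y. B ((f \<circ> inv_into U \<phi>) y) ((h \<circ> inv_into U \<phi>) y))"
    using W(1) W'(1)
    by (intro smooth_on_bilinear[OF _ assms(1) smooth_on_subset[OF W(4)] smooth_on_subset[OF W'(4)]]) auto
  then show ?thesis
    using W W' by (intro smooth_atI[OF c, of "W \<inter> W'"]) (auto simp: comp_def)
qed

lemma smooth_at_add:
  assumes "smooth_at A p f" "smooth_at A p h"
  shows "smooth_at A p (\<lambda>q. f q + h q)"
proof -
  obtain U \<phi> where c: "(U, \<phi>) \<in> A" "p \<in> U"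
    using chart_at smooth_at_carrier assms(2) by blast
  obtain W where W: "open W" "\<phi> p \<in> W" "W \<subseteq> \<phi> ` U" "smooth_on W (f \<circ> inv_into U \<phi>)"
    using smooth_atE[OF assms(1) c] .
  obtain W' where W': "open W'" "\<phi> p \<in> W'" "W' \<subseteq> \<phi> ` U" "smooth_on W' (h \<circ> inv_into U \<phi>)"
    using smooth_atE[OF assms(2) c] .
  have "smooth_on (W \<inter> W') (\<lambda>y. (f \<circ> inv_into U \<phi>) y + (h \<circ> inv_into U \<phi>) y)"
    using W(1) W'(1)
    by (intro smooth_on_add[OF _ smooth_on_subset[OF W(4)] smooth_on_subset[OF W'(4)]]) auto
  then show ?thesis
    using W W' by (intro smooth_atI[OF c, of "W \<inter> W'"]) (auto simp: comp_def)
qed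

lemma smooth_at_compose:
  fixes f :: "'m \<Rightarrow> 'c::euclidean_space"
  assumes "smooth_at A p f" "open T" "f p \<in> T" "smooth_on T h"
  shows "smooth_at A p (\<lambda>q. h (f q))"
proof -
  obtain U \<phi> where c: "(U, \<phi>) \<in> A" "p \<in> U"
    using chart_at smooth_at_carrier assms(1) by blast
  obtain W where W: "open W" "\<phi> p \<in> W" "W \<subseteq> \<phi> ` U" "smooth_on W (f \<circ> inv_into U \<phi>)"
    using smooth_atE[OF assms(1) c] .
  define W' where "W' = W \<inter> (f \<circ> inv_into U \<phi>) -` T"
  have o: "open W'"
    unfolding W'_def by (rule continuous_open_preimage[OF smooth_on_continuous[OF W(4)] W(1) assms(2)])
  have "smooth_on W' (f \<circ> inv_into U \<phi>)"
    using smooth_on_subset[OF W(4)] by (simp add: W'_def)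
  moreover have "(f \<circ> inv_into U \<phi>) ` W' \<subseteq> T" by (auto simp: W'_def)
  ultimately have "smooth_on W' (\<lambda>y. h ((f \<circ> inv_into U \<phi>) y))"
    using smooth_on_compose[OF o assms(2) _ _ assms(4)] by blast
  then show ?thesis
    using W assms(3) chart_inv[OF c]
    by (intro smooth_atI[OF c o]) (auto simp: W'_def comp_def)
qed

lemma smooth_at_linear:
  assumes "bounded_linear L" "smooth_at A p f" shows "smooth_at A p (\<lambda>q. L (f q))"
proof -
  obtain U \<phi> where c: "(U, \<phi>) \<in> A" "p \<in> U"
    using chart_at smooth_at_carrier assms(2) by blast
  obtain W where W: "open W" "\<phi> p \<in> W" "W \<subseteq> \<phi> ` U" "smooth_on W (f \<circ> inv_into U \<phi>)"
    using smooth_atE[OF assms(2) c] .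
  show ?thesis
    using smooth_atI[OF c W(1-3), of "\<lambda>q. L (f q)"] smooth_on_linear_image[OF W(1) assms(1) W(4)]
    by (simp add: comp_def)
qed

lemma smooth_at_sum:
  assumes "p \<in> carrier A" "\<And>i. i \<in> I \<Longrightarrow> smooth_at A p (f i)"
  shows "smooth_at A p (\<lambda>q. \<Sum>i\<in>I. f i q)"
  using assms(2)
  by (induction I rule: infinite_finite_induct) (simp_all add: smooth_at_const[OF assms(1)] smooth_at_add)

lemmas smooth_at_mult = smooth_at_bilinear[OF bounded_bilinear_mult]
lemmas smooth_at_scaleR = smooth_at_bilinear[OF bounded_bilinear_scaleR]

lemma smooth_at_cmult: "smooth_at A p f \<Longrightarrow> smooth_at A p (\<lambda>q. c * f q)" for f :: "'m \<Rightarrow> real"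
  by (intro smooth_at_mult smooth_at_const smooth_at_carrier)

lemma smooth_at_minus: "smooth_at A p f \<Longrightarrow> smooth_at A p (\<lambda>q. - f q)"
  by (intro smooth_at_linear[of uminus] bounded_linear_minus[OF bounded_linear_ident])

lemma smooth_at_diff: "smooth_at A p f \<Longrightarrow> smooth_at A p h \<Longrightarrow> smooth_at A p (\<lambda>q. f q - h q)"
  using smooth_at_add[OF _ smooth_at_minus] by force

lemma smooth_at_exp: "smooth_at A p f \<Longrightarrow> smooth_at A p (\<lambda>q. exp (f q) :: real)"
  by (rule smooth_at_compose[of _ f UNIV]) (auto simp: smooth_on_exp)

lemma smooth_at_ln: "smooth_at A p f \<Longrightarrow> f p > 0 \<Longrightarrow> smooth_at A p (\<lambda>q. ln (f q) :: real)"
  by (rule smooth_at_compose[of _ f "{0<..}"]) (auto simp: smooth_on_ln)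

lemma smooth_at_chart: "(U, \<phi>) \<in> A \<Longrightarrow> p \<in> U \<Longrightarrow> smooth_at A p \<phi>"
proof (rule smooth_atI[of U \<phi>])
  assume c: "(U, \<phi>) \<in> A" "p \<in> U"
  show "smooth_on (\<phi> ` U) (\<phi> \<circ> inv_into U \<phi>)"
    using smooth_on_cong[OF chart_image_open[OF c(1)] _ smooth_on_id] chart_inv2[of _ \<phi> U] by force
qed (auto simp: chart_image_open)

lemma smooth_at_coord: "(U, \<phi>) \<in> A \<Longrightarrow> p \<in> U \<Longrightarrow> smooth_at A p (\<lambda>q. \<phi> q \<bullet> v)"
  by (rule smooth_at_linear[OF bounded_linear_inner_left smooth_at_chart])

end

text \<open>A map between manifolds is used only through its expression in one pair of charts on a
  small \<open>W\<close>; composition in coordinates does the rest. Inclusions of slices and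
  projections of the product manifolds below are all instances.\<close>

lemma smooth_at_map:
  assumes "manifold A" "manifold B"
    and c: "(U, \<phi>) \<in> A" "p \<in> U" and d: "(V, \<theta>) \<in> B"
    and W: "open W" "\<phi> p \<in> W" "W \<subseteq> \<phi> ` U" "\<And>y. y \<in> W \<Longrightarrow> F (inv_into U \<phi> y) \<in> V"
      "smooth_on W (\<lambda>y. \<theta> (F (inv_into U \<phi> y)))"
    and f: "smooth_at B (F p) f"
  shows "smooth_at A p (\<lambda>q. f (F q))"
proof -
  interpret A: manifold A by fact
  interpret B: manifold B by fact
  have Fp: "F p \<in> V" using W(2,4) A.chart_inv[OF c] by force
  obtain T where T: "open T" "\<theta> (F p) \<in> T" "T \<subseteq> \<theta> ` V" "smooth_on T (f \<circ> inv_into V \<theta>)"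
    using B.smooth_atE[OF f d Fp] .
  define W' where "W' = W \<inter> (\<lambda>y. \<theta> (F (inv_into U \<phi> y))) -` T"
  have o: "open W'"
    unfolding W'_def by (rule continuous_open_preimage[OF smooth_on_continuous[OF W(5)] W(1) T(1)])
  have "smooth_on W' (\<lambda>y. \<theta> (F (inv_into U \<phi> y)))"
    using smooth_on_subset[OF W(5)] by (simp add: W'_def)
  moreover have "(\<lambda>y. \<theta> (F (inv_into U \<phi> y))) ` W' \<subseteq> T" by (auto simp: W'_def)
  ultimately have "smooth_on W' (\<lambda>y. (f \<circ> inv_into V \<theta>) (\<theta> (F (inv_into U \<phi> y))))"
    using smooth_on_compose[OF o T(1) _ _ T(4)] by blast
  then have "smooth_on W' ((\<lambda>q. f (F q)) \<circ> inv_into U \<phi>)"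
    by (rule smooth_on_cong[OF o, rotated]) (auto simp: W'_def B.chart_inv[OF d] W(4))
  then show ?thesis
    using o W T A.chart_inv[OF c] by (intro A.smooth_atI[OF c o]) (auto simp: W'_def)
qed

section \<open>Tangent vectors in charts and as derivations\<close>

context manifold begin

lemma chart_comp_differentiable:
  assumes "(U, \<phi>) \<in> A" "p \<in> U" "smooth_at A p f"
  shows "(f \<circ> inv_into U \<phi>) differentiable at (\<phi> p)"
proof -
  obtain W where "open W" "\<phi> p \<in> W" "W \<subseteq> \<phi> ` U" "smooth_on W (f \<circ> inv_into U \<phi>)"
    using smooth_atE[OF assms(3,1,2)] .
  then show ?thesis using smooth_on_differentiable by blast
qed

lemma chart_comp_has_derivative:
  assumes "(U, \<phi>) \<in> A" "p \<in> U" "smooth_at A p f"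
  shows "((f \<circ> inv_into U \<phi>) has_derivative frechet_derivative (f \<circ> inv_into U \<phi>) (at (\<phi> p))) (at (\<phi> p))"
  using chart_comp_differentiable[OF assms] frechet_derivative_works by blast

lemma linear_chart_tvec:
  assumes "(U, \<phi>) \<in> A" "p \<in> U"
  shows "linear (chart_tvec A U \<phi> p)"
proof -
  have l: "linear (frechet_derivative (f \<circ> inv_into U \<phi>) (at (\<phi> p)))" if "smooth_at A p f" for f :: "'m \<Rightarrow> real"
    using chart_comp_differentiable[OF assms that] by (rule linear_frechet_derivative)
  show ?thesis
    by (rule linearI) (auto simp: chart_tvec_def fun_eq_iff scaleR_fun_apply linear_add[OF l] linear_cmul[OF l])
qed

lemma chart_tvec_coord:
  assumes c: "(U, \<phi>) \<in> A" "p \<in> U"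
  shows "chart_tvec A U \<phi> p v (\<lambda>q. \<phi> q \<bullet> w) = v \<bullet> w"
proof -
  have "frechet_derivative ((\<lambda>q. \<phi> q \<bullet> w) \<circ> inv_into U \<phi>) (at (\<phi> p)) = frechet_derivative (\<lambda>y. y \<bullet> w) (at (\<phi> p))"
    by (rule frechet_derivative_cong_open[OF chart_image_open[OF c(1)]])
      (use c chart_inv2[of _ \<phi> U] in auto)
  also have "\<dots> = (\<lambda>v. v \<bullet> w)"
    by (rule frechet_derivative_eqI) (rule bounded_linear_imp_has_derivative[OF bounded_linear_inner_left])
  finally show ?thesis by (simp add: chart_tvec_def smooth_at_coord[OF c])
qed

text \<open>The chain rule for the transition map; functions that are not smooth at p are sent to 0
  by both sides. It follows that one chart already yields the whole tangent space.\<close>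

lemma chart_tvec_change:
  assumes c: "(U, \<phi>) \<in> A" "p \<in> U" and d: "(V, \<theta>) \<in> A" "p \<in> V"
  shows "chart_tvec A V \<theta> p v = chart_tvec A U \<phi> p (frechet_derivative (\<phi> \<circ> inv_into V \<theta>) (at (\<theta> p)) v)"
proof
  fix f
  show "chart_tvec A V \<theta> p v f = chart_tvec A U \<phi> p (frechet_derivative (\<phi> \<circ> inv_into V \<theta>) (at (\<theta> p)) v) f"
  proof (cases "smooth_at A p f")
    case True
    have 1: "((\<phi> \<circ> inv_into V \<theta>) has_derivative frechet_derivative (\<phi> \<circ> inv_into V \<theta>) (at (\<theta> p))) (at (\<theta> p))"
      by (rule chart_comp_has_derivative[OF d smooth_at_chart[OF c]])
    have "(\<phi> \<circ> inv_into V \<theta>) (\<theta> p) = \<phi> p" using chart_inv[OF d] by simp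
    then have 2: "((f \<circ> inv_into U \<phi>) has_derivative frechet_derivative (f \<circ> inv_into U \<phi>) (at (\<phi> p)))
        (at ((\<phi> \<circ> inv_into V \<theta>) (\<theta> p)))"
      using chart_comp_has_derivative[OF c True] by simp
    have "open (\<theta> ` (V \<inter> U))" using chart_image_subset_open[OF d(1) chart_open[OF c(1)]] .
    then have "frechet_derivative (f \<circ> inv_into V \<theta>) (at (\<theta> p)) =
        frechet_derivative (\<lambda>y. (f \<circ> inv_into U \<phi>) ((\<phi> \<circ> inv_into V \<theta>) y)) (at (\<theta> p))"
      by (rule frechet_derivative_cong_open)
        (use c d chart_inv[OF d(1)] chart_inv[OF c(1)] in auto)
    then show ?thesis
      using frechet_derivative_eqI[OF has_derivative_compose[OF 1 2]] by (simp add: chart_tvec_def)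
  qed (simp add: chart_tvec_def)
qed

lemma tangent_space_chart:
  assumes c: "(U, \<phi>) \<in> A" "p \<in> U"
  shows "TM p = range (chart_tvec A U \<phi> p)"
proof (intro equalityI subsetI)
  fix X assume "X \<in> TM p"
  then obtain V \<theta> v where "(V, \<theta>) \<in> A" "p \<in> V" "X = chart_tvec A V \<theta> p v"
    by (auto simp: tangent_space_eq)
  then show "X \<in> range (chart_tvec A U \<phi> p)" using chart_tvec_change[OF c] by simp
qed (use c in \<open>auto simp: tangent_space_eq\<close>)

lemma chart_tvec_in: "(U, \<phi>) \<in> A \<Longrightarrow> p \<in> U \<Longrightarrow> chart_tvec A U \<phi> p v \<in> TM p"
  by (simp add: tangent_space_chart)

lemma tangent_chart_tvec:
  assumes c: "(U, \<phi>) \<in> A" "p \<in> U" and X: "X \<in> TM p"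
  shows "X = chart_tvec A U \<phi> p (\<Sum>b\<in>Basis. X (\<lambda>q. \<phi> q \<bullet> b) *\<^sub>R b)"
proof -
  obtain v where v: "X = chart_tvec A U \<phi> p v" using X tangent_space_chart[OF c] by blast
  show ?thesis by (simp add: v chart_tvec_coord[OF c] euclidean_representation)
qed

lemma tangent_expand:
  assumes c: "(U, \<phi>) \<in> A" "p \<in> U" and X: "X \<in> TM p"
  shows "X = (\<Sum>b\<in>Basis. X (\<lambda>q. \<phi> q \<bullet> b) *\<^sub>R chart_tvec A U \<phi> p b)"
proof -
  have "chart_tvec A U \<phi> p (\<Sum>b\<in>Basis. X (\<lambda>q. \<phi> q \<bullet> b) *\<^sub>R b)
      = (\<Sum>b\<in>Basis. X (\<lambda>q. \<phi> q \<bullet> b) *\<^sub>R chart_tvec A U \<phi> p b)"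
    by (simp add: linear_sum[OF linear_chart_tvec[OF c]] linear_cmul[OF linear_chart_tvec[OF c]])
  then show ?thesis using tangent_chart_tvec[OF assms] by simp
qed

lemma subspace_tangent_space: "p \<in> carrier A \<Longrightarrow> subspace (TM p)"
  by (metis chart_at linear_chart_tvec linear_subspace_image subspace_UNIV tangent_space_chart)

lemma tangent_basis_card:
  assumes "p \<in> carrier A" "independent B" "span B = TM p"
  shows "finite B" "card B = DIM('e)"
proof -
  obtain U \<phi> where c: "(U, \<phi>) \<in> A" "p \<in> U" using chart_at assms(1) by blast
  let ?T = "chart_tvec A U \<phi> p"
  have inj: "inj ?T"
    by (rule injI) (metis chart_tvec_coord[OF c] euclidean_eqI)
  have "independent (?T ` Basis)"
    by (rule linear_independent_injective_image[OF linear_chart_tvec[OF c] independent_Basis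
        inj_on_subset[OF inj subset_UNIV]])
  moreover have "span (?T ` Basis) = TM p"
    using linear_span_image[OF linear_chart_tvec[OF c], of Basis] by (simp add: tangent_space_chart[OF c])
  moreover have "card (?T ` Basis) = DIM('e)" using card_image[OF inj_on_subset[OF inj]] by blast
  ultimately have "dim B = DIM('e)"
    using dim_eq_card[of "?T ` Basis" B] assms(3) by simp
  then show "card B = DIM('e)" using dim_eq_card_independent[OF assms(2)] by simp
  \<comment> \<open>An infinite set has \<open>card\<close> 0, so a positive cardinality forces
    finiteness.\<close>
  then show "finite B" using DIM_positive[where 'a='e] card_gt_0_iff by metis
qed

lemma tangent_apply:
  assumes c: "(U, \<phi>) \<in> A" "p \<in> U" and X: "X \<in> TM p" and f: "smooth_at A p f"
  shows "X f = frechet_derivative (f \<circ> inv_into U \<phi>) (at (\<phi> p)) (\<Sum>b\<in>Basis. X (\<lambda>q. \<phi> q \<bullet> b) *\<^sub>R b)"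
proof -
  define v where "v = (\<Sum>b\<in>Basis. X (\<lambda>q. \<phi> q \<bullet> b) *\<^sub>R b)"
  have "X = chart_tvec A U \<phi> p v" using tangent_chart_tvec[OF c X] by (simp add: v_def)
  then have "X f = chart_tvec A U \<phi> p v f" by simp
  then show ?thesis using f unfolding v_def[symmetric] by (simp add: chart_tvec_def)
qed

lemma tangent_not_smooth: "X \<in> TM p \<Longrightarrow> \<not> smooth_at A p f \<Longrightarrow> X f = 0"
  by (auto simp: tangent_space_eq chart_tvec_def)

lemma tangent_carrier: "X \<in> TM p \<Longrightarrow> p \<in> carrier A"
  by (auto simp: tangent_space_eq carrier_def)

lemma tangent_rep:
  assumes "X \<in> TM p"
  obtains U \<phi> v where "(U, \<phi>) \<in> A" "p \<in> U" "X = chart_tvec A U \<phi> p v"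
  using assms by (auto simp: tangent_space_eq)

text \<open>Tangent vectors act on all functions, but the cut-off to 0 respects germs: f and h are
  either both smooth at p or both not.\<close>

lemma tangent_cong:
  assumes X: "X \<in> TM p" and e: "\<forall>\<^sub>F q in nhds p. f q = h q"
  shows "X f = X h"
proof -
  obtain U \<phi> v where c: "(U, \<phi>) \<in> A" "p \<in> U" and v: "X = chart_tvec A U \<phi> p v"
    using tangent_rep[OF X] .
  have "\<forall>\<^sub>F q in nhds p. h q = f q" using e by eventually_elim simp
  then have s: "smooth_at A p f \<longleftrightarrow> smooth_at A p h" using smooth_at_cong e by blast
  obtain N where N: "open N" "p \<in> N" "\<And>q. q \<in> N \<Longrightarrow> f q = h q"
    using e by (auto simp: eventually_nhds)
  have "frechet_derivative (f \<circ> inv_into U \<phi>) (at (\<phi> p)) = frechet_derivative (h \<circ> inv_into U \<phi>) (at (\<phi> p))"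
    by (rule frechet_derivative_cong_open[OF chart_image_subset_open[OF c(1) N(1)]])
      (use c N chart_inv[OF c(1)] in auto)
  then show ?thesis by (simp add: v chart_tvec_def s)
qed

lemma tangent_add:
  assumes X: "X \<in> TM p" and f: "smooth_at A p f" and h: "smooth_at A p h"
  shows "X (\<lambda>q. f q + h q) = X f + X h"
proof -
  obtain U \<phi> v where c: "(U, \<phi>) \<in> A" "p \<in> U" and v: "X = chart_tvec A U \<phi> p v"
    using tangent_rep[OF X] .
  have "((\<lambda>y. (f \<circ> inv_into U \<phi>) y + (h \<circ> inv_into U \<phi>) y) has_derivative
      (\<lambda>v. frechet_derivative (f \<circ> inv_into U \<phi>) (at (\<phi> p)) v
        + frechet_derivative (h \<circ> inv_into U \<phi>) (at (\<phi> p)) v)) (at (\<phi> p))"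
    by (intro has_derivative_add chart_comp_has_derivative[OF c] f h)
  then have "frechet_derivative ((\<lambda>q. f q + h q) \<circ> inv_into U \<phi>) (at (\<phi> p)) =
      (\<lambda>v. frechet_derivative (f \<circ> inv_into U \<phi>) (at (\<phi> p)) v
        + frechet_derivative (h \<circ> inv_into U \<phi>) (at (\<phi> p)) v)"
    by (intro frechet_derivative_eqI) (simp add: comp_def)
  then show ?thesis by (simp add: v chart_tvec_def f h smooth_at_add)
qed

lemma tangent_mult:
  assumes X: "X \<in> TM p" and f: "smooth_at A p f" and h: "smooth_at A p h"
  shows "X (\<lambda>q. f q * h q) = f p * X h + X f * h p"
proof -
  obtain U \<phi> v where c: "(U, \<phi>) \<in> A" "p \<in> U" and v: "X = chart_tvec A U \<phi> p v"
    using tangent_rep[OF X] .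
  have "((\<lambda>y. (f \<circ> inv_into U \<phi>) y * (h \<circ> inv_into U \<phi>) y) has_derivative
      (\<lambda>v. (f \<circ> inv_into U \<phi>) (\<phi> p) * frechet_derivative (h \<circ> inv_into U \<phi>) (at (\<phi> p)) v
        + frechet_derivative (f \<circ> inv_into U \<phi>) (at (\<phi> p)) v * (h \<circ> inv_into U \<phi>) (\<phi> p))) (at (\<phi> p))"
    by (intro has_derivative_mult chart_comp_has_derivative[OF c] f h)
  then have "frechet_derivative ((\<lambda>q. f q * h q) \<circ> inv_into U \<phi>) (at (\<phi> p)) =
      (\<lambda>v. (f \<circ> inv_into U \<phi>) (\<phi> p) * frechet_derivative (h \<circ> inv_into U \<phi>) (at (\<phi> p)) v
        + frechet_derivative (f \<circ> inv_into U \<phi>) (at (\<phi> p)) v * (h \<circ> inv_into U \<phi>) (\<phi> p))"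
    by (intro frechet_derivative_eqI) (simp add: comp_def)
  then show ?thesis by (simp add: v chart_tvec_def f h smooth_at_mult chart_inv[OF c])
qed

lemma tangent_const: "X \<in> TM p \<Longrightarrow> X (\<lambda>q. c) = 0"
proof -
  assume X: "X \<in> TM p"
  obtain U \<phi> v where "(U, \<phi>) \<in> A" "p \<in> U" and v: "X = chart_tvec A U \<phi> p v"
    using tangent_rep[OF X] .
  show ?thesis by (simp add: v chart_tvec_def comp_def frechet_derivative_const)
qed

lemma tangent_cmult:
  "X \<in> TM p \<Longrightarrow> smooth_at A p f \<Longrightarrow> X (\<lambda>q. c * f q) = c * X f"
  using tangent_mult[of X p "\<lambda>q. c" f] by (simp add: smooth_at_const tangent_carrier tangent_const)

lemma tangent_minus:
  "X \<in> TM p \<Longrightarrow> smooth_at A p f \<Longrightarrow> X (\<lambda>q. - f q) = - X f"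
  using tangent_cmult[of X p f "-1"] by simp

lemma tangent_diff:
  "X \<in> TM p \<Longrightarrow> smooth_at A p f \<Longrightarrow> smooth_at A p h \<Longrightarrow> X (\<lambda>q. f q - h q) = X f - X h"
  using tangent_add[of X p f "\<lambda>q. - h q"] by (simp add: smooth_at_minus tangent_minus)

lemma tangent_exp:
  assumes X: "X \<in> TM p" and f: "smooth_at A p f"
  shows "X (\<lambda>q. exp (f q)) = exp (f p) * X f"
proof -
  obtain U \<phi> v where c: "(U, \<phi>) \<in> A" "p \<in> U" and v: "X = chart_tvec A U \<phi> p v"
    using tangent_rep[OF X] .
  have "((\<lambda>y. exp ((f \<circ> inv_into U \<phi>) y)) has_derivative
      (\<lambda>v. exp ((f \<circ> inv_into U \<phi>) (\<phi> p)) * frechet_derivative (f \<circ> inv_into U \<phi>) (at (\<phi> p)) v)) (at (\<phi> p))"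
    using has_derivative_exp[OF chart_comp_has_derivative[OF c f]] by (simp add: mult.commute)
  then have "frechet_derivative ((\<lambda>q. exp (f q)) \<circ> inv_into U \<phi>) (at (\<phi> p)) =
      (\<lambda>v. exp ((f \<circ> inv_into U \<phi>) (\<phi> p)) * frechet_derivative (f \<circ> inv_into U \<phi>) (at (\<phi> p)) v)"
    by (intro frechet_derivative_eqI) (simp add: comp_def)
  then show ?thesis by (simp add: v chart_tvec_def f smooth_at_exp chart_inv[OF c])
qed

end

section \<open>Vector fields and connections\<close>

lemma
  assumes "lin_on S F"
  shows lin_on_add: "x \<in> S \<Longrightarrow> y \<in> S \<Longrightarrow> F (x + y) = F x + F y"
    and lin_on_scaleR: "x \<in> S \<Longrightarrow> F (c *\<^sub>R x) = c *\<^sub>R F x"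
  using assms by (auto simp: lin_on_def)

lemma lin_on_0: "lin_on S F \<Longrightarrow> subspace S \<Longrightarrow> F 0 = 0"
  using lin_on_scaleR[of S F 0 0] subspace_0 by force

lemma lin_on_minus: "lin_on S F \<Longrightarrow> x \<in> S \<Longrightarrow> F (- x) = - F x"
  using lin_on_scaleR[of S F x "-1"] by simp

lemma lin_on_diff: "lin_on S F \<Longrightarrow> subspace S \<Longrightarrow> x \<in> S \<Longrightarrow> y \<in> S \<Longrightarrow> F (x - y) = F x - F y"
  using lin_on_add[of S F x "- y"] lin_on_minus[of S F y] subspace_neg[of S y] by simp

lemma lin_on_sum:
  assumes "lin_on S F" "subspace S" "\<And>i. i \<in> I \<Longrightarrow> x i \<in> S"
  shows "F (\<Sum>i\<in>I. c i *\<^sub>R x i) = (\<Sum>i\<in>I. c i *\<^sub>R F (x i))"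
  using assms(3)
  by (induction I rule: infinite_finite_induct)
    (simp_all add: lin_on_0[OF assms(1,2)] lin_on_add[OF assms(1)] lin_on_scaleR[OF assms(1)]
      subspace_sum[OF assms(2)] subspace_scale[OF assms(2)])

lemma
  assumes D: "is_connection A B D" and s: "section_near A B p s"
  shows connection_lin_on: "lin_on (tangent_space A p) (\<lambda>v. D p v s)"
    and connection_in_fib: "v \<in> tangent_space A p \<Longrightarrow> D p v s \<in> fib B p"
    and connection_add: "v \<in> tangent_space A p \<Longrightarrow> section_near A B p s' \<Longrightarrow>
      D p v (\<lambda>q. s q + s' q) = D p v s + D p v s'"
    and connection_scaleR: "v \<in> tangent_space A p \<Longrightarrow> smooth_at A p f \<Longrightarrow>
      D p v (\<lambda>q. f q *\<^sub>R s q) = v f *\<^sub>R s p + f p *\<^sub>R D p v s"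
    and connection_cong: "v \<in> tangent_space A p \<Longrightarrow> section_near A B p s' \<Longrightarrow>
      \<forall>\<^sub>F q in nhds p. s q = s' q \<Longrightarrow> D p v s = D p v s'"
  using D s section_near_carrier[OF s] unfolding is_connection_def smooth_near_eq by blast+

context manifold begin

lemma smooth_section_tangent_iff:
  assumes "open U" "U \<subseteq> carrier A"
  shows "smooth_section A (tangent_bundle A) U W \<longleftrightarrow> (\<forall>q\<in>U. W q \<in> TM q \<and>
    (\<forall>(V, \<theta>)\<in>A. q \<in> V \<longrightarrow> smooth_at A q (\<lambda>q'. \<Sum>b\<in>Basis. W q' (\<lambda>x. \<theta> x \<bullet> b) *\<^sub>R b)))"
proof -
  have "smooth_section A (tangent_bundle A) U W \<longleftrightarrow> (\<forall>q\<in>U. W q \<in> TM q) \<and>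
    (\<forall>(V, \<theta>)\<in>A. smooth_fun A (U \<inter> V) (\<lambda>q'. \<Sum>b\<in>Basis. W q' (\<lambda>x. \<theta> x \<bullet> b) *\<^sub>R b))"
    by (force simp: smooth_section_def trivs_tangent_bundle)
  moreover have "smooth_fun A (U \<inter> V) f \<longleftrightarrow> (\<forall>q\<in>U. q \<in> V \<longrightarrow> smooth_at A q f)"
    if "(V, \<theta>) \<in> A" for V \<theta> and f :: "'m \<Rightarrow> 'e"
    using smooth_fun_iff[of "U \<inter> V"] assms chart_open[OF that] by auto
  ultimately show ?thesis by fast
qed

lemma smooth_at_components:
  assumes "\<And>b. b \<in> Basis \<Longrightarrow> smooth_at A p (\<lambda>q. f q b)" "p \<in> carrier A"
  shows "smooth_at A p (\<lambda>q. \<Sum>b\<in>Basis. f q b *\<^sub>R (b :: 'c::euclidean_space))"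
  using assms by (intro smooth_at_sum smooth_at_scaleR smooth_at_const) auto

text \<open>In the chart, \<open>W q f\<close> is the derivative of f in the direction of the
  component vector of W, so \<open>smooth_on_derivative_field\<close> applies.\<close>

lemma smooth_at_field_apply:
  assumes c: "(U, \<phi>) \<in> A" "p \<in> U" and T: "\<forall>\<^sub>F q in nhds p. W q \<in> TM q"
    and sm: "\<And>b. b \<in> Basis \<Longrightarrow> smooth_at A p (\<lambda>q. W q (\<lambda>x. \<phi> x \<bullet> b))"
    and f: "smooth_at A p f"
  shows "smooth_at A p (\<lambda>q. W q f)"
proof -
  define w where "w q = (\<Sum>b\<in>Basis. W q (\<lambda>x. \<phi> x \<bullet> b) *\<^sub>R b)" for q
  have w: "smooth_at A p w"
    unfolding w_def by (rule smooth_at_components[OF sm smooth_at_carrier[OF f]])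
  obtain W1 where W1: "open W1" "\<phi> p \<in> W1" "W1 \<subseteq> \<phi> ` U" "smooth_on W1 (w \<circ> inv_into U \<phi>)"
    using smooth_atE[OF w c] .
  obtain W2 where W2: "open W2" "\<phi> p \<in> W2" "W2 \<subseteq> \<phi> ` U" "smooth_on W2 (f \<circ> inv_into U \<phi>)"
    using smooth_atE[OF f c] .
  obtain N where N: "open N" "p \<in> N" "\<And>q. q \<in> N \<Longrightarrow> W q \<in> TM q"
    using T by (auto simp: eventually_nhds)
  define W' where "W' = W1 \<inter> W2 \<inter> \<phi> ` (U \<inter> N)"
  have o: "open W'"
    unfolding W'_def using W1 W2 chart_image_subset_open[OF c(1) N(1)] by blast
  have "smooth_on W' (\<lambda>y. frechet_derivative (f \<circ> inv_into U \<phi>) (at y) ((w \<circ> inv_into U \<phi>) y))"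
    by (intro smooth_on_derivative_field o smooth_on_subset[OF W1(4)] smooth_on_subset[OF W2(4)])
      (auto simp: W'_def)
  then have "smooth_on W' ((\<lambda>q. W q f) \<circ> inv_into U \<phi>)"
  proof (rule smooth_on_cong[OF o, rotated])
    fix y assume y: "y \<in> W'"
    define q where "q = inv_into U \<phi> y"
    have q: "q \<in> U" "q \<in> N" "\<phi> q = y" "y \<in> W2"
      using y chart_inv[OF c(1)] by (auto simp: W'_def q_def)
    have "smooth_at A q f" using smooth_atI[OF c(1) q(1) W2(1) _ W2(3,4)] q by simp
    then show "frechet_derivative (f \<circ> inv_into U \<phi>) (at y) ((w \<circ> inv_into U \<phi>) y) = ((\<lambda>q. W q f) \<circ> inv_into U \<phi>) y"
      using tangent_apply[OF c(1) q(1) N(3)[OF q(2)]] q by (simp add: w_def q_def[symmetric])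
  qed
  then show ?thesis
    by (rule smooth_atI[OF c o, rotated 2]) (use W1 W2 N c in \<open>auto simp: W'_def\<close>)
qed

section \<open>Germs of smooth vector fields and tensoriality\<close>

abbreviation vfield :: "'m \<Rightarrow> ('m \<Rightarrow> 'm tvec) \<Rightarrow> bool"
  where "vfield p W \<equiv> section_near A (tangent_bundle A) p W"

text \<open>One chart is enough: the components of W in any other chart are its values on the
  coordinate functions of that chart, and \<open>smooth_at_field_apply\<close> covers these.\<close>

lemma vfield_iff:
  assumes c: "(U, \<phi>) \<in> A" "p \<in> U"
  shows "vfield p W \<longleftrightarrow> (\<forall>\<^sub>F q in nhds p. W q \<in> TM q) \<and>
    (\<forall>b\<in>Basis. smooth_at A p (\<lambda>q. W q (\<lambda>x. \<phi> x \<bullet> b)))"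
proof
  assume "vfield p W"
  then obtain N where N: "open_in A N" "p \<in> N" "smooth_section A (tangent_bundle A) N W"
    by (auto simp: section_near_def)
  then have o: "open N" "N \<subseteq> carrier A" by (auto simp: open_in_def)
  have *: "\<forall>q\<in>N. W q \<in> TM q" "smooth_at A p (\<lambda>q. \<Sum>b\<in>Basis. W q (\<lambda>x. \<phi> x \<bullet> b) *\<^sub>R b)"
  proof -
    have "\<forall>q\<in>N. W q \<in> TM q \<and> (\<forall>(V, \<theta>)\<in>A. q \<in> V \<longrightarrow>
        smooth_at A q (\<lambda>q'. \<Sum>b\<in>Basis. W q' (\<lambda>x. \<theta> x \<bullet> b) *\<^sub>R b))"
      using smooth_section_tangent_iff[OF o, of W] N(3) by blast
    note * = this
    show "\<forall>q\<in>N. W q \<in> TM q" using * by blast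
    show "smooth_at A p (\<lambda>q. \<Sum>b\<in>Basis. W q (\<lambda>x. \<phi> x \<bullet> b) *\<^sub>R b)"
      using bspec[OF conjunct2[OF bspec[OF * N(2)]] c(1)] c(2) by simp
  qed
  have "smooth_at A p (\<lambda>q. W q (\<lambda>x. \<phi> x \<bullet> b))" if b: "b \<in> Basis" for b
    using smooth_at_linear[OF bounded_linear_inner_left *(2), of b] b
    by (simp add: inner_sum_left inner_Basis if_distrib cong: if_cong)
  then show "(\<forall>\<^sub>F q in nhds p. W q \<in> TM q) \<and>
    (\<forall>b\<in>Basis. smooth_at A p (\<lambda>q. W q (\<lambda>x. \<phi> x \<bullet> b)))"
    using * o N by (auto simp: eventually_nhds)
next
  assume *: "(\<forall>\<^sub>F q in nhds p. W q \<in> TM q) \<and>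
    (\<forall>b\<in>Basis. smooth_at A p (\<lambda>q. W q (\<lambda>x. \<phi> x \<bullet> b)))"
  then have "\<forall>\<^sub>F q in nhds p. \<forall>b\<in>Basis. smooth_at A q (\<lambda>q. W q (\<lambda>x. \<phi> x \<bullet> b))"
    by (simp add: eventually_ball_finite_distrib smooth_at_eventually)
  moreover have "\<forall>\<^sub>F q in nhds p. q \<in> U"
    using chart_open[OF c(1)] c(2) by (auto simp: eventually_nhds)
  ultimately have "\<forall>\<^sub>F q in nhds p. W q \<in> TM q \<and> q \<in> U \<and>
      (\<forall>b\<in>Basis. smooth_at A q (\<lambda>q. W q (\<lambda>x. \<phi> x \<bullet> b)))"
    using * by (auto intro: eventually_conj)
  then obtain N where N: "open N" "p \<in> N" "\<And>q. q \<in> N \<Longrightarrow> W q \<in> TM q" "N \<subseteq> U"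
      "\<And>q b. q \<in> N \<Longrightarrow> b \<in> Basis \<Longrightarrow> smooth_at A q (\<lambda>q. W q (\<lambda>x. \<phi> x \<bullet> b))"
    by (auto simp: eventually_nhds subset_iff)
  have NA: "N \<subseteq> carrier A" using N(4) chart_subset_carrier[OF c(1)] by blast
  have "smooth_at A q (\<lambda>q'. \<Sum>b\<in>Basis. W q' (\<lambda>x. \<theta> x \<bullet> b) *\<^sub>R b)"
    if q: "q \<in> N" and d: "(V, \<theta>) \<in> A" "q \<in> V" for q V \<theta>
  proof (rule smooth_at_components)
    show "q \<in> carrier A" using NA q by blast
    have "\<forall>\<^sub>F q' in nhds q. W q' \<in> TM q'"
      using N(1,3) q by (auto simp: eventually_nhds)
    note * = this
    show "smooth_at A q (\<lambda>q'. W q' (\<lambda>x. \<theta> x \<bullet> b))" for b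
      by (rule smooth_at_field_apply[OF c(1) subsetD[OF N(4) q] * _ smooth_at_coord[OF d]])
        (rule N(5)[OF q])
  qed
  then have "smooth_section A (tangent_bundle A) N W"
    unfolding smooth_section_tangent_iff[OF N(1) NA] using N(3) by blast
  then show "vfield p W" using N(1,2) NA by (auto simp: section_near_def open_in_def)
qed

lemma vfield_tangent: "vfield p W \<Longrightarrow> \<forall>\<^sub>F q in nhds p. W q \<in> TM q"
proof -
  assume W: "vfield p W"
  obtain U \<phi> where c: "(U, \<phi>) \<in> A" "p \<in> U" using chart_at section_near_carrier[OF W] by blast
  show ?thesis using W by (simp add: vfield_iff[OF c])
qed

lemma vfield_in: "vfield p W \<Longrightarrow> W p \<in> TM p"
  using section_near_fib[of A "tangent_bundle A" p W] by simp

lemma vfield_apply: "vfield p W \<Longrightarrow> smooth_at A p f \<Longrightarrow> smooth_at A p (\<lambda>q. W q f)"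
proof -
  assume W: "vfield p W" and f: "smooth_at A p f"
  obtain U \<phi> where c: "(U, \<phi>) \<in> A" "p \<in> U" using chart_at section_near_carrier[OF W] by blast
  show ?thesis
    by (rule smooth_at_field_apply[OF c _ _ f]) (use W in \<open>simp_all add: vfield_iff[OF c]\<close>)
qed

lemma vfieldI:
  assumes "p \<in> carrier A" "\<forall>\<^sub>F q in nhds p. W q \<in> TM q"
    "\<And>f. smooth_at A p f \<Longrightarrow> smooth_at A p (\<lambda>q. W q f)"
  shows "vfield p W"
proof -
  obtain U \<phi> where c: "(U, \<phi>) \<in> A" "p \<in> U" using chart_at assms(1) by blast
  show ?thesis using assms smooth_at_coord[OF c] by (auto simp: vfield_iff[OF c])
qed

lemma vfield_cong:
  assumes "vfield p V" "\<forall>\<^sub>F q in nhds p. V q = W q" shows "vfield p W"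
proof (rule vfieldI)
  show "p \<in> carrier A" using assms section_near_carrier by blast
  show "\<forall>\<^sub>F q in nhds p. W q \<in> TM q"
    using assms(2) vfield_tangent[OF assms(1)] by eventually_elim simp
  show "smooth_at A p (\<lambda>q. W q f)" if "smooth_at A p f" for f
    using smooth_at_cong[OF vfield_apply[OF assms(1) that]] assms(2) by (simp add: eventually_mono)
qed

lemma eventually_carrier: "p \<in> carrier A \<Longrightarrow> \<forall>\<^sub>F q in nhds p. q \<in> carrier A"
  using open_carrier by (auto simp: eventually_nhds)

lemma vfield_add:
  assumes "vfield p V" "vfield p W" shows "vfield p (\<lambda>q. V q + W q)"
proof (rule vfieldI)
  show "p \<in> carrier A" using assms section_near_carrier by blast
  show "\<forall>\<^sub>F q in nhds p. V q + W q \<in> TM q"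
    using vfield_tangent[OF assms(1)] vfield_tangent[OF assms(2)]
    by eventually_elim (blast intro: subspace_add[OF subspace_tangent_space] tangent_carrier)
qed (use assms in \<open>simp add: smooth_at_add vfield_apply\<close>)

lemma vfield_scaleR:
  assumes "smooth_at A p f" "vfield p W" shows "vfield p (\<lambda>q. f q *\<^sub>R W q)"
proof (rule vfieldI)
  show "p \<in> carrier A" using assms section_near_carrier by blast
  show "\<forall>\<^sub>F q in nhds p. f q *\<^sub>R W q \<in> TM q"
    using vfield_tangent[OF assms(2)]
    by eventually_elim (blast intro: subspace_scale[OF subspace_tangent_space] tangent_carrier)
qed (use assms in \<open>simp add: scaleR_fun_apply smooth_at_mult vfield_apply\<close>)

lemma vfield_cscaleR: "vfield p W \<Longrightarrow> vfield p (\<lambda>q. a *\<^sub>R W q)"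
  by (intro vfield_scaleR smooth_at_const section_near_carrier)

lemma vfield_zero: "p \<in> carrier A \<Longrightarrow> vfield p (\<lambda>q. 0)"
  by (rule vfieldI)
    (auto simp: smooth_at_const intro!: eventually_mono[OF eventually_carrier] subspace_0 subspace_tangent_space)

lemma vfield_sum:
  assumes "p \<in> carrier A" "\<And>i. i \<in> I \<Longrightarrow> vfield p (W i)"
  shows "vfield p (\<lambda>q. \<Sum>i\<in>I. W i q)"
  using assms(2) by (induction I rule: infinite_finite_induct) (simp_all add: vfield_zero[OF assms(1)] vfield_add)

lemma vfield_coord:
  assumes c: "(U, \<phi>) \<in> A" "p \<in> U" shows "vfield p (\<lambda>q. chart_tvec A U \<phi> q v)"
proof -
  have e: "\<forall>\<^sub>F q in nhds p. q \<in> U"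
    using chart_open[OF c(1)] c(2) by (auto simp: eventually_nhds)
  have "p \<in> carrier A" using c by (auto simp: carrier_def)
  then have "smooth_at A p (\<lambda>q. chart_tvec A U \<phi> q v (\<lambda>x. \<phi> x \<bullet> b))" for b
    by (intro smooth_at_cong[OF smooth_at_const[of p "v \<bullet> b"]] eventually_mono[OF e])
      (simp_all add: chart_tvec_coord[OF c(1)])
  then show ?thesis
    using e by (auto simp: vfield_iff[OF c] chart_tvec_in[OF c(1)] elim: eventually_mono)
qed

text \<open>The extension has constant components in a chart, so it is a vector field only near p.
  Connections and brackets depend on germs alone, so this suffices.\<close>

lemma vfield_exists:
  assumes "v \<in> TM p" obtains V where "vfield p V" "V p = v"
proof -
  obtain U \<phi> w where c: "(U, \<phi>) \<in> A" "p \<in> U" and v: "v = chart_tvec A U \<phi> p w"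
    using tangent_rep[OF assms] .
  show ?thesis using that[OF vfield_coord[OF c]] v by metis
qed

lemma vfield_expand:
  assumes c: "(U, \<phi>) \<in> A" "p \<in> U" and W: "vfield p W"
  shows "\<forall>\<^sub>F q in nhds p. W q = (\<Sum>b\<in>Basis. W q (\<lambda>x. \<phi> x \<bullet> b) *\<^sub>R chart_tvec A U \<phi> q b)"
proof -
  have "\<forall>\<^sub>F q in nhds p. q \<in> U"
    using chart_open[OF c(1)] c(2) by (auto simp: eventually_nhds)
  with vfield_tangent[OF W] show ?thesis
    by eventually_elim (rule tangent_expand[OF c(1)])
qed

text \<open>Near p a field is a combination of coordinate fields with smooth coefficients. Locality
  replaces the field by this combination, and linearity over functions then leaves only the
  coefficients at p.\<close>

lemma tensorial_eqI:
  fixes \<Phi> :: "('m \<Rightarrow> 'm tvec) \<Rightarrow> 'x::real_vector"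
  assumes add: "\<And>V W. vfield p V \<Longrightarrow> vfield p W \<Longrightarrow> \<Phi> (\<lambda>q. V q + W q) = \<Phi> V + \<Phi> W"
    and scale: "\<And>f V. smooth_at A p f \<Longrightarrow> vfield p V \<Longrightarrow> \<Phi> (\<lambda>q. f q *\<^sub>R V q) = f p *\<^sub>R \<Phi> V"
    and loc: "\<And>V W. vfield p V \<Longrightarrow> vfield p W \<Longrightarrow> \<forall>\<^sub>F q in nhds p. V q = W q \<Longrightarrow> \<Phi> V = \<Phi> W"
    and V: "vfield p V" and W: "vfield p W" and eq: "V p = W p"
  shows "\<Phi> V = \<Phi> W"
proof -
  have p: "p \<in> carrier A" using section_near_carrier[OF V] .
  obtain U \<phi> where c: "(U, \<phi>) \<in> A" "p \<in> U" using chart_at p by blast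
  have sum: "\<Phi> (\<lambda>q. \<Sum>b\<in>I. f b q *\<^sub>R E b q) = (\<Sum>b\<in>I. f b p *\<^sub>R \<Phi> (E b))"
    if "\<And>b. b \<in> I \<Longrightarrow> smooth_at A p (f b)" "\<And>b. b \<in> I \<Longrightarrow> vfield p (E b)" "finite I"
    for I :: "'e set" and f E
    using that(3,1,2)
  proof (induction I rule: finite_induct)
    case empty
    \<comment> \<open>The zero field is 0 times itself, so \<Phi> vanishes on it by linearity over
      constants.\<close>
    show ?case using scale[OF smooth_at_const[OF p, of 0] vfield_zero[OF p]]
      by (simp only: sum.empty scaleR_zero_left)
  next
    case (insert b I)
    have v: "vfield p (\<lambda>q. f i q *\<^sub>R E i q)" if "i \<in> insert b I" for i
      using insert.prems[OF that] by (rule vfield_scaleR)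
    have "\<Phi> (\<lambda>q. f b q *\<^sub>R E b q + (\<Sum>b\<in>I. f b q *\<^sub>R E b q)) =
        \<Phi> (\<lambda>q. f b q *\<^sub>R E b q) + \<Phi> (\<lambda>q. \<Sum>b\<in>I. f b q *\<^sub>R E b q)"
      by (rule add[OF v vfield_sum[OF p v]]) auto
    also have "\<dots> = f b p *\<^sub>R \<Phi> (E b) + (\<Sum>b\<in>I. f b p *\<^sub>R \<Phi> (E b))"
      using scale[of "f b" "E b"] insert.prems insert.IH by simp
    finally show ?case by (simp only: sum.insert[OF insert.hyps])
  qed
  have *: "\<Phi> X = (\<Sum>b\<in>Basis. X p (\<lambda>x. \<phi> x \<bullet> b) *\<^sub>R \<Phi> (\<lambda>q. chart_tvec A U \<phi> q b))" if X: "vfield p X" for X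
  proof -
    let ?X = "\<lambda>q. \<Sum>b\<in>Basis. X q (\<lambda>x. \<phi> x \<bullet> b) *\<^sub>R chart_tvec A U \<phi> q b"
    have sm: "smooth_at A p (\<lambda>q. X q (\<lambda>x. \<phi> x \<bullet> b))" for b
      by (rule vfield_apply[OF X smooth_at_coord[OF c]])
    have "vfield p ?X" by (intro vfield_sum[OF p] vfield_scaleR sm vfield_coord[OF c])
    then have "\<Phi> X = \<Phi> ?X" using loc[OF X] vfield_expand[OF c X] by blast
    also have "\<dots> = (\<Sum>b\<in>Basis. X p (\<lambda>x. \<phi> x \<bullet> b) *\<^sub>R \<Phi> (\<lambda>q. chart_tvec A U \<phi> q b))"
      by (rule sum[OF sm vfield_coord[OF c]]) simp
    finally show ?thesis .
  qed
  show ?thesis by (simp add: *[OF V] *[OF W] eq)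
qed

end

section \<open>The Levi-Civita connection and its curvature\<close>

locale levi_civita_manifold = manifold A
  for A :: "('m::{t2_space, second_countable_topology}, 'e::euclidean_space) atlas" +
  fixes g :: "'m \<Rightarrow> 'm tvec \<Rightarrow> 'm tvec \<Rightarrow> real"
    and D :: "'m \<Rightarrow> 'm tvec \<Rightarrow> ('m \<Rightarrow> 'm tvec) \<Rightarrow> 'm tvec"
  assumes lc: "levi_civita A g D"
begin

lemma conn: "is_connection A (tangent_bundle A) D"
  using lc by (simp add: levi_civita_def metric_connection_def)

lemmas D_lin = connection_lin_on[OF conn]
lemmas D_add = connection_add[OF conn, unfolded fib_tangent_bundle]
lemmas D_scaleR = connection_scaleR[OF conn]
lemmas D_vfield = section_near_connection[OF conn]

lemma D_in: "vfield p s \<Longrightarrow> v \<in> TM p \<Longrightarrow> D p v s \<in> TM p"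
  using connection_in_fib[OF conn] by simp

lemma D_cong:
  "vfield p s \<Longrightarrow> v \<in> TM p \<Longrightarrow> \<forall>\<^sub>F q in nhds p. s q = s' q \<Longrightarrow> D p v s' = D p v s"
  using connection_cong[OF conn, of p s v s'] vfield_cong[of p s s'] by simp

lemma D_arg_add:
  "vfield p s \<Longrightarrow> v \<in> TM p \<Longrightarrow> w \<in> TM p \<Longrightarrow> D p (v + w) s = D p v s + D p w s"
  by (rule lin_on_add[OF D_lin])

lemma D_arg_scaleR: "vfield p s \<Longrightarrow> v \<in> TM p \<Longrightarrow> D p (c *\<^sub>R v) s = c *\<^sub>R D p v s"
  by (rule lin_on_scaleR[OF D_lin])

lemma D_arg_diff:
  "vfield p s \<Longrightarrow> v \<in> TM p \<Longrightarrow> w \<in> TM p \<Longrightarrow> D p (v - w) s = D p v s - D p w s"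
  by (rule lin_on_diff[OF D_lin subspace_tangent_space[OF section_near_carrier]])

lemma D_cscaleR: "vfield p s \<Longrightarrow> v \<in> TM p \<Longrightarrow> D p v (\<lambda>q. c *\<^sub>R s q) = c *\<^sub>R D p v s"
  using D_scaleR[of p s v "\<lambda>q. c"] by (simp add: tangent_const smooth_at_const section_near_carrier)

lemma torsion: "vfield p V \<Longrightarrow> vfield p W \<Longrightarrow> lie_bracket A V W p = D p (V p) W - D p (W p) V"
  using lc section_near_carrier[of A "tangent_bundle A" p V] unfolding levi_civita_def by metis

text \<open>The existence of a torsion-free connection makes the bracket a tangent vector; symmetry of second
  derivatives is not needed.\<close>

lemma bracket_in: "vfield p V \<Longrightarrow> vfield p W \<Longrightarrow> lie_bracket A V W p \<in> TM p"
  by (simp add: torsion D_in vfield_in subspace_diff subspace_tangent_space section_near_carrier)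

lemma bracket_apply:
  "smooth_at A p f \<Longrightarrow> lie_bracket A V W p f = V p (\<lambda>q. W q f) - W p (\<lambda>q. V q f)"
  by (simp add: lie_bracket_def smooth_near_eq)

lemma metric_derivative:
  assumes "v \<in> TM p" "vfield p V" "vfield p W"
  shows "v (\<lambda>q. g q (V q) (W q)) = g p (D p v V) (W p) + g p (V p) (D p v W)"
  using lc assms section_near_carrier[OF assms(2)] unfolding levi_civita_def metric_connection_def by blast

text \<open>Metric compatibility and the torsion identity are substituted on the right, and all but
  one term cancel. Symmetry and linearity are asked only at p: for the ambient metric they will be
  available only at points with r = 0.\<close>

lemma koszul:
  assumes V: "vfield p X" "vfield p Y" "vfield p Z"
    and sym: "\<And>v w. v \<in> TM p \<Longrightarrow> w \<in> TM p \<Longrightarrow> g p v w = g p w v"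
    and lin: "\<And>v. v \<in> TM p \<Longrightarrow> lin_on (TM p) (g p v)"
  shows "2 * g p (D p (X p) Y) (Z p) =
    X p (\<lambda>q. g q (Y q) (Z q)) + Y p (\<lambda>q. g q (X q) (Z q)) - Z p (\<lambda>q. g q (X q) (Y q))
    + g p (Z p) (lie_bracket A X Y p) - g p (Y p) (lie_bracket A X Z p) - g p (X p) (lie_bracket A Y Z p)"
proof -
  note T = vfield_in[OF V(1)] vfield_in[OF V(2)] vfield_in[OF V(3)]
  have p: "p \<in> carrier A" using section_near_carrier[OF V(1)] .
  note d = lin_on_diff[OF lin subspace_tangent_space[OF p]]
  show ?thesis
    unfolding metric_derivative[OF T(1) V(2,3)] metric_derivative[OF T(2) V(1,3)]
      metric_derivative[OF T(3) V(1,2)] torsion[OF V(1,2)] torsion[OF V(1,3)] torsion[OF V(2,3)]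
    by (simp add: V T d D_in sym[of "D p _ _"])
qed

section \<open>The curvature as a tensor\<close>

definition curv :: "'m \<Rightarrow> ('m \<Rightarrow> 'm tvec) \<Rightarrow> ('m \<Rightarrow> 'm tvec) \<Rightarrow> ('m \<Rightarrow> 'm tvec) \<Rightarrow> 'm tvec"
  where "curv p V W s =
    D p (V p) (\<lambda>q. D q (W q) s) - D p (W p) (\<lambda>q. D q (V q) s) - D p (lie_bracket A V W p) s"

lemma curv_in:
  assumes "vfield p V" "vfield p W" "vfield p s" shows "curv p V W s \<in> TM p"
  unfolding curv_def using assms
  by (intro subspace_diff subspace_tangent_space D_in D_vfield vfield_in bracket_in section_near_carrier)

lemma curv_swap:
  assumes "vfield p V" "vfield p W" "vfield p s" shows "curv p W V s = - curv p V W s"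
  using assms by (simp add: curv_def torsion D_arg_diff D_in vfield_in)

lemma curv_add_arg:
  assumes V: "vfield p V" and V': "vfield p V'" and W: "vfield p W" and s: "vfield p s"
  shows "curv p (\<lambda>q. V q + V' q) W s = curv p V W s + curv p V' W s"
proof -
  note T = vfield_in[OF V] vfield_in[OF V'] vfield_in[OF W]
  have "\<forall>\<^sub>F q in nhds p. D q (V q) s + D q (V' q) s = D q (V q + V' q) s"
    using vfield_tangent[OF V] vfield_tangent[OF V'] section_near_eventually[OF s]
    by eventually_elim (simp add: D_arg_add)
  then have 1: "D p (W p) (\<lambda>q. D q (V q + V' q) s) = D p (W p) (\<lambda>q. D q (V q) s) + D p (W p) (\<lambda>q. D q (V' q) s)"
    using D_cong[OF vfield_add[OF D_vfield[OF V s] D_vfield[OF V' s]] T(3)]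
    by (simp add: D_add D_vfield V V' s T)
  have 2: "D p (lie_bracket A (\<lambda>q. V q + V' q) W p) s = D p (lie_bracket A V W p) s + D p (lie_bracket A V' W p) s"
  proof -
    have "lie_bracket A (\<lambda>q. V q + V' q) W p = lie_bracket A V W p + lie_bracket A V' W p"
      using vfield_add[OF V V'] V V' W T by (simp add: torsion D_add D_arg_add algebra_simps)
    then show ?thesis by (simp add: D_arg_add[OF s] bracket_in V V' W)
  qed
  show ?thesis
    unfolding curv_def 1 2 by (simp add: D_arg_add[OF D_vfield[OF W s]] T)
qed

text \<open>Differentiating f D_V s along W produces the extra term (W f) D_V s. It is cancelled by
  the one from [f V, W] = f [V, W] - (W f) V, an identity that is itself read off from
  \<open>torsion\<close>.\<close>

lemma curv_scaleR_arg:
  assumes f: "smooth_at A p f" and V: "vfield p V" and W: "vfield p W" and s: "vfield p s"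
  shows "curv p (\<lambda>q. f q *\<^sub>R V q) W s = f p *\<^sub>R curv p V W s"
proof -
  note T = vfield_in[OF V] vfield_in[OF W]
  have p: "p \<in> carrier A" using section_near_carrier[OF V] .
  have "\<forall>\<^sub>F q in nhds p. f q *\<^sub>R D q (V q) s = D q (f q *\<^sub>R V q) s"
    using vfield_tangent[OF V] section_near_eventually[OF s]
    by eventually_elim (simp add: D_arg_scaleR)
  then have 1: "D p (W p) (\<lambda>q. D q (f q *\<^sub>R V q) s) = W p f *\<^sub>R D p (V p) s + f p *\<^sub>R D p (W p) (\<lambda>q. D q (V q) s)"
    using D_cong[OF vfield_scaleR[OF f D_vfield[OF V s]] T(2)]
    by (simp add: D_scaleR D_vfield V f s T)
  have b: "lie_bracket A (\<lambda>q. f q *\<^sub>R V q) W p = f p *\<^sub>R lie_bracket A V W p - W p f *\<^sub>R V p"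
    using vfield_scaleR[OF f V] V W T f by (simp add: torsion D_scaleR D_arg_scaleR algebra_simps)
  have 2: "D p (lie_bracket A (\<lambda>q. f q *\<^sub>R V q) W p) s = f p *\<^sub>R D p (lie_bracket A V W p) s - W p f *\<^sub>R D p (V p) s"
    unfolding b by (simp add: D_arg_diff[OF s] D_arg_scaleR[OF s] bracket_in V W T subspace_scale[OF subspace_tangent_space[OF p]])
  show ?thesis
    unfolding curv_def 1 2 by (simp add: D_arg_scaleR[OF D_vfield[OF W s]] T algebra_simps)
qed

lemma curv_add:
  assumes V: "vfield p V" and W: "vfield p W" and s: "vfield p s" and s': "vfield p s'"
  shows "curv p V W (\<lambda>q. s q + s' q) = curv p V W s + curv p V W s'"
proof -
  have 1: "D p v (\<lambda>q. D q (W q) (\<lambda>q. s q + s' q)) = D p v (\<lambda>q. D q (W q) s) + D p v (\<lambda>q. D q (W q) s')"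
    if W: "vfield p W" and v: "v \<in> TM p" for v W
  proof -
    have "\<forall>\<^sub>F q in nhds p. D q (W q) s + D q (W q) s' = D q (W q) (\<lambda>q. s q + s' q)"
      using vfield_tangent[OF W] section_near_eventually[OF s] section_near_eventually[OF s']
      by eventually_elim (simp add: D_add)
    then show ?thesis
      using D_cong[OF vfield_add[OF D_vfield[OF W s] D_vfield[OF W s']] v]
      by (simp add: D_add D_vfield W s s' v)
  qed
  show ?thesis
    unfolding curv_def by (simp add: 1 V W vfield_in D_add[OF s bracket_in[OF V W] s'])
qed

text \<open>The second derivatives of f combine to V W f - W V f, which is the bracket applied to f
  and is removed by the last term of \<open>curv\<close>. The first derivatives of f appear
  symmetrically in V and W and cancel.\<close>

lemma curv_scaleR:
  assumes f: "smooth_at A p f" and V: "vfield p V" and W: "vfield p W" and s: "vfield p s"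
  shows "curv p V W (\<lambda>q. f q *\<^sub>R s q) = f p *\<^sub>R curv p V W s"
proof -
  have 1: "D p v (\<lambda>q. D q (W q) (\<lambda>q. f q *\<^sub>R s q)) = v (\<lambda>q. W q f) *\<^sub>R s p + W p f *\<^sub>R D p v s
      + v f *\<^sub>R D p (W p) s + f p *\<^sub>R D p v (\<lambda>q. D q (W q) s)"
    if W: "vfield p W" and v: "v \<in> TM p" for v W
  proof -
    have "\<forall>\<^sub>F q in nhds p. W q f *\<^sub>R s q + f q *\<^sub>R D q (W q) s = D q (W q) (\<lambda>q. f q *\<^sub>R s q)"
      using vfield_tangent[OF W] section_near_eventually[OF s] smooth_at_eventually[OF f]
      by eventually_elim (simp add: D_scaleR)
    then show ?thesis
      using D_cong[OF vfield_add[OF vfield_scaleR[OF vfield_apply[OF W f] s] vfield_scaleR[OF f D_vfield[OF W s]]] v]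
      by (simp add: D_add D_scaleR D_vfield vfield_scaleR vfield_apply W s f v)
  qed
  show ?thesis
    unfolding curv_def
    by (simp add: 1 V W vfield_in D_scaleR[OF s bracket_in[OF V W] f] bracket_apply[OF f] algebra_simps)
qed

lemma curv_cong_arg:
  assumes V: "vfield p V" and V': "vfield p V'" and e: "\<forall>\<^sub>F q in nhds p. V q = V' q"
    and W: "vfield p W" and s: "vfield p s"
  shows "curv p V W s = curv p V' W s"
proof -
  note T = vfield_in[OF V] vfield_in[OF W]
  have Vp: "V p = V' p" using e by (rule eventually_nhds_x_imp_x)
  have "\<forall>\<^sub>F q in nhds p. D q (V q) s = D q (V' q) s" using e by eventually_elim simp
  then have "D p (W p) (\<lambda>q. D q (V' q) s) = D p (W p) (\<lambda>q. D q (V q) s)"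
    by (rule D_cong[OF D_vfield[OF V s] T(2)])
  moreover have "lie_bracket A V W p = lie_bracket A V' W p"
    using D_cong[OF V T(2) e] by (simp add: torsion V V' W Vp)
  ultimately show ?thesis by (simp add: curv_def Vp)
qed

lemma curv_cong:
  assumes V: "vfield p V" and W: "vfield p W" and s: "vfield p s" and s': "vfield p s'"
    and e: "\<forall>\<^sub>F q in nhds p. s q = s' q"
  shows "curv p V W s = curv p V W s'"
proof -
  have 1: "D p v (\<lambda>q. D q (W q) s') = D p v (\<lambda>q. D q (W q) s)"
    if W: "vfield p W" and v: "v \<in> TM p" for v W
  proof (rule D_cong[OF D_vfield[OF W s] v])
    show "\<forall>\<^sub>F q in nhds p. D q (W q) s = D q (W q) s'"
      using vfield_tangent[OF W] section_near_eventually[OF s] iffD2[OF eventually_eventually e]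
      by eventually_elim (rule D_cong[symmetric])
  qed
  show ?thesis
    unfolding curv_def by (simp add: 1 V W vfield_in D_cong[OF s bracket_in[OF V W] e])
qed

text \<open>The definite description in \<open>curvature\<close> has a value only because of this
  independence of the extensions. The second slot is reduced to the first by
  \<open>curv_swap\<close>; the third is treated on its own.\<close>

lemma curv_tensorial:
  assumes "vfield p V" "vfield p W" "vfield p s" "vfield p V'" "vfield p W'" "vfield p s'"
    and "V p = V' p" "W p = W' p" "s p = s' p"
  shows "curv p V W s = curv p V' W' s'"
proof -
  have arg: "curv p V W s = curv p V' W s"
    if "vfield p V" "vfield p V'" "vfield p W" "vfield p s" "V p = V' p" for V V' W s
    by (rule tensorial_eqI[of p "\<lambda>V. curv p V W s"])
      (rule curv_add_arg curv_scaleR_arg curv_cong_arg that | assumption)+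
  have "curv p V W s = curv p V' W s" using arg assms by blast
  also have "\<dots> = - curv p W V' s" using assms curv_swap by blast
  also have "\<dots> = - curv p W' V' s" using arg[of W W' V' s] assms by simp
  also have "\<dots> = curv p V' W' s" using assms curv_swap[of p W' V' s] by simp
  also have "\<dots> = curv p V' W' s'"
    by (rule tensorial_eqI[of p "\<lambda>s. curv p V' W' s"])
      (rule curv_add curv_scaleR curv_cong assms | assumption)+
  finally show ?thesis .
qed

lemma curvature_eq:
  assumes V: "vfield p V" and W: "vfield p W" and s: "vfield p s"
  shows "curvature A (tangent_bundle A) D p (V p) (W p) (s p) = curv p V W s"
  unfolding curvature_def
proof (rule the_equality)
  show "\<exists>V' W' s'. vfield p V' \<and> V' p = V p \<and> vfield p W' \<and> W' p = W p \<and> vfield p s' \<and> s' p = s p \<and>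
      curv p V W s = D p (V p) (\<lambda>q. D q (W' q) s') - D p (W p) (\<lambda>q. D q (V' q) s') - D p (lie_bracket A V' W' p) s'"
    using assms unfolding curv_def by blast
next
  fix z
  assume "\<exists>V' W' s'. vfield p V' \<and> V' p = V p \<and> vfield p W' \<and> W' p = W p \<and> vfield p s' \<and> s' p = s p \<and>
      z = D p (V p) (\<lambda>q. D q (W' q) s') - D p (W p) (\<lambda>q. D q (V' q) s') - D p (lie_bracket A V' W' p) s'"
  then obtain V' W' s' where *: "vfield p V'" "V' p = V p" "vfield p W'" "W' p = W p" "vfield p s'" "s' p = s p"
      "z = D p (V p) (\<lambda>q. D q (W' q) s') - D p (W p) (\<lambda>q. D q (V' q) s') - D p (lie_bracket A V' W' p) s'"
    by blast
  then have "z = curv p V' W' s'" by (simp add: curv_def)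
  also have "\<dots> = curv p V W s" by (rule curv_tensorial) (use * assms in simp_all)
  finally show "z = curv p V W s" .
qed

abbreviation Rm :: "'m \<Rightarrow> 'm tvec \<Rightarrow> 'm tvec \<Rightarrow> 'm tvec \<Rightarrow> 'm tvec"
  where "Rm \<equiv> curvature A (tangent_bundle A) D"

lemma Rm_in:
  assumes "v \<in> TM p" "w \<in> TM p" "x \<in> TM p"
  shows "Rm p v w x \<in> TM p"
proof -
  obtain V W X where "vfield p V" "V p = v" "vfield p W" "W p = w" "vfield p X" "X p = x"
    using vfield_exists assms by metis
  then show ?thesis using curvature_eq curv_in by metis
qed

lemma Rm_swap:
  assumes "v \<in> TM p" "w \<in> TM p" "x \<in> TM p"
  shows "Rm p w v x = - Rm p v w x"
proof -
  obtain V W X where "vfield p V" "V p = v" "vfield p W" "W p = w" "vfield p X" "X p = x"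
    using vfield_exists assms by metis
  then show ?thesis using curvature_eq curv_swap by metis
qed

lemma Rm_lin_on:
  assumes w: "w \<in> TM p" and x: "x \<in> TM p"
  shows "lin_on (TM p) (\<lambda>v. Rm p v w x)"
    and "lin_on (TM p) (\<lambda>z. Rm p w x z)"
proof -
  have p: "p \<in> carrier A" using tangent_carrier[OF w] .
  obtain W X where W: "vfield p W" "W p = w" and X: "vfield p X" "X p = x"
    using vfield_exists w x by metis
  show "lin_on (TM p) (\<lambda>v. Rm p v w x)"
    unfolding lin_on_def
  proof (intro conjI ballI allI)
    fix v v' assume "v \<in> TM p" "v' \<in> TM p"
    then obtain V V' where V: "vfield p V" "V p = v" "vfield p V'" "V' p = v'"
      using vfield_exists by metis
    then show "Rm p (v + v') w x = Rm p v w x + Rm p v' w x"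
      using curvature_eq[OF vfield_add[OF V(1,3)] W(1) X(1)] curvature_eq[OF V(1) W(1) X(1)]
        curvature_eq[OF V(3) W(1) X(1)] curv_add_arg[OF V(1,3) W(1) X(1)] W X by simp
  next
    fix c v assume "v \<in> TM p"
    then obtain V where V: "vfield p V" "V p = v" using vfield_exists by metis
    then show "Rm p (c *\<^sub>R v) w x = c *\<^sub>R Rm p v w x"
      using curvature_eq[OF vfield_cscaleR[OF V(1)] W(1) X(1), of c] curvature_eq[OF V(1) W(1) X(1)]
        curv_scaleR_arg[OF smooth_at_const[OF p] V(1) W(1) X(1), of c] W X by simp
  qed
  show "lin_on (TM p) (\<lambda>z. Rm p w x z)"
    unfolding lin_on_def
  proof (intro conjI ballI allI)
    fix v v' assume "v \<in> TM p" "v' \<in> TM p"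
    then obtain V V' where V: "vfield p V" "V p = v" "vfield p V'" "V' p = v'"
      using vfield_exists by metis
    then show "Rm p w x (v + v') = Rm p w x v + Rm p w x v'"
      using curvature_eq[OF W(1) X(1) vfield_add[OF V(1,3)]] curvature_eq[OF W(1) X(1) V(1)]
        curvature_eq[OF W(1) X(1) V(3)] curv_add[OF W(1) X(1) V(1,3)] W X by simp
  next
    fix c v assume "v \<in> TM p"
    then obtain V where V: "vfield p V" "V p = v" using vfield_exists by metis
    then show "Rm p w x (c *\<^sub>R v) = c *\<^sub>R Rm p w x v"
      using curvature_eq[OF W(1) X(1) vfield_cscaleR[OF V(1)], of c] curvature_eq[OF W(1) X(1) V(1)]
        curv_scaleR[OF smooth_at_const[OF p] W(1) X(1) V(1), of c] W X by simp
  qed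
qed

end

section \<open>Rules for a Riemannian metric and the skew symmetry of its curvature\<close>

locale riemannian_manifold = levi_civita_manifold A g D
  for A :: "('m::{t2_space, second_countable_topology}, 'e::euclidean_space) atlas" and g D +
  assumes riem: "riemannian_metric A g"
begin

lemma
  assumes "v \<in> TM p"
  shows g_lin: "lin_on (TM p) (g p v)"
    and g_sym: "w \<in> TM p \<Longrightarrow> g p v w = g p w v"
    and g_pos: "v \<noteq> 0 \<Longrightarrow> g p v v > 0"
  using riem assms tangent_carrier[OF assms]
  unfolding riemannian_metric_def bundle_metric_def fib_tangent_bundle by blast+

lemma g_smooth:
  assumes V: "vfield p V" and W: "vfield p W" shows "smooth_at A p (\<lambda>q. g q (V q) (W q))"
proof -
  obtain U where U: "open_in A U" "p \<in> U" "smooth_section A (tangent_bundle A) U V"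
    using V by (auto simp: section_near_def)
  obtain U' where U': "open_in A U'" "p \<in> U'" "smooth_section A (tangent_bundle A) U' W"
    using W by (auto simp: section_near_def)
  have o: "open_in A (U \<inter> U')" using U U' open_in_Int by blast
  have s: "smooth_section A (tangent_bundle A) (U \<inter> U') V" "smooth_section A (tangent_bundle A) (U \<inter> U') W"
    using U U' smooth_section_subset by blast+
  have "\<forall>U s s'. open_in A U \<and> smooth_section A (tangent_bundle A) U s \<and>
      smooth_section A (tangent_bundle A) U s' \<longrightarrow> smooth_fun A U (\<lambda>p. g p (s p) (s' p))"
    by (rule riem[unfolded riemannian_metric_def bundle_metric_def, THEN conjunct1, THEN conjunct2])
  then have "smooth_fun A (U \<inter> U') (\<lambda>q. g q (V q) (W q))"
    using o s by (elim allE[of _ "U \<inter> U'"] allE[of _ V] allE[of _ W]) simp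
  then show ?thesis unfolding smooth_at_def using o U U' by blast
qed

lemma
  assumes "u \<in> TM p" "v \<in> TM p"
  shows g_add: "w \<in> TM p \<Longrightarrow> g p u (v + w) = g p u v + g p u w"
    and g_add2: "w \<in> TM p \<Longrightarrow> g p (u + v) w = g p u w + g p v w"
    and g_diff: "w \<in> TM p \<Longrightarrow> g p u (v - w) = g p u v - g p u w"
    and g_diff2: "w \<in> TM p \<Longrightarrow> g p (u - v) w = g p u w - g p v w"
    and g_scaleR: "g p u (c *\<^sub>R v) = c * g p u v"
    and g_scaleR2: "g p (c *\<^sub>R u) v = c * g p u v"
    and g_minus2: "g p (- u) v = - g p u v"
proof -
  note S = subspace_tangent_space[OF tangent_carrier[OF assms(1)]]
  note mem = subspace_add[OF S] subspace_diff[OF S] subspace_scale[OF S] subspace_neg[OF S]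
  note l = lin_on_add[OF g_lin] lin_on_diff[OF g_lin S] lin_on_scaleR[OF g_lin] lin_on_minus[OF g_lin]
  show "w \<in> TM p \<Longrightarrow> g p u (v + w) = g p u v + g p u w"
    "w \<in> TM p \<Longrightarrow> g p u (v - w) = g p u v - g p u w"
    "g p u (c *\<^sub>R v) = c * g p u v"
    using assms by (simp_all add: l)
  show "w \<in> TM p \<Longrightarrow> g p (u + v) w = g p u w + g p v w"
    "w \<in> TM p \<Longrightarrow> g p (u - v) w = g p u w - g p v w"
    using assms by (simp_all add: l mem g_sym[of _ p w])
  show "g p (c *\<^sub>R u) v = c * g p u v" "g p (- u) v = - g p u v"
    using assms by (simp_all add: l mem g_sym[of _ p v])
qed

lemma g_nondeg:
  assumes "v \<in> TM p" "w \<in> TM p"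
    "\<And>z. z \<in> TM p \<Longrightarrow> g p v z = g p w z"
  shows "v = w"
proof (rule ccontr)
  assume "v \<noteq> w"
  have "v - w \<in> TM p"
    using assms subspace_diff[OF subspace_tangent_space[OF tangent_carrier[OF assms(1)]]] by blast
  then have "g p (v - w) (v - w) > 0" "g p (v - w) (v - w) = 0"
    using g_pos[of "v - w" p] \<open>v \<noteq> w\<close> assms(3) g_diff2[OF assms(1,2)] by auto
  then show False by simp
qed

text \<open>Differentiate g(s, y) along W and then along V. In the commutator the mixed terms g(D_V
  s, D_W y) and g(D_W s, D_V y) cancel, and the rest must equal the derivative of g(s, y) along the
  bracket.\<close>

lemma curv_skew:
  assumes V: "vfield p V" and W: "vfield p W" and s: "vfield p s" and y: "vfield p y"
  shows "g p (curv p V W s) (y p) = - g p (curv p V W y) (s p)"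
proof -
  have p: "p \<in> carrier A" using section_near_carrier[OF V] .
  note S = subspace_tangent_space[OF p]
  note T = vfield_in[OF V] vfield_in[OF W] vfield_in[OF s] vfield_in[OF y]
  have 1: "v (\<lambda>q. W q (\<lambda>x. g x (s x) (y x))) =
      g p (D p v (\<lambda>q. D q (W q) s)) (y p) + g p (D p (W p) s) (D p v y)
      + g p (D p v s) (D p (W p) y) + g p (s p) (D p v (\<lambda>q. D q (W q) y))"
    if W: "vfield p W" and v: "v \<in> TM p" for v W
  proof -
    have "\<forall>\<^sub>F q in nhds p. W q (\<lambda>x. g x (s x) (y x)) = g q (D q (W q) s) (y q) + g q (s q) (D q (W q) y)"
      using vfield_tangent[OF W] section_near_eventually[OF s] section_near_eventually[OF y]
      by eventually_elim (simp add: metric_derivative)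
    then have "v (\<lambda>q. W q (\<lambda>x. g x (s x) (y x))) = v (\<lambda>q. g q (D q (W q) s) (y q) + g q (s q) (D q (W q) y))"
      by (rule tangent_cong[OF v])
    then show ?thesis
      by (simp add: tangent_add[OF v] g_smooth metric_derivative[OF v] D_vfield s y W)
  qed
  have sm: "smooth_at A p (\<lambda>x. g x (s x) (y x))" by (rule g_smooth[OF s y])
  have "lie_bracket A V W p (\<lambda>x. g x (s x) (y x)) =
      V p (\<lambda>q. W q (\<lambda>x. g x (s x) (y x))) - W p (\<lambda>q. V q (\<lambda>x. g x (s x) (y x)))"
    by (rule bracket_apply[OF sm])
  then have "g p (D p (lie_bracket A V W p) s) (y p) + g p (s p) (D p (lie_bracket A V W p) y) =
      g p (D p (V p) (\<lambda>q. D q (W q) s)) (y p) + g p (s p) (D p (V p) (\<lambda>q. D q (W q) y))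
      - (g p (D p (W p) (\<lambda>q. D q (V q) s)) (y p) + g p (s p) (D p (W p) (\<lambda>q. D q (V q) y)))"
    by (simp add: 1 V W T metric_derivative[OF bracket_in[OF V W] s y] g_sym[of "D p _ s"] D_in s y)
  moreover have "g p (curv p V W y) (s p) = g p (s p) (curv p V W y)"
    by (rule g_sym[OF curv_in[OF V W y] T(3)])
  ultimately show ?thesis
    unfolding curv_def
    by (simp add: g_diff g_diff2 D_in D_vfield V W s y T bracket_in subspace_diff[OF S])
qed

lemma Rm_skew:
  assumes "v \<in> TM p" "w \<in> TM p" "x \<in> TM p" "y \<in> TM p"
  shows "g p (Rm p v w x) y = - g p (Rm p v w y) x"
proof -
  obtain V where V: "vfield p V" "V p = v" using vfield_exists assms by blast
  obtain W where W: "vfield p W" "W p = w" using vfield_exists assms by blast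
  obtain X where X: "vfield p X" "X p = x" using vfield_exists assms by blast
  obtain Y where Y: "vfield p Y" "Y p = y" using vfield_exists assms by blast
  show ?thesis
    using curvature_eq[OF V(1) W(1) X(1)] curvature_eq[OF V(1) W(1) Y(1)]
      curv_skew[OF V(1) W(1) X(1) Y(1)] V W X Y by simp
qed

end

section \<open>Product manifolds and the ambient manifold\<close>

lemma manifold_open_atlas: "open S \<Longrightarrow> manifold (open_atlas S)"
  for S :: "'e::euclidean_space set"
proof
  assume S: "open S"
  have "homeomorphism S (id ` S) id (inv_into S id)"
    by (rule homeomorphismI) (auto simp: continuous_on_id inv_into_f_f intro: continuous_on_eq[OF continuous_on_id])
  moreover have "smooth_on (id ` (S \<inter> S)) (id \<circ> inv_into S id)"
    by (rule smooth_on_cong[OF _ _ smooth_on_id]) (use S in auto)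
  ultimately show "smooth_manifold (open_atlas S)"
    using S by (simp add: smooth_manifold_def open_atlas_def)
qed

lemma inv_into_map_prod:
  assumes "inj_on \<phi> U" "inj_on \<psi> V" "y \<in> \<phi> ` U" "z \<in> \<psi> ` V"
  shows "inv_into (U \<times> V) (map_prod \<phi> \<psi>) (y, z) = (inv_into U \<phi> y, inv_into V \<psi> z)"
  using assms
  by (intro inv_into_f_eq map_prod_inj_on) (auto simp: inv_into_f_f)

lemma manifold_prod:
  fixes A :: "('m::{t2_space, second_countable_topology}, 'e::euclidean_space) atlas"
    and B :: "('n::{t2_space, second_countable_topology}, 'f::euclidean_space) atlas"
  assumes "manifold A" "manifold B"
  shows "manifold (prod_atlas A B)"
proof
  interpret A: manifold A by fact
  interpret B: manifold B by fact
  have inj: "inj_on \<phi> U" if "(U, \<phi>) \<in> A" for U \<phi>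
    using A.chart_inv[OF that] by (metis inj_onI)
  have injB: "inj_on \<phi> U" if "(U, \<phi>) \<in> B" for U \<phi>
    using B.chart_inv[OF that] by (metis inj_onI)
  have inv: "inv_into (U \<times> V) (map_prod \<phi> \<psi>) z = (inv_into U \<phi> (fst z), inv_into V \<psi> (snd z))"
    if "(U, \<phi>) \<in> A" "(V, \<psi>) \<in> B" "z \<in> \<phi> ` U \<times> \<psi> ` V" for U V \<phi> \<psi> z
    using inv_into_map_prod[OF inj[OF that(1)] injB[OF that(2)], of "fst z" "snd z"] that(3) by auto
  have "open (U \<times> V) \<and> open (map_prod \<phi> \<psi> ` (U \<times> V)) \<and>
      homeomorphism (U \<times> V) (map_prod \<phi> \<psi> ` (U \<times> V)) (map_prod \<phi> \<psi>) (inv_into (U \<times> V) (map_prod \<phi> \<psi>))"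
    if c: "(U, \<phi>) \<in> A" and d: "(V, \<psi>) \<in> B" for U \<phi> V \<psi>
  proof (intro conjI)
    show "open (U \<times> V)" using A.chart_open[OF c] B.chart_open[OF d] by (rule open_Times)
    have im: "map_prod \<phi> \<psi> ` (U \<times> V) = \<phi> ` U \<times> \<psi> ` V" by (rule map_prod_surj_on[OF refl refl])
    show "open (map_prod \<phi> \<psi> ` (U \<times> V))"
      unfolding im using A.chart_image_open[OF c] B.chart_image_open[OF d] by (rule open_Times)
    note hc = A.chart_homeomorphism[OF c] and hd = B.chart_homeomorphism[OF d]
    have 1: "continuous_on (U \<times> V) (map_prod \<phi> \<psi>)"
      using hc hd unfolding map_prod_def case_prod_beta homeomorphism_def
      by (intro continuous_on_Pair continuous_on_compose2[of U \<phi> _ fst] continuous_on_compose2[of V \<psi> _ snd]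
          continuous_intros) auto
    have 2: "continuous_on (\<phi> ` U \<times> \<psi> ` V) (\<lambda>z. (inv_into U \<phi> (fst z), inv_into V \<psi> (snd z)))"
      using hc hd unfolding homeomorphism_def
      by (intro continuous_on_Pair continuous_on_compose2[of "\<phi> ` U" "inv_into U \<phi>" _ fst]
          continuous_on_compose2[of "\<psi> ` V" "inv_into V \<psi>" _ snd] continuous_intros) auto
    have 3: "continuous_on (\<phi> ` U \<times> \<psi> ` V) (inv_into (U \<times> V) (map_prod \<phi> \<psi>))"
      by (rule continuous_on_eq[OF 2]) (simp add: inv[OF c d])
    show "homeomorphism (U \<times> V) (map_prod \<phi> \<psi> ` (U \<times> V)) (map_prod \<phi> \<psi>) (inv_into (U \<times> V) (map_prod \<phi> \<psi>))"
      unfolding im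
    proof (rule homeomorphismI[OF 1 3])
      show "map_prod \<phi> \<psi> ` (U \<times> V) \<subseteq> \<phi> ` U \<times> \<psi> ` V" using im by blast
      show "inv_into (U \<times> V) (map_prod \<phi> \<psi>) ` (\<phi> ` U \<times> \<psi> ` V) \<subseteq> U \<times> V"
        using inv_into_into[of _ "map_prod \<phi> \<psi>" "U \<times> V"] im by blast
      show "inv_into (U \<times> V) (map_prod \<phi> \<psi>) (map_prod \<phi> \<psi> x) = x" if "x \<in> U \<times> V" for x
        using that by (intro inv_into_f_f map_prod_inj_on inj[OF c] injB[OF d])
      show "map_prod \<phi> \<psi> (inv_into (U \<times> V) (map_prod \<phi> \<psi>) y) = y" if "y \<in> \<phi> ` U \<times> \<psi> ` V" for y
        using that im f_inv_into_f[of y "map_prod \<phi> \<psi>" "U \<times> V"] by simp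
    qed
  qed
  moreover have "smooth_on (map_prod \<phi> \<psi> ` (U \<times> V \<inter> U' \<times> V')) (map_prod \<phi>' \<psi>' \<circ> inv_into (U \<times> V) (map_prod \<phi> \<psi>))"
    if c: "(U, \<phi>) \<in> A" and d: "(V, \<psi>) \<in> B" and c': "(U', \<phi>') \<in> A" and d': "(V', \<psi>') \<in> B"
    for U \<phi> V \<psi> U' \<phi>' V' \<psi>'
  proof -
    let ?S = "\<phi> ` (U \<inter> U')" and ?T = "\<psi> ` (V \<inter> V')"
    have im: "map_prod \<phi> \<psi> ` (U \<times> V \<inter> U' \<times> V') = ?S \<times> ?T"
      unfolding Times_Int_Times by (rule map_prod_surj_on[OF refl refl])
    have oS: "open ?S" using A.chart_image_subset_open[OF c A.chart_open[OF c']] .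
    have oT: "open ?T" using B.chart_image_subset_open[OF d B.chart_open[OF d']] .
    have o: "open (?S \<times> ?T)" using oS oT by (rule open_Times)
    have "smooth_on (?S \<times> ?T) (\<lambda>z. ((\<phi>' \<circ> inv_into U \<phi>) (fst z), (\<psi>' \<circ> inv_into V \<psi>) (snd z)))"
      by (intro smooth_on_Pair[OF o] smooth_on_compose[OF o oS _ _ A.transition_smooth[OF c c']]
          smooth_on_compose[OF o oT _ _ B.transition_smooth[OF d d']]
          smooth_on_bounded_linear bounded_linear_fst bounded_linear_snd) auto
    then show ?thesis
      unfolding im
    proof (rule smooth_on_cong[OF o, rotated])
      fix z assume z: "z \<in> ?S \<times> ?T"
      have "z \<in> \<phi> ` U \<times> \<psi> ` V" using z by auto
      from inv[OF c d this]
      show "((\<phi>' \<circ> inv_into U \<phi>) (fst z), (\<psi>' \<circ> inv_into V \<psi>) (snd z)) =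
          (map_prod \<phi>' \<psi>' \<circ> inv_into (U \<times> V) (map_prod \<phi> \<psi>)) z" by simp
    qed
  qed
  ultimately show "smooth_manifold (prod_atlas A B)"
    unfolding smooth_manifold_def prod_atlas_def by fast
qed

lemma carrier_prod_atlas: "carrier (prod_atlas A B) = carrier A \<times> carrier B"
  unfolding carrier_def prod_atlas_def by fast

lemma carrier_open_atlas [simp]: "carrier (open_atlas S) = S"
  by (simp add: carrier_def open_atlas_def)

text \<open>The tangent vector \<open>a \<partial>\<^sub>t + b \<partial>\<^sub>r + v\<close>.\<close>

definition amb ::
    "('m::topological_space, 'e::euclidean_space) atlas \<Rightarrow> real \<Rightarrow>
     real \<times> real \<times> 'm \<Rightarrow> real \<Rightarrow> real \<Rightarrow> 'm tvec \<Rightarrow> (real \<times> real \<times> 'm) tvec"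
  where "amb A \<delta> = (\<lambda>(t, r, x) a b v f. if smooth_at (ambient_atlas A \<delta>) (t, r, x) f
    then a * deriv (\<lambda>s. f (s, r, x)) t + b * deriv (\<lambda>s. f (t, s, x)) r + v (\<lambda>y. f (t, r, y)) else 0)"

lemma amb_plus: "amb A \<delta> q a b v + amb A \<delta> q a' b' v' = amb A \<delta> q (a + a') (b + b') (v + v')"
  by (cases q) (simp add: amb_def fun_eq_iff algebra_simps)

lemma amb_scaleR: "c *\<^sub>R amb A \<delta> q a b v = amb A \<delta> q (c * a) (c * b) (c *\<^sub>R v)"
  by (cases q) (simp add: amb_def fun_eq_iff scaleR_fun_apply algebra_simps)

section \<open>Charts, smooth functions and tangent vectors of the ambient manifold\<close>

locale ambient = manifold A
  for A :: "('m::{t2_space, second_countable_topology}, 'e::euclidean_space) atlas" +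
  fixes \<delta> :: real
  assumes \<delta>: "\<delta> > 0"
begin

abbreviation "N \<equiv> ambient_atlas A \<delta>"

text \<open>An admissible family is smooth on the product of the whole real line with M. Its
  components are differentiated in r here; \<open>smooth_at_RA_N\<close> and
  \<open>smooth_at_RA_slice\<close> carry the results over to \<open>N\<close> and to M.\<close>

abbreviation "RA \<equiv> prod_atlas (open_atlas (UNIV :: real set)) A"

lemma manifold_N: "manifold N"
  unfolding ambient_atlas_def by (intro manifold_prod manifold_open_atlas manifold_axioms) auto

lemma manifold_RA: "manifold RA"
  by (intro manifold_prod manifold_open_atlas manifold_axioms) auto

sublocale N: manifold N by (rule manifold_N)

sublocale RA: manifold RA by (rule manifold_RA)

lemma carrier_N: "carrier N = {0<..} \<times> {-\<delta><..<\<delta>} \<times> carrier A"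
  by (simp add: ambient_atlas_def carrier_prod_atlas)

definition chart_dom :: "'m set \<Rightarrow> (real \<times> real \<times> 'm) set"
  where "chart_dom U = {0<..} \<times> {-\<delta><..<\<delta>} \<times> U"

definition chart_map :: "('m \<Rightarrow> 'e) \<Rightarrow> real \<times> real \<times> 'm \<Rightarrow> real \<times> real \<times> 'e"
  where "chart_map \<phi> = map_prod id (map_prod id \<phi>)"

lemma chart_map_apply [simp]: "chart_map \<phi> (t, r, x) = (t, r, \<phi> x)"
  by (simp add: chart_map_def)

lemma N_eq: "N = {(chart_dom U, chart_map \<phi>) |U \<phi>. (U, \<phi>) \<in> A}"
  by (auto simp: ambient_atlas_def prod_atlas_def open_atlas_def chart_dom_def chart_map_def)

lemma RA_eq: "RA = {(UNIV \<times> U, map_prod id \<phi>) |U \<phi>. (U, \<phi>) \<in> A}"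
  by (auto simp: prod_atlas_def open_atlas_def)

lemma chart_N: "(U, \<phi>) \<in> A \<Longrightarrow> (chart_dom U, chart_map \<phi>) \<in> N"
  by (auto simp: N_eq)

lemma chart_RA: "(U, \<phi>) \<in> A \<Longrightarrow> (UNIV \<times> U, map_prod id \<phi>) \<in> RA"
  by (auto simp: RA_eq)

lemma inv_chart_N:
  assumes c: "(U, \<phi>) \<in> A" and "t > 0" "\<bar>r\<bar> < \<delta>" "y \<in> \<phi> ` U"
  shows "inv_into (chart_dom U) (chart_map \<phi>) (t, r, y) = (t, r, inv_into U \<phi> y)"
proof -
  have "(t, r, inv_into U \<phi> y) \<in> chart_dom U"
    using assms chart_inv_mem[of y \<phi> U] by (auto simp: chart_dom_def)
  from N.chart_inv[OF chart_N[OF c] this] show ?thesis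
    using chart_inv2[of y \<phi> U] assms(4) by simp
qed

lemma inv_chart_RA:
  assumes c: "(U, \<phi>) \<in> A" and "y \<in> \<phi> ` U"
  shows "inv_into (UNIV \<times> U) (map_prod id \<phi>) (r :: real, y) = (r, inv_into U \<phi> y)"
proof -
  have "(r, inv_into U \<phi> y) \<in> UNIV \<times> U"
    using assms chart_inv_mem[of y \<phi> U] by auto
  from RA.chart_inv[OF chart_RA[OF c] this] show ?thesis
    using chart_inv2[of y \<phi> U] assms(2) by simp
qed

lemma smooth_at_embed:
  assumes f: "smooth_at N (\<tau> x, \<rho> x, x) f" and \<tau>: "smooth_at A x \<tau>" and \<rho>: "smooth_at A x \<rho>"
  shows "smooth_at A x (\<lambda>y. f (\<tau> y, \<rho> y, y))"
proof -
  have x: "x \<in> carrier A" using smooth_at_carrier[OF \<tau>] .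
  obtain U \<phi> where c: "(U, \<phi>) \<in> A" "x \<in> U" using chart_at x by blast
  obtain W1 where W1: "open W1" "\<phi> x \<in> W1" "W1 \<subseteq> \<phi> ` U" "smooth_on W1 (\<tau> \<circ> inv_into U \<phi>)"
    using smooth_atE[OF \<tau> c] .
  obtain W2 where W2: "open W2" "\<phi> x \<in> W2" "W2 \<subseteq> \<phi> ` U" "smooth_on W2 (\<rho> \<circ> inv_into U \<phi>)"
    using smooth_atE[OF \<rho> c] .
  have pos: "\<tau> x > 0" "\<rho> x \<in> {-\<delta><..<\<delta>}" using smooth_at_carrier[OF f] by (auto simp: carrier_N)
  define W where "W = (W1 \<inter> (\<tau> \<circ> inv_into U \<phi>) -` {0<..}) \<inter> (W2 \<inter> (\<rho> \<circ> inv_into U \<phi>) -` {-\<delta><..<\<delta>})"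
  have o: "open W"
    unfolding W_def
    by (intro open_Int continuous_open_preimage[OF smooth_on_continuous] W1 W2) auto
  have W: "W \<subseteq> W1" "W \<subseteq> W2" by (auto simp: W_def)
  show ?thesis
  proof (rule smooth_at_map[OF manifold_axioms manifold_N c chart_N[OF c(1)] o, where F = "\<lambda>y. (\<tau> y, \<rho> y, y)"])
    show "\<phi> x \<in> W" using W1 W2 pos chart_inv[OF c] by (simp add: W_def)
    show "W \<subseteq> \<phi> ` U" using W W1 by blast
    show "(\<tau> (inv_into U \<phi> y), \<rho> (inv_into U \<phi> y), inv_into U \<phi> y) \<in> chart_dom U" if "y \<in> W" for y
      using that W1(3) chart_inv_mem[of y \<phi> U] by (auto simp: W_def chart_dom_def)
    have "smooth_on W (\<lambda>y. ((\<tau> \<circ> inv_into U \<phi>) y, (\<rho> \<circ> inv_into U \<phi>) y, y))"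
      by (intro smooth_on_Pair[OF o] smooth_on_subset[OF W1(4)] smooth_on_subset[OF W2(4)] smooth_on_id W)
    then show "smooth_on W (\<lambda>y. chart_map \<phi> (\<tau> (inv_into U \<phi> y), \<rho> (inv_into U \<phi> y), inv_into U \<phi> y))"
      by (rule smooth_on_cong[OF o, rotated]) (use W W1(3) chart_inv2[of _ \<phi> U] in auto)
  qed (rule f)
qed

lemma smooth_at_proj:
  assumes f: "smooth_at A x f" and q: "(t, r, x) \<in> carrier N"
  shows "smooth_at N (t, r, x) (\<lambda>(t, r, y). f y)"
proof -
  obtain U \<phi> where c: "(U, \<phi>) \<in> A" "x \<in> U" using chart_at smooth_at_carrier[OF f] by blast
  have o: "open (chart_map \<phi> ` chart_dom U)" by (rule N.chart_image_open[OF chart_N[OF c(1)]])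
  have q': "(t, r, x) \<in> chart_dom U" using q c by (auto simp: carrier_N chart_dom_def)
  have "smooth_at N (t, r, x) (\<lambda>q. f (snd (snd q)))"
  proof (rule smooth_at_map[OF manifold_N manifold_axioms chart_N[OF c(1)] q' c(1) o])
    show "snd (snd (inv_into (chart_dom U) (chart_map \<phi>) y)) \<in> U" if "y \<in> chart_map \<phi> ` chart_dom U" for y
      using inv_into_into[OF that] by (auto simp: chart_dom_def)
    show "smooth_on (chart_map \<phi> ` chart_dom U) (\<lambda>y. \<phi> (snd (snd (inv_into (chart_dom U) (chart_map \<phi>) y))))"
    proof (rule smooth_on_cong[OF o _ smooth_on_bounded_linear])
      show "bounded_linear (\<lambda>z :: real \<times> real \<times> 'e. snd (snd z))"
        by (intro bounded_linear_compose[OF bounded_linear_snd] bounded_linear_snd)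
      show "snd (snd y) = \<phi> (snd (snd (inv_into (chart_dom U) (chart_map \<phi>) y)))"
        if "y \<in> chart_map \<phi> ` chart_dom U" for y
        using arg_cong[OF f_inv_into_f[OF that], of "\<lambda>z. snd (snd z)"] by (simp add: chart_map_def)
    qed
  qed (use f q' imageI[OF q', of "chart_map \<phi>"] in auto)
  then show ?thesis by (simp add: case_prod_beta')
qed

lemma smooth_at_fst: "q \<in> carrier N \<Longrightarrow> smooth_at N q (\<lambda>(t, r, x). t)"
proof -
  assume "q \<in> carrier N"
  then obtain V \<psi> where c: "(V, \<psi>) \<in> N" "q \<in> V" by (rule N.chart_at)
  then obtain U \<phi> where "\<psi> = chart_map \<phi>" by (auto simp: N_eq)
  then show ?thesis
    using N.smooth_at_linear[OF bounded_linear_fst N.smooth_at_chart[OF c]]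
    by (simp add: chart_map_def case_prod_beta')
qed

lemma smooth_at_snd: "q \<in> carrier N \<Longrightarrow> smooth_at N q (\<lambda>(t, r, x). r)"
proof -
  assume "q \<in> carrier N"
  then obtain V \<psi> where c: "(V, \<psi>) \<in> N" "q \<in> V" by (rule N.chart_at)
  then obtain U \<phi> where "\<psi> = chart_map \<phi>" by (auto simp: N_eq)
  then show ?thesis
    using N.smooth_at_linear[OF bounded_linear_compose[OF bounded_linear_fst bounded_linear_snd] N.smooth_at_chart[OF c]]
    by (simp add: chart_map_def case_prod_beta')
qed

lemma smooth_at_RA_N:
  assumes k: "smooth_at RA (r, x) k" and q: "(t, r, x) \<in> carrier N"
  shows "smooth_at N (t, r, x) (\<lambda>(t, z). k z)"
proof -
  have "x \<in> carrier A" using q by (simp add: carrier_N)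
  then obtain U \<phi> where c: "(U, \<phi>) \<in> A" "x \<in> U" using chart_at by blast
  have o: "open (chart_map \<phi> ` chart_dom U)" by (rule N.chart_image_open[OF chart_N[OF c(1)]])
  have q': "(t, r, x) \<in> chart_dom U" using q c by (auto simp: carrier_N chart_dom_def)
  have "smooth_at N (t, r, x) (\<lambda>q. k (snd q))"
  proof (rule smooth_at_map[OF manifold_N manifold_RA chart_N[OF c(1)] q' chart_RA[OF c(1)] o])
    show "snd (inv_into (chart_dom U) (chart_map \<phi>) y) \<in> UNIV \<times> U" if "y \<in> chart_map \<phi> ` chart_dom U" for y
      using inv_into_into[OF that] by (auto simp: chart_dom_def)
    show "smooth_on (chart_map \<phi> ` chart_dom U) (\<lambda>y. map_prod id \<phi> (snd (inv_into (chart_dom U) (chart_map \<phi>) y)))"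
    proof (rule smooth_on_cong[OF o _ smooth_on_bounded_linear[OF bounded_linear_snd]])
      show "snd y = map_prod id \<phi> (snd (inv_into (chart_dom U) (chart_map \<phi>) y))"
        if "y \<in> chart_map \<phi> ` chart_dom U" for y
        using arg_cong[OF f_inv_into_f[OF that], of snd] by (simp add: chart_map_def)
    qed
  qed (use k q' imageI[OF q', of "chart_map \<phi>"] in auto)
  then show ?thesis by (simp add: case_prod_beta')
qed

lemma smooth_at_RA_slice:
  assumes k: "smooth_at RA (r, x) k"
  shows "smooth_at A x (\<lambda>y. k (r, y))"
proof -
  have "x \<in> carrier A" using smooth_at_carrier[OF k] by (simp add: carrier_prod_atlas)
  then obtain U \<phi> where c: "(U, \<phi>) \<in> A" "x \<in> U" using chart_at by blast
  note o = chart_image_open[OF c(1)]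
  show ?thesis
  proof (rule smooth_at_map[OF manifold_axioms manifold_RA c chart_RA[OF c(1)] o])
    show "smooth_on (\<phi> ` U) (\<lambda>y. map_prod id \<phi> (r, inv_into U \<phi> y))"
      by (rule smooth_on_cong[OF o _ smooth_on_Pair[OF o smooth_on_const[of _ r] smooth_on_id]])
        (use chart_inv2[of _ \<phi> U] in auto)
  qed (use k c chart_inv_mem[of _ \<phi> U] in auto)
qed

lemma smooth_at_RA_proj:
  assumes f: "smooth_at A x f"
  shows "smooth_at RA (r, x) (\<lambda>(r, y). f y)"
proof -
  have "x \<in> carrier A" using smooth_at_carrier[OF f] .
  then obtain U \<phi> where c: "(U, \<phi>) \<in> A" "x \<in> U" using chart_at by blast
  have im: "map_prod id \<phi> ` (UNIV \<times> U) = (UNIV :: real set) \<times> \<phi> ` U"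
    by (rule map_prod_surj_on) auto
  have o: "open (map_prod id \<phi> ` ((UNIV :: real set) \<times> U))" by (rule RA.chart_image_open[OF chart_RA[OF c(1)]])
  have q': "(r, x) \<in> UNIV \<times> U" using c by simp
  have "smooth_at RA (r, x) (\<lambda>q. f (snd q))"
  proof (rule smooth_at_map[OF manifold_RA manifold_axioms chart_RA[OF c(1)] q' c(1) o])
    show "snd (inv_into (UNIV \<times> U) (map_prod id \<phi>) y) \<in> U"
      if "y \<in> map_prod id \<phi> ` ((UNIV :: real set) \<times> U)" for y
      using inv_into_into[OF that] by auto
    show "smooth_on (map_prod id \<phi> ` ((UNIV :: real set) \<times> U)) (\<lambda>y. \<phi> (snd (inv_into (UNIV \<times> U) (map_prod id \<phi>) y)))"
      by (rule smooth_on_cong[OF o _ smooth_on_bounded_linear[OF bounded_linear_snd]])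
        (use inv_chart_RA[OF c(1)] chart_inv2[of _ \<phi> U] im in force)
  qed (use f q' imageI[OF q', of "map_prod id \<phi>"] in auto)
  then show ?thesis by (simp add: case_prod_beta')
qed

text \<open>In a chart the derivative in r is the directional derivative along (1, 0), hence smooth
  again. The two parts make the derivative of the family at r = 0 a genuine one and a smooth
  field.\<close>

lemma RA_deriv:
  assumes k: "smooth_at RA (r, x) (k :: real \<times> 'm \<Rightarrow> real)"
  shows "smooth_at RA (r, x) (\<lambda>(r, y). deriv (\<lambda>s. k (s, y)) r)"
    and "((\<lambda>s. k (s, x)) has_real_derivative deriv (\<lambda>s. k (s, x)) r) (at r)"
proof -
  have "x \<in> carrier A" using smooth_at_carrier[OF k] by (simp add: carrier_prod_atlas)
  then obtain U \<phi> where c: "(U, \<phi>) \<in> A" "x \<in> U" using chart_at by blast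
  define F where "F = k \<circ> inv_into (UNIV \<times> U) (map_prod id \<phi>)"
  have q: "(r, x) \<in> UNIV \<times> U" using c by simp
  have im: "map_prod id \<phi> ` (UNIV \<times> U) = (UNIV :: real set) \<times> \<phi> ` U"
    by (rule map_prod_surj_on) auto
  obtain W where W: "open W" "map_prod id \<phi> (r, x) \<in> W" "W \<subseteq> map_prod id \<phi> ` (UNIV \<times> U)" "smooth_on W F"
    using RA.smooth_atE[OF k chart_RA[OF c(1)] q] unfolding F_def .
  have F: "F (s, \<phi> y) = k (s, y)" if "y \<in> U" for s y
    using that inv_chart_RA[OF c(1), of "\<phi> y" s] chart_inv[OF c(1) that] by (simp add: F_def)
  have d: "((\<lambda>s. k (s, y)) has_real_derivative frechet_derivative F (at (s, \<phi> y)) (1, 0)) (at s)"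
    if "(s, \<phi> y) \<in> W" "y \<in> U" for s y
  proof -
    have 1: "((\<lambda>s. (s, \<phi> y)) has_derivative (\<lambda>h. (h, 0))) (at s)"
      by (auto intro!: derivative_eq_intros)
    have 2: "(F has_derivative frechet_derivative F (at (s, \<phi> y))) (at (s, \<phi> y))"
      by (rule smooth_on_has_derivative[OF W(4) that(1)])
    then have l: "linear (frechet_derivative F (at (s, \<phi> y)))" by (rule has_derivative_linear)
    have "(\<lambda>h. frechet_derivative F (at (s, \<phi> y)) (h, 0)) = (\<lambda>h. frechet_derivative F (at (s, \<phi> y)) (1, 0) * h)"
    proof
      show "frechet_derivative F (at (s, \<phi> y)) (h, 0) = frechet_derivative F (at (s, \<phi> y)) (1, 0) * h" for h
        using linear_cmul[OF l, of h "(1, 0)"] by (simp add: mult.commute)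
    qed
    then show ?thesis
      using has_derivative_compose[OF 1 2] unfolding F[OF that(2)] has_field_derivative_def by (simp only:)
  qed
  show "((\<lambda>s. k (s, x)) has_real_derivative deriv (\<lambda>s. k (s, x)) r) (at r)"
    using d[of r x] DERIV_imp_deriv[OF d[of r x]] W(2) c(2) by simp
  show "smooth_at RA (r, x) (\<lambda>(r, y). deriv (\<lambda>s. k (s, y)) r)"
  proof (rule RA.smooth_atI[OF chart_RA[OF c(1)] q W(1-3)])
    show "smooth_on W ((\<lambda>(r, y). deriv (\<lambda>s. k (s, y)) r) \<circ> inv_into (UNIV \<times> U) (map_prod id \<phi>))"
    proof (rule smooth_on_cong[OF W(1) _ smooth_on_derivative[OF W(4)]])
      fix z assume z: "z \<in> W"
      then obtain s y where y: "z = (s, \<phi> y)" "y \<in> U" using W(3) im by auto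
      show "frechet_derivative F (at z) (1, 0) = ((\<lambda>(r, y). deriv (\<lambda>s. k (s, y)) r) \<circ> inv_into (UNIV \<times> U) (map_prod id \<phi>)) z"
        using DERIV_imp_deriv[OF d[of s y]] z y inv_chart_RA[OF c(1), of "\<phi> y" s] chart_inv[OF c(1) y(2)]
        by simp
    qed
  qed
qed

text \<open>The three partial derivatives in the definition of \<open>amb\<close> are the
  restrictions of one Frechet derivative in the product chart. Through this identification all
  general facts on tangent vectors apply to \<open>amb\<close>.\<close>

lemma amb_chart:
  assumes c: "(U, \<phi>) \<in> A" "x \<in> U" and tr: "t > 0" "\<bar>r\<bar> < \<delta>"
  shows "amb A \<delta> (t, r, x) a b (chart_tvec A U \<phi> x w)
    = chart_tvec N (chart_dom U) (chart_map \<phi>) (t, r, x) (a, b, w)"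
proof
  fix f
  have q: "(t, r, x) \<in> chart_dom U" using c tr by (auto simp: chart_dom_def)
  have x: "x \<in> carrier A" using c chart_subset_carrier by blast
  show "amb A \<delta> (t, r, x) a b (chart_tvec A U \<phi> x w) f
    = chart_tvec N (chart_dom U) (chart_map \<phi>) (t, r, x) (a, b, w) f"
  proof (cases "smooth_at N (t, r, x) f")
    case f: True
    define F where "F = f \<circ> inv_into (chart_dom U) (chart_map \<phi>)"
    define F' where "F' = frechet_derivative F (at (t, r, \<phi> x))"
    have F: "(F has_derivative F') (at (t, r, \<phi> x))"
      using N.chart_comp_has_derivative[OF chart_N[OF c(1)] q f] by (simp add: F_def F'_def)
    have l: "linear F'" using F by (rule has_derivative_linear)
    have Fe: "F (s, \<rho>, y) = f (s, \<rho>, inv_into U \<phi> y)" if "s > 0" "\<bar>\<rho>\<bar> < \<delta>" "y \<in> \<phi> ` U" for s \<rho> y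
      using inv_chart_N[OF c(1) that] by (simp add: F_def)
    have \<phi>x: "\<phi> x \<in> \<phi> ` U" "inv_into U \<phi> (\<phi> x) = x" using c chart_inv[OF c] by auto
    have 1: "deriv (\<lambda>s. f (s, r, x)) t = F' (1, 0, 0)"
    proof (rule DERIV_imp_deriv)
      have "((\<lambda>s. (s, r, \<phi> x)) has_derivative (\<lambda>h. (h, 0, 0))) (at t)"
        by (auto intro!: derivative_eq_intros simp: zero_prod_def)
      from has_derivative_compose[OF this F]
      have "((\<lambda>s. F (s, r, \<phi> x)) has_derivative (\<lambda>h. F' (h, 0, 0))) (at t)" .
      moreover have "(\<lambda>h. F' (h, 0, 0)) = (\<lambda>h. F' (1, 0, 0) * h)"
      proof
        show "F' (h, 0, 0) = F' (1, 0, 0) * h" for h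
          using linear_cmul[OF l, of h "(1, 0, 0)"] by (simp add: mult.commute)
      qed
      ultimately have "((\<lambda>s. F (s, r, \<phi> x)) has_real_derivative F' (1, 0, 0)) (at t)"
        unfolding has_field_derivative_def by (simp only:)
      \<comment> \<open>\<open>F\<close> is built from the inverse of the chart and is known to
        agree with f only while s stays positive.\<close>
      then show "((\<lambda>s. f (s, r, x)) has_real_derivative F' (1, 0, 0)) (at t)"
        by (rule has_field_derivative_transform_within_open[of _ _ _ "{0<..}"])
          (use tr \<phi>x Fe in auto)
    qed
    have 2: "deriv (\<lambda>s. f (t, s, x)) r = F' (0, 1, 0)"
    proof (rule DERIV_imp_deriv)
      have "((\<lambda>s. (t, s, \<phi> x)) has_derivative (\<lambda>h. (0, h, 0))) (at r)"
        by (auto intro!: derivative_eq_intros)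
      from has_derivative_compose[OF this F]
      have "((\<lambda>s. F (t, s, \<phi> x)) has_derivative (\<lambda>h. F' (0, h, 0))) (at r)" .
      moreover have "(\<lambda>h. F' (0, h, 0)) = (\<lambda>h. F' (0, 1, 0) * h)"
      proof
        show "F' (0, h, 0) = F' (0, 1, 0) * h" for h
          using linear_cmul[OF l, of h "(0, 1, 0)"] by (simp add: mult.commute)
      qed
      ultimately have "((\<lambda>s. F (t, s, \<phi> x)) has_real_derivative F' (0, 1, 0)) (at r)"
        unfolding has_field_derivative_def by (simp only:)
      then show "((\<lambda>s. f (t, s, x)) has_real_derivative F' (0, 1, 0)) (at r)"
        by (rule has_field_derivative_transform_within_open[of _ _ _ "{-\<delta><..<\<delta>}"])
          (use tr \<phi>x Fe in auto)
    qed
    have sl: "smooth_at A x (\<lambda>y. f (t, r, y))"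
      using smooth_at_embed[of "\<lambda>_. t" x "\<lambda>_. r" f, OF _ smooth_at_const[OF x] smooth_at_const[OF x]] f
      by simp
    have 3: "chart_tvec A U \<phi> x w (\<lambda>y. f (t, r, y)) = F' (0, 0, w)"
    proof -
      have "((\<lambda>y. (t, r, y)) has_derivative (\<lambda>h. (0, 0, h))) (at (\<phi> x))"
        by (auto intro!: derivative_eq_intros)
      from has_derivative_compose[OF this F]
      have "((\<lambda>y. F (t, r, y)) has_derivative (\<lambda>h. F' (0, 0, h))) (at (\<phi> x))" .
      then have "frechet_derivative (\<lambda>y. F (t, r, y)) (at (\<phi> x)) = (\<lambda>h. F' (0, 0, h))"
        by (rule frechet_derivative_eqI)
      moreover have "frechet_derivative (\<lambda>y. F (t, r, y)) (at (\<phi> x)) =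
          frechet_derivative ((\<lambda>y. f (t, r, y)) \<circ> inv_into U \<phi>) (at (\<phi> x))"
        by (rule frechet_derivative_cong_open[OF chart_image_open[OF c(1)] \<phi>x(1)]) (use Fe tr in auto)
      ultimately show ?thesis using sl by (simp add: chart_tvec_def)
    qed
    have "F' (a, b, w) = F' (a *\<^sub>R (1, 0, 0) + (b *\<^sub>R (0, 1, 0) + (0, 0, w)))" by simp
    also have "\<dots> = a * F' (1, 0, 0) + b * F' (0, 1, 0) + F' (0, 0, w)"
      unfolding linear_add[OF l] linear_cmul[OF l] by simp
    finally show ?thesis
      using f sl 3 by (simp add: amb_def 1 2 chart_tvec_def F_def[symmetric] F'_def[symmetric])
  qed (simp add: amb_def chart_tvec_def)
qed

lemma amb_in:
  assumes v: "v \<in> TM x" and q: "(t, r, x) \<in> carrier N"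
  shows "amb A \<delta> (t, r, x) a b v \<in> tangent_space N (t, r, x)"
proof -
  obtain U \<phi> w where c: "(U, \<phi>) \<in> A" "x \<in> U" and w: "v = chart_tvec A U \<phi> x w"
    using tangent_rep[OF v] .
  have tr: "t > 0" "\<bar>r\<bar> < \<delta>" using q by (auto simp: carrier_N)
  show ?thesis
    unfolding w amb_chart[OF c tr]
    by (rule N.chart_tvec_in[OF chart_N[OF c(1)]]) (use c tr in \<open>auto simp: chart_dom_def\<close>)
qed

lemma amb_fst:
  assumes v: "v \<in> TM x" and q: "(t, r, x) \<in> carrier N"
  shows "amb A \<delta> (t, r, x) a b v (\<lambda>(t, r, x). t) = a"
  by (simp add: amb_def smooth_at_fst[OF q] tangent_const[OF v])

lemma amb_snd:
  assumes v: "v \<in> TM x" and q: "(t, r, x) \<in> carrier N"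
  shows "amb A \<delta> (t, r, x) a b v (\<lambda>(t, r, x). r) = b"
  by (simp add: amb_def smooth_at_snd[OF q] tangent_const[OF v])

lemma smooth_at_rt: "q \<in> carrier N \<Longrightarrow> smooth_at N q (\<lambda>(t, r, x). r * t)"
  using N.smooth_at_mult[OF smooth_at_snd smooth_at_fst] by (simp add: case_prod_beta')

lemma amb_rt:
  assumes v: "v \<in> TM x" and q: "(t, r, x) \<in> carrier N"
  shows "amb A \<delta> (t, r, x) a b v (\<lambda>(t, r, x). r * t) = r * a + t * b"
proof -
  have "deriv (\<lambda>s. r * s) t = r" "deriv (\<lambda>s. s * t) r = t"
    by (rule DERIV_imp_deriv, auto intro!: derivative_eq_intros)+
  then show ?thesis by (simp add: amb_def smooth_at_rt[OF q] tangent_const[OF v])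
qed

lemma amb_proj:
  assumes f: "smooth_at A x f" and q: "(t, r, x) \<in> carrier N"
  shows "amb A \<delta> (t, r, x) a b v (\<lambda>(t, r, y). f y) = v f"
  by (simp add: amb_def smooth_at_proj[OF f q])

lemma differential_amb:
  assumes v: "v \<in> TM x" and q: "(t, r, x) \<in> carrier N"
  shows "differential A (\<lambda>(t, r, x). x) (t, r, x) (amb A \<delta> (t, r, x) a b v) = v"
proof
  show "differential A (\<lambda>(t, r, x). x) (t, r, x) (amb A \<delta> (t, r, x) a b v) f = v f" for f
    using amb_proj[OF _ q, of f a b v] tangent_not_smooth[OF v, of f]
    by (simp add: differential_def smooth_near_eq comp_def case_prod_beta')
qed

text \<open>A vector of the ambient manifold is recovered from its values on t and r and its
  projection to M. Brackets and the differential of the immersion are later identified by computing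
  these three data.\<close>

lemma amb_surj:
  assumes X: "X \<in> tangent_space N (t, r, x)"
  shows "differential A (\<lambda>(t, r, x). x) (t, r, x) X \<in> TM x"
    and "X = amb A \<delta> (t, r, x) (X (\<lambda>(t, r, x). t)) (X (\<lambda>(t, r, x). r))
      (differential A (\<lambda>(t, r, x). x) (t, r, x) X)"
proof -
  have q: "(t, r, x) \<in> carrier N" using N.tangent_carrier[OF X] .
  then have tr: "t > 0" "\<bar>r\<bar> < \<delta>" "x \<in> carrier A" by (auto simp: carrier_N)
  obtain U \<phi> where c: "(U, \<phi>) \<in> A" "x \<in> U" using chart_at tr(3) by blast
  have "(t, r, x) \<in> chart_dom U" using c tr by (auto simp: chart_dom_def)
  then obtain z where z: "X = chart_tvec N (chart_dom U) (chart_map \<phi>) (t, r, x) z"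
    using N.tangent_space_chart[OF chart_N[OF c(1)]] X by blast
  obtain a b w where abw: "z = (a, b, w)" by (cases z) auto
  let ?v = "chart_tvec A U \<phi> x w"
  have X': "X = amb A \<delta> (t, r, x) a b ?v" using z abw amb_chart[OF c tr(1,2)] by simp
  have v: "?v \<in> TM x" by (rule chart_tvec_in[OF c])
  show "differential A (\<lambda>(t, r, x). x) (t, r, x) X \<in> TM x"
    unfolding X' differential_amb[OF v q] by (rule v)
  show "X = amb A \<delta> (t, r, x) (X (\<lambda>(t, r, x). t)) (X (\<lambda>(t, r, x). r))
      (differential A (\<lambda>(t, r, x). x) (t, r, x) X)"
    unfolding X' differential_amb[OF v q] amb_fst[OF v q] amb_snd[OF v q] ..
qed

lemma amb_coord:
  assumes v: "v \<in> TM x" and q: "(t, r, x) \<in> carrier N"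
    and c: "(U, \<phi>) \<in> A" "x \<in> U"
  shows "amb A \<delta> (t, r, x) a b v (\<lambda>z. chart_map \<phi> z \<bullet> (\<beta>1, \<beta>2, \<beta>3))
    = a * \<beta>1 + b * \<beta>2 + v (\<lambda>y. \<phi> y \<bullet> \<beta>3)"
proof -
  have q': "(t, r, x) \<in> chart_dom U" using q c by (auto simp: chart_dom_def carrier_N)
  have x: "x \<in> carrier A" using q by (simp add: carrier_N)
  have sm: "smooth_at N (t, r, x) (\<lambda>z. chart_map \<phi> z \<bullet> (\<beta>1, \<beta>2, \<beta>3))"
    by (rule N.smooth_at_coord[OF chart_N[OF c(1)] q'])
  have 1: "deriv (\<lambda>s. s * \<beta>1 + (r * \<beta>2 + \<phi> x \<bullet> \<beta>3)) t = \<beta>1"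
    by (rule DERIV_imp_deriv) (auto intro!: derivative_eq_intros)
  have 2: "deriv (\<lambda>s. t * \<beta>1 + (s * \<beta>2 + \<phi> x \<bullet> \<beta>3)) r = \<beta>2"
    by (rule DERIV_imp_deriv) (auto intro!: derivative_eq_intros)
  have "v (\<lambda>y. (t * \<beta>1 + r * \<beta>2) + \<phi> y \<bullet> \<beta>3) = v (\<lambda>y. \<phi> y \<bullet> \<beta>3)"
    using tangent_add[OF v smooth_at_const[OF x] smooth_at_coord[OF c]] tangent_const[OF v] by simp
  then show ?thesis
    using sm by (simp add: amb_def) (simp add: inner_prod_def add.assoc 1 2)
qed

text \<open>The field \<open>a t \<partial>\<^sub>t + b \<partial>\<^sub>r + V\<close> with constants a and b. The factor t makes
  \<open>Q 1 0 0\<close> the Euler field, which commutes with all fields of this form.\<close>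

definition Q :: "real \<Rightarrow> real \<Rightarrow> ('m \<Rightarrow> 'm tvec) \<Rightarrow> real \<times> real \<times> 'm \<Rightarrow> (real \<times> real \<times> 'm) tvec"
  where "Q a b V = (\<lambda>(t, r, x). amb A \<delta> (t, r, x) (a * t) b (V x))"

lemma eventually_proj:
  assumes "\<forall>\<^sub>F y in nhds x. P y" and q: "(t, r, x) \<in> carrier N"
  shows "\<forall>\<^sub>F (t', r', y) in nhds (t, r, x). (t', r', y) \<in> carrier N \<and> P y"
proof -
  obtain S where S: "open S" "x \<in> S" "\<And>y. y \<in> S \<Longrightarrow> P y"
    using assms(1) by (auto simp: eventually_nhds)
  have "open (carrier N \<inter> UNIV \<times> UNIV \<times> S)"
    using N.open_carrier S(1) by (intro open_Int open_Times) auto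
  then show ?thesis
    unfolding eventually_nhds using S q by (intro exI[of _ "carrier N \<inter> UNIV \<times> UNIV \<times> S"]) auto
qed

lemma Q_vfield:
  assumes V: "vfield x V" and q: "(t, r, x) \<in> carrier N"
  shows "N.vfield (t, r, x) (Q a b V)"
proof -
  have x: "x \<in> carrier A" using q by (simp add: carrier_N)
  obtain U \<phi> where c: "(U, \<phi>) \<in> A" "x \<in> U" using chart_at x by blast
  have q': "(t, r, x) \<in> chart_dom U" using q c by (auto simp: chart_dom_def carrier_N)
  have "\<forall>\<^sub>F y in nhds x. V y \<in> TM y \<and> y \<in> U"
    using vfield_tangent[OF V] chart_open[OF c(1)] c(2) by (auto intro!: eventually_conj simp: eventually_nhds)
  from eventually_proj[OF this q]
  have e: "\<forall>\<^sub>F (t', r', y) in nhds (t, r, x). (t', r', y) \<in> carrier N \<and> V y \<in> TM y \<and> y \<in> U" .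
  show ?thesis
    unfolding N.vfield_iff[OF chart_N[OF c(1)] q']
  proof (intro conjI ballI)
    show "\<forall>\<^sub>F z in nhds (t, r, x). Q a b V z \<in> tangent_space N z"
      using e by eventually_elim (auto simp: Q_def amb_in)
    fix \<beta> :: "real \<times> real \<times> 'e"
    obtain \<beta>1 \<beta>2 \<beta>3 where \<beta>: "\<beta> = (\<beta>1, \<beta>2, \<beta>3)" by (cases \<beta>) auto
    have "smooth_at N (t, r, x) (\<lambda>z. a * (case z of (t, r, x) \<Rightarrow> t) * \<beta>1 + b * \<beta>2
        + (case z of (t, r, y) \<Rightarrow> V y (\<lambda>y. \<phi> y \<bullet> \<beta>3)))"
      by (intro N.smooth_at_add N.smooth_at_mult N.smooth_at_const smooth_at_fst q
          smooth_at_proj[OF _ q] vfield_apply[OF V] smooth_at_coord[OF c])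
    then show "smooth_at N (t, r, x) (\<lambda>z. Q a b V z (\<lambda>x. chart_map \<phi> x \<bullet> \<beta>))"
    proof (rule N.smooth_at_cong)
      show "\<forall>\<^sub>F z in nhds (t, r, x). a * (case z of (t, r, x) \<Rightarrow> t) * \<beta>1 + b * \<beta>2
          + (case z of (t, r, y) \<Rightarrow> V y (\<lambda>y. \<phi> y \<bullet> \<beta>3)) = Q a b V z (\<lambda>x. chart_map \<phi> x \<bullet> \<beta>)"
        using e by eventually_elim (auto simp: Q_def \<beta> amb_coord[OF _ _ c(1)])
    qed
  qed
qed

end

section \<open>The Levi-Civita connection of the ambient metric\<close>

locale ambient_space = ambient A \<delta> + riemannian_manifold A g D
  for A :: "('m::{t2_space, second_countable_topology}, 'e::euclidean_space) atlas" and \<delta> g D +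
  fixes \<gamma> :: "real \<Rightarrow> 'm \<Rightarrow> 'm tvec \<Rightarrow> 'm tvec"
    and Damb :: "real \<times> real \<times> 'm \<Rightarrow> (real \<times> real \<times> 'm) tvec \<Rightarrow>
        (real \<times> real \<times> 'm \<Rightarrow> (real \<times> real \<times> 'm) tvec) \<Rightarrow> (real \<times> real \<times> 'm) tvec"
    and c :: "('m \<Rightarrow> 'm tvec \<Rightarrow> 'm tvec \<Rightarrow> real) set"
  assumes adm: "admissible_family A c \<gamma> \<delta>" and gc: "g \<in> c"
    and lc_amb: "levi_civita (ambient_atlas A \<delta>) (ambient_metric A g \<gamma>) Damb"
begin

abbreviation "G \<equiv> ambient_metric A g \<gamma>"

sublocale N: levi_civita_manifold N G Damb
  by unfold_locales (rule lc_amb)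

lemma
  assumes "v \<in> TM p"
  shows \<gamma>_lin: "lin_on (TM p) (\<gamma> r p)"
    and \<gamma>_in: "\<gamma> r p v \<in> TM p"
    and \<gamma>_sym: "w \<in> TM p \<Longrightarrow> g p (\<gamma> r p v) w = g p v (\<gamma> r p w)"
    and \<gamma>_0: "\<gamma> 0 p v = v"
  using adm[unfolded admissible_family_def] assms tangent_carrier[OF assms] gc
  by (simp, blast, simp, simp)

lemma \<gamma>_smooth:
  assumes V: "vfield x V" and c: "(U, \<phi>) \<in> A" "x \<in> U"
  shows "smooth_at RA (r, x) (\<lambda>(r, p). \<gamma> r p (V p) (\<lambda>q. \<phi> q \<bullet> b))"
proof -
  obtain W where W: "open_in A W" "x \<in> W" "smooth_section A (tangent_bundle A) W V"
    using V by (auto simp: section_near_def)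
  let ?\<Theta> = "\<lambda>(p :: 'm) X. \<Sum>b\<in>Basis. X (\<lambda>q. \<phi> q \<bullet> b) *\<^sub>R b"
  let ?f = "\<lambda>(r, p). ?\<Theta> p (\<gamma> r p (V p))"
  have t: "(U, ?\<Theta>) \<in> trivs (tangent_bundle A)"
    using c by (auto simp: trivs_tangent_bundle)
  have "\<forall>U V. open_in A U \<and> smooth_section A (tangent_bundle A) U V \<longrightarrow>
       (\<forall>(W, \<Theta>)\<in>trivs (tangent_bundle A).
          smooth_fun RA (UNIV \<times> (U \<inter> W)) (\<lambda>(r, p). \<Theta> p (\<gamma> r p (V p))))"
    by (rule adm[unfolded admissible_family_def, THEN conjunct2, THEN conjunct1])
  then have "\<forall>(W', \<Theta>)\<in>trivs (tangent_bundle A).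
          smooth_fun RA (UNIV \<times> (W \<inter> W')) (\<lambda>(r, p). \<Theta> p (\<gamma> r p (V p)))"
    using W by (elim allE[of _ W] allE[of _ V]) simp
  from bspec[OF this t] have "smooth_fun RA (UNIV \<times> (W \<inter> U)) ?f" by simp
  moreover have "open (UNIV \<times> (W \<inter> U) :: (real \<times> 'm) set)"
    using W chart_open[OF c(1)] by (intro open_Times open_Int) (auto simp: open_in_def)
  moreover have "(r, x) \<in> UNIV \<times> (W \<inter> U)" "(r, x) \<in> carrier RA"
    using W c chart_subset_carrier[OF c(1)] by (auto simp: carrier_prod_atlas)
  ultimately have f: "smooth_at RA (r, x) ?f"
    using RA.smooth_fun_iff by blast
  have "\<forall>\<^sub>F y in nhds x. V y \<in> TM y \<and> y \<in> U"
    using vfield_tangent[OF V] chart_open[OF c(1)] c(2) by (auto intro!: eventually_conj simp: eventually_nhds)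
  then obtain S where S: "open S" "x \<in> S" "\<And>y. y \<in> S \<Longrightarrow> V y \<in> TM y" "S \<subseteq> U"
    by (auto simp: eventually_nhds)
  show ?thesis
  proof (rule RA.smooth_at_cong[OF RA.smooth_at_linear[OF bounded_linear_inner_left[of b] f]])
    have "(case z of (r, p) \<Rightarrow> ?\<Theta> p (\<gamma> r p (V p))) \<bullet> b = (case z of (r, p) \<Rightarrow> \<gamma> r p (V p) (\<lambda>q. \<phi> q \<bullet> b))"
      if zS: "z \<in> UNIV \<times> S" for z
    proof -
      obtain r p where z: "z = (r, p)" "p \<in> S" using zS by auto
      have X: "\<gamma> r p (V p) \<in> TM p" by (rule \<gamma>_in[OF S(3)[OF z(2)]])
      have p: "(U, \<phi>) \<in> A" "p \<in> U" using c z S by auto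
      have "chart_tvec A U \<phi> p (?\<Theta> p (\<gamma> r p (V p))) (\<lambda>q. \<phi> q \<bullet> b) = ?\<Theta> p (\<gamma> r p (V p)) \<bullet> b"
        by (rule chart_tvec_coord[OF p])
      then show ?thesis using tangent_chart_tvec[OF p X] z by simp
    qed
    moreover have "open (UNIV \<times> S :: (real \<times> 'm) set)" "(r, x) \<in> UNIV \<times> S"
      using S by (auto intro: open_Times)
    ultimately show "\<forall>\<^sub>F z in nhds (r, x). (case z of (r, p) \<Rightarrow> ?\<Theta> p (\<gamma> r p (V p))) \<bullet> b =
        (case z of (r, p) \<Rightarrow> \<gamma> r p (V p) (\<lambda>q. \<phi> q \<bullet> b))"
      unfolding eventually_nhds by blast
  qed
qed

section \<open>The derivative of the family at r = 0 and the endomorphism S\<close>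

lemma \<gamma>_coord_deriv:
  assumes v: "v \<in> TM p" and c: "(U, \<phi>) \<in> A" "p \<in> U"
  shows "((\<lambda>\<rho>. \<gamma> \<rho> p v (\<lambda>q. \<phi> q \<bullet> b)) has_real_derivative deriv (\<lambda>\<rho>. \<gamma> \<rho> p v (\<lambda>q. \<phi> q \<bullet> b)) 0) (at 0)"
proof -
  obtain V where V: "vfield p V" "V p = v" using vfield_exists[OF v] .
  show ?thesis
    using RA_deriv(2)[OF \<gamma>_smooth[OF V(1) c, of 0 b]] V(2) by simp
qed

text \<open>The limit is taken separately on each function. Since \<gamma>(r) v is a combination of
  fixed chart vectors with coefficients depending on r, the limit is the combination with the
  differentiated coefficients, hence a tangent vector.\<close>

lemma family_deriv_eq:
  assumes v: "v \<in> TM p" and c: "(U, \<phi>) \<in> A" "p \<in> U"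
  shows "family_deriv \<gamma> 0 p v =
    (\<Sum>b\<in>Basis. deriv (\<lambda>\<rho>. \<gamma> \<rho> p v (\<lambda>q. \<phi> q \<bullet> b)) 0 *\<^sub>R chart_tvec A U \<phi> p b)" (is "_ = ?R")
proof
  fix f
  have e: "\<gamma> \<rho> p v f = (\<Sum>b\<in>Basis. \<gamma> \<rho> p v (\<lambda>q. \<phi> q \<bullet> b) * chart_tvec A U \<phi> p b f)" for \<rho>
    using arg_cong[OF tangent_expand[OF c \<gamma>_in[OF v]], of "\<lambda>X. X f"]
    by (simp add: sum_fun_apply scaleR_fun_apply)
  have "((\<lambda>\<rho>. \<gamma> \<rho> p v f) has_real_derivative
      (\<Sum>b\<in>Basis. deriv (\<lambda>\<rho>. \<gamma> \<rho> p v (\<lambda>q. \<phi> q \<bullet> b)) 0 * chart_tvec A U \<phi> p b f)) (at 0)"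
    unfolding e by (intro DERIV_sum DERIV_cmult_right \<gamma>_coord_deriv[OF v c])
  then have "(\<lambda>h. (\<gamma> (0 + h) p v f - \<gamma> 0 p v f) / h) \<midarrow>0\<rightarrow>
      (\<Sum>b\<in>Basis. deriv (\<lambda>\<rho>. \<gamma> \<rho> p v (\<lambda>q. \<phi> q \<bullet> b)) 0 * chart_tvec A U \<phi> p b f)"
    by (simp add: DERIV_def)
  then show "family_deriv \<gamma> 0 p v f = ?R f"
    unfolding family_deriv_def by (simp add: tendsto_Lim sum_fun_apply scaleR_fun_apply)
qed

lemma family_deriv_in:
  assumes v: "v \<in> TM p" shows "family_deriv \<gamma> 0 p v \<in> TM p"
proof -
  obtain U \<phi> where c: "(U, \<phi>) \<in> A" "p \<in> U" using chart_at tangent_carrier[OF v] by blast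
  show ?thesis
    unfolding family_deriv_eq[OF v c]
    by (intro subspace_sum subspace_scale subspace_tangent_space tangent_carrier[OF v] chart_tvec_in[OF c])
qed

lemma family_deriv_coord:
  assumes v: "v \<in> TM p" and c: "(U, \<phi>) \<in> A" "p \<in> U" and b: "b \<in> Basis"
  shows "family_deriv \<gamma> 0 p v (\<lambda>q. \<phi> q \<bullet> b) = deriv (\<lambda>\<rho>. \<gamma> \<rho> p v (\<lambda>q. \<phi> q \<bullet> b)) 0"
  unfolding family_deriv_eq[OF v c]
  using b by (simp add: sum_fun_apply scaleR_fun_apply chart_tvec_coord[OF c] inner_Basis if_distrib cong: if_cong)

lemma \<gamma>_g_deriv:
  assumes v: "v \<in> TM p" and w: "w \<in> TM p"
  shows "((\<lambda>\<rho>. g p (\<gamma> \<rho> p v) w) has_real_derivative g p (family_deriv \<gamma> 0 p v) w) (at 0)"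
proof -
  have p: "p \<in> carrier A" using tangent_carrier[OF v] .
  obtain U \<phi> where c: "(U, \<phi>) \<in> A" "p \<in> U" using chart_at p by blast
  have e: "g p X w = (\<Sum>b\<in>Basis. X (\<lambda>q. \<phi> q \<bullet> b) * g p w (chart_tvec A U \<phi> p b))"
    if X: "X \<in> TM p" for X
  proof -
    have "g p X w = g p w (\<Sum>b\<in>Basis. X (\<lambda>q. \<phi> q \<bullet> b) *\<^sub>R chart_tvec A U \<phi> p b)"
      using g_sym[OF X w] tangent_expand[OF c X] by simp
    also have "\<dots> = (\<Sum>b\<in>Basis. X (\<lambda>q. \<phi> q \<bullet> b) *\<^sub>R g p w (chart_tvec A U \<phi> p b))"
      by (rule lin_on_sum[OF g_lin[OF w] subspace_tangent_space[OF p] chart_tvec_in[OF c]])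
    finally show ?thesis by simp
  qed
  show ?thesis
    unfolding e[OF \<gamma>_in[OF v]] e[OF family_deriv_in[OF v]]
    by (rule DERIV_cong[OF DERIV_sum[OF DERIV_cmult_right[OF \<gamma>_coord_deriv[OF v c]]]])
      (simp add: family_deriv_coord[OF v c])
qed

text \<open>The Koszul formula determines twice the connection, so half of the r-derivative of the
  metric enters; S absorbs this half. As S is what gets compared with curvature quantities, the
  factors 2 in the criterion come from here.\<close>

definition S :: "'m \<Rightarrow> 'm tvec \<Rightarrow> 'm tvec"
  where "S p v = (1 / 2) *\<^sub>R family_deriv \<gamma> 0 p v"

lemma S_in: "v \<in> TM p \<Longrightarrow> S p v \<in> TM p"
  unfolding S_def by (intro subspace_scale subspace_tangent_space family_deriv_in tangent_carrier)

lemma g_S: "v \<in> TM p \<Longrightarrow> w \<in> TM p \<Longrightarrow> 2 * g p (S p v) w = g p (family_deriv \<gamma> 0 p v) w"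
  by (simp add: S_def g_scaleR2 family_deriv_in)

lemma S_sym:
  assumes v: "v \<in> TM p" and w: "w \<in> TM p"
  shows "g p (S p v) w = g p (S p w) v"
proof -
  have "g p (\<gamma> \<rho> p v) w = g p (\<gamma> \<rho> p w) v" for \<rho>
    using \<gamma>_sym[OF v w] g_sym[OF v \<gamma>_in[OF w]] by simp
  then have "g p (family_deriv \<gamma> 0 p v) w = g p (family_deriv \<gamma> 0 p w) v"
    using DERIV_unique[OF \<gamma>_g_deriv[OF v w]] \<gamma>_g_deriv[OF w v] by simp
  then show ?thesis using g_S[OF v w] g_S[OF w v] by simp
qed

text \<open>Rather than passing to the limit in the linearity of \<gamma>(r), the argument is moved
  by \<open>S_sym\<close> to the slot where the pairing is linear, and nondegeneracy of g
  concludes.\<close>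

lemma S_lin: assumes p: "p \<in> carrier A" shows "lin_on (TM p) (S p)"
  unfolding lin_on_def
proof (intro conjI ballI allI)
  note T = subspace_tangent_space[OF p]
  fix v w assume v: "v \<in> TM p" and w: "w \<in> TM p"
  have vw: "v + w \<in> TM p" by (rule subspace_add[OF T v w])
  show "S p (v + w) = S p v + S p w"
  proof (rule g_nondeg[OF S_in[OF vw] subspace_add[OF T S_in[OF v] S_in[OF w]]])
    fix z assume z: "z \<in> TM p"
    have "g p (S p (v + w)) z = g p (S p z) (v + w)" by (rule S_sym[OF vw z])
    then show "g p (S p (v + w)) z = g p (S p v + S p w) z"
      by (simp add: g_add[OF S_in[OF z] v w] g_add2 S_in v w z S_sym[of z])
  qed
next
  note T = subspace_tangent_space[OF p]
  fix k v assume v: "v \<in> TM p"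
  have kv: "k *\<^sub>R v \<in> TM p" by (rule subspace_scale[OF T v])
  show "S p (k *\<^sub>R v) = k *\<^sub>R S p v"
  proof (rule g_nondeg[OF S_in[OF kv] subspace_scale[OF T S_in[OF v]]])
    fix z assume z: "z \<in> TM p"
    have "g p (S p (k *\<^sub>R v)) z = g p (S p z) (k *\<^sub>R v)" by (rule S_sym[OF kv z])
    then show "g p (S p (k *\<^sub>R v)) z = g p (k *\<^sub>R S p v) z"
      by (simp add: g_scaleR[OF S_in[OF z] v] g_scaleR2 S_in v z S_sym[of z])
  qed
qed

lemma S_vfield: assumes V: "vfield p V" shows "vfield p (\<lambda>q. S q (V q))"
proof -
  obtain U \<phi> where c: "(U, \<phi>) \<in> A" "p \<in> U" using chart_at section_near_carrier[OF V] by blast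
  have e: "\<forall>\<^sub>F y in nhds p. V y \<in> TM y \<and> y \<in> U"
    using vfield_tangent[OF V] chart_open[OF c(1)] c(2) by (auto intro!: eventually_conj simp: eventually_nhds)
  have "vfield p (\<lambda>q. family_deriv \<gamma> 0 q (V q))"
    unfolding vfield_iff[OF c]
  proof (intro conjI ballI)
    show "\<forall>\<^sub>F q in nhds p. family_deriv \<gamma> 0 q (V q) \<in> TM q"
      using e by eventually_elim (simp add: family_deriv_in)
    fix b :: 'e assume b: "b \<in> Basis"
    have "smooth_at A p (\<lambda>y. deriv (\<lambda>\<rho>. \<gamma> \<rho> y (V y) (\<lambda>q. \<phi> q \<bullet> b)) 0)"
      using smooth_at_RA_slice[OF RA_deriv(1)[OF \<gamma>_smooth[OF V c, of 0 b]]] by simp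
    then show "smooth_at A p (\<lambda>q. family_deriv \<gamma> 0 q (V q) (\<lambda>x. \<phi> x \<bullet> b))"
      by (rule smooth_at_cong) (use e in eventually_elim, simp add: family_deriv_coord[OF _ c(1) _ b])
  qed
  then show ?thesis unfolding S_def by (rule vfield_cscaleR)
qed

section \<open>The ambient metric at points with r = 0\<close>

lemma G_amb:
  assumes q: "(t, r, x) \<in> carrier N" and v: "v \<in> TM x" and w: "w \<in> TM x"
  shows "G (t, r, x) (amb A \<delta> (t, r, x) a b v) (amb A \<delta> (t, r, x) a' b' w) =
    (r * a + t * b) * a' + a * (r * a' + t * b') + t\<^sup>2 * g x (\<gamma> r x v) w"
  by (simp add: ambient_metric_def amb_fst[OF _ q] amb_rt[OF _ q] differential_amb[OF _ q] v w)

lemma carrier_N_0: "t > 0 \<Longrightarrow> x \<in> carrier A \<Longrightarrow> (t, 0, x) \<in> carrier N"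
  using \<delta> by (simp add: carrier_N)

lemma G_amb_0:
  assumes t: "t > 0" and v: "v \<in> TM x" and w: "w \<in> TM x"
  shows "G (t, 0, x) (amb A \<delta> (t, 0, x) a b v) (amb A \<delta> (t, 0, x) a' b' w) =
    t * (b * a' + a * b') + t\<^sup>2 * g x v w"
  using G_amb[OF carrier_N_0[OF t tangent_carrier[OF v]] v w] by (simp add: \<gamma>_0[OF v] algebra_simps)

lemma G_0_sym_lin:
  assumes t: "t > 0" and X: "X \<in> tangent_space N (t, 0, x)"
  shows "Y \<in> tangent_space N (t, 0, x) \<Longrightarrow> G (t, 0, x) X Y = G (t, 0, x) Y X"
    and "lin_on (tangent_space N (t, 0, x)) (G (t, 0, x) X)"
proof -
  obtain a b v where v: "v \<in> TM x" and X': "X = amb A \<delta> (t, 0, x) a b v"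
    using amb_surj[OF X] by blast
  have x: "x \<in> carrier A" using tangent_carrier[OF v] .
  have Y: "\<exists>a b v. v \<in> TM x \<and> Y = amb A \<delta> (t, 0, x) a b v"
    if "Y \<in> tangent_space N (t, 0, x)" for Y
    using amb_surj[OF that] by blast
  show "G (t, 0, x) X Y = G (t, 0, x) Y X" if "Y \<in> tangent_space N (t, 0, x)"
    using Y[OF that] by (auto simp: X' G_amb_0[OF t] v g_sym[OF v] algebra_simps)
  show "lin_on (tangent_space N (t, 0, x)) (G (t, 0, x) X)"
    unfolding lin_on_def
  proof (intro conjI ballI allI)
    fix Y Z assume "Y \<in> tangent_space N (t, 0, x)" "Z \<in> tangent_space N (t, 0, x)"
    then obtain a1 b1 v1 a2 b2 v2 where "v1 \<in> TM x" "Y = amb A \<delta> (t, 0, x) a1 b1 v1"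
      "v2 \<in> TM x" "Z = amb A \<delta> (t, 0, x) a2 b2 v2" using Y by metis
    then show "G (t, 0, x) X (Y + Z) = G (t, 0, x) X Y + G (t, 0, x) X Z"
      by (simp add: X' amb_plus G_amb_0[OF t] v g_add subspace_add[OF subspace_tangent_space[OF x]] algebra_simps)
  next
    fix k Y assume "Y \<in> tangent_space N (t, 0, x)"
    then obtain a1 b1 v1 where "v1 \<in> TM x" "Y = amb A \<delta> (t, 0, x) a1 b1 v1" using Y by metis
    then show "G (t, 0, x) X (k *\<^sub>R Y) = k *\<^sub>R G (t, 0, x) X Y"
      by (simp add: X' amb_scaleR G_amb_0[OF t] v g_scaleR subspace_scale[OF subspace_tangent_space[OF x]] algebra_simps)
  qed
qed

text \<open>At r = 0 the t- and r-directions form a hyperbolic plane: pairing with \<partial>_t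
  reads off b, pairing with \<partial>_r reads off a, and horizontal vectors read off v.\<close>

lemma G_0_nondeg:
  assumes t: "t > 0" and X: "X \<in> tangent_space N (t, 0, x)" and Y: "Y \<in> tangent_space N (t, 0, x)"
    and eq: "\<And>a b v. v \<in> TM x \<Longrightarrow>
      G (t, 0, x) X (amb A \<delta> (t, 0, x) a b v) = G (t, 0, x) Y (amb A \<delta> (t, 0, x) a b v)"
  shows "X = Y"
proof -
  obtain a b v where v: "v \<in> TM x" and X': "X = amb A \<delta> (t, 0, x) a b v"
    using amb_surj[OF X] by blast
  obtain a' b' v' where v': "v' \<in> TM x" and Y': "Y = amb A \<delta> (t, 0, x) a' b' v'"
    using amb_surj[OF Y] by blast
  have z: "0 \<in> TM x" by (rule subspace_0[OF subspace_tangent_space[OF tangent_carrier[OF v]]])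
  have e: "t * (b * a1 + a * b1) + t\<^sup>2 * g x v z = t * (b' * a1 + a' * b1) + t\<^sup>2 * g x v' z"
    if "z \<in> TM x" for a1 b1 z
    using eq[OF that, of a1 b1] that by (simp add: X' Y' G_amb_0[OF t] v v')
  have "g x v 0 = 0" "g x v' 0 = 0"
    using g_scaleR[OF v z, of 0] g_scaleR[OF v' z, of 0] by simp_all
  then have "b = b'" "a = a'" using e[OF z, of 1 0] e[OF z, of 0 1] t by auto
  moreover have "v = v'"
    using g_nondeg[OF v v'] e[of _ 0 0] t by simp
  ultimately show ?thesis using X' Y' by simp
qed

section \<open>Brackets of the fields \<open>Q\<close> and the Koszul formula for them\<close>

lemma Q_in:
  "vfield x V \<Longrightarrow> (t, r, x) \<in> carrier N \<Longrightarrow> Q a b V (t, r, x) \<in> tangent_space N (t, r, x)"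
  by (rule N.vfield_in[OF Q_vfield])

lemma eventually_field:
  assumes "vfield x V" "(t, r, x) \<in> carrier N"
  shows "\<forall>\<^sub>F (t', r', y) in nhds (t, r, x). (t', r', y) \<in> carrier N \<and> V y \<in> TM y"
  by (rule eventually_proj[OF vfield_tangent[OF assms(1)] assms(2)])

lemma Q_Q_fst:
  assumes V: "vfield x V" and V': "vfield x V'" and q: "(t, r, x) \<in> carrier N"
  shows "Q a b V (t, r, x) (\<lambda>z. Q a' b' V' z (\<lambda>(t, r, x). t)) = a' * (a * t)"
proof -
  note T = Q_in[OF V q, of a b]
  have "\<forall>\<^sub>F z in nhds (t, r, x). Q a' b' V' z (\<lambda>(t, r, x). t) = a' * (case z of (t, r, x) \<Rightarrow> t)"
    using eventually_field[OF V' q] by eventually_elim (auto simp: Q_def amb_fst)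
  then have "Q a b V (t, r, x) (\<lambda>z. Q a' b' V' z (\<lambda>(t, r, x). t)) =
      Q a b V (t, r, x) (\<lambda>z. a' * (case z of (t, r, x) \<Rightarrow> t))"
    by (rule N.tangent_cong[OF T])
  also have "\<dots> = a' * Q a b V (t, r, x) (\<lambda>(t, r, x). t)"
    by (rule N.tangent_cmult[OF T smooth_at_fst[OF q]])
  finally show ?thesis by (simp add: Q_def amb_fst[OF vfield_in[OF V] q])
qed

lemma Q_Q_snd:
  assumes V: "vfield x V" and V': "vfield x V'" and q: "(t, r, x) \<in> carrier N"
  shows "Q a b V (t, r, x) (\<lambda>z. Q a' b' V' z (\<lambda>(t, r, x). r)) = 0"
proof -
  note T = Q_in[OF V q, of a b]
  have "\<forall>\<^sub>F z in nhds (t, r, x). Q a' b' V' z (\<lambda>(t, r, x). r) = b'"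
    using eventually_field[OF V' q] by eventually_elim (auto simp: Q_def amb_snd)
  from N.tangent_cong[OF T this] show ?thesis by (simp add: N.tangent_const[OF T])
qed

lemma Q_Q_proj:
  assumes V: "vfield x V" and V': "vfield x V'" and q: "(t, r, x) \<in> carrier N" and f: "smooth_at A x f"
  shows "Q a b V (t, r, x) (\<lambda>z. Q a' b' V' z (\<lambda>(t, r, y). f y)) = V x (\<lambda>y. V' y f)"
proof -
  note T = Q_in[OF V q, of a b]
  have "\<forall>\<^sub>F z in nhds (t, r, x). Q a' b' V' z (\<lambda>(t, r, y). f y) = (case z of (t, r, y) \<Rightarrow> V' y f)"
    using eventually_proj[OF smooth_at_eventually[OF f] q]
    by eventually_elim (auto simp: Q_def amb_proj)
  from N.tangent_cong[OF T this]
  show ?thesis by (simp add: Q_def amb_proj[OF vfield_apply[OF V' f] q])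
qed

text \<open>The t-component is a' (a t) - a (a' t) = 0, the r-component vanishes because b and b'
  are constant, and V and V' do not involve t and r, so the projection to M is their own bracket. By
  \<open>amb_surj\<close> these three determine the bracket.\<close>

lemma bracket_Q:
  assumes V: "vfield x V" and V': "vfield x V'" and q: "(t, r, x) \<in> carrier N"
  shows "lie_bracket N (Q a b V) (Q a' b' V') (t, r, x) = amb A \<delta> (t, r, x) 0 0 (lie_bracket A V V' x)"
proof -
  let ?X = "lie_bracket N (Q a b V) (Q a' b' V') (t, r, x)"
  have X: "?X \<in> tangent_space N (t, r, x)"
    by (rule N.bracket_in[OF Q_vfield[OF V q] Q_vfield[OF V' q]])
  have 1: "?X (\<lambda>(t, r, x). t) = 0"
    by (simp add: N.bracket_apply[OF smooth_at_fst[OF q]] Q_Q_fst[OF V V' q] Q_Q_fst[OF V' V q])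
  have 2: "?X (\<lambda>(t, r, x). r) = 0"
    by (simp add: N.bracket_apply[OF smooth_at_snd[OF q]] Q_Q_snd[OF V V' q] Q_Q_snd[OF V' V q])
  have 3: "differential A (\<lambda>(t, r, x). x) (t, r, x) ?X = lie_bracket A V V' x"
  proof
    fix f
    show "differential A (\<lambda>(t, r, x). x) (t, r, x) ?X f = lie_bracket A V V' x f"
    proof (cases "smooth_at A x f")
      case f: True
      have "differential A (\<lambda>(t, r, x). x) (t, r, x) ?X f = ?X (f \<circ> (\<lambda>(t, r, x). x))"
        using f by (simp add: differential_def smooth_near_eq)
      also have "\<dots> = ?X (\<lambda>(t, r, y). f y)"
        by (rule arg_cong[where f = ?X]) (auto simp: fun_eq_iff)
      also have "\<dots> = V x (\<lambda>y. V' y f) - V' x (\<lambda>y. V y f)"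
        by (simp add: N.bracket_apply[OF smooth_at_proj[OF f q]] Q_Q_proj[OF V V' q f] Q_Q_proj[OF V' V q f])
      finally show ?thesis by (simp add: bracket_apply[OF f])
    qed (simp add: differential_def smooth_near_eq lie_bracket_def)
  qed
  show ?thesis using amb_surj(2)[OF X] unfolding 1 2 3 .
qed

lemma G_Q:
  assumes "(t, r, x) \<in> carrier N" "V x \<in> TM x" "V' x \<in> TM x"
  shows "G (t, r, x) (Q a b V (t, r, x)) (Q a' b' V' (t, r, x)) =
    t\<^sup>2 * (2 * r * (a * a') + (a * b' + b * a') + g x (\<gamma> r x (V x)) (V' x))"
  using assms by (simp add: Q_def G_amb algebra_simps power2_eq_square)

text \<open>\<open>g_smooth\<close> concerns fields on M, whereas \<gamma>(r) V also moves with r.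
  The expansion in coordinate vectors separates the two: the coefficients live on \<open>RA\<close>,
  their pairings with V' on M.\<close>

lemma \<gamma>_g_smooth:
  assumes V: "vfield x V" and V': "vfield x V'"
  shows "smooth_at RA (r, x) (\<lambda>(r, y). g y (\<gamma> r y (V y)) (V' y))"
proof -
  have x: "x \<in> carrier A" using section_near_carrier[OF V] .
  obtain U \<phi> where c: "(U, \<phi>) \<in> A" "x \<in> U" using chart_at x by blast
  have rx: "(r, x) \<in> carrier RA" using x by (simp add: carrier_prod_atlas)
  have "\<forall>\<^sub>F y in nhds x. y \<in> U"
    using chart_open[OF c(1)] c(2) by (auto simp: eventually_nhds)
  with vfield_tangent[OF V] vfield_tangent[OF V']
  have "\<forall>\<^sub>F y in nhds x. V y \<in> TM y \<and> V' y \<in> TM y \<and> y \<in> U"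
    by eventually_elim simp
  then obtain W where W: "open W" "x \<in> W" "\<And>y. y \<in> W \<Longrightarrow> V y \<in> TM y"
      "\<And>y. y \<in> W \<Longrightarrow> V' y \<in> TM y" "W \<subseteq> U"
    by (auto simp: eventually_nhds)
  have sm: "smooth_at RA (r, x) (\<lambda>z. \<Sum>b\<in>Basis. (case z of (r, y) \<Rightarrow> \<gamma> r y (V y) (\<lambda>q. \<phi> q \<bullet> b)) *
      (case z of (r, y) \<Rightarrow> g y (V' y) (chart_tvec A U \<phi> y b)))"
    by (intro RA.smooth_at_sum[OF rx] RA.smooth_at_mult \<gamma>_smooth[OF V c] smooth_at_RA_proj
        g_smooth[OF V' vfield_coord[OF c]])
  have e: "(\<Sum>b\<in>Basis. \<gamma> r y (V y) (\<lambda>q. \<phi> q \<bullet> b) * g y (V' y) (chart_tvec A U \<phi> y b)) = g y (\<gamma> r y (V y)) (V' y)"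
    if y: "y \<in> W" for r y
  proof -
    have cy: "(U, \<phi>) \<in> A" "y \<in> U" using c W y by auto
    note X = \<gamma>_in[OF W(3)[OF y]] and w = W(4)[OF y]
    have "g y (\<gamma> r y (V y)) (V' y) = g y (V' y) (\<Sum>b\<in>Basis. \<gamma> r y (V y) (\<lambda>q. \<phi> q \<bullet> b) *\<^sub>R chart_tvec A U \<phi> y b)"
      using g_sym[OF X w] tangent_expand[OF cy X] by simp
    also have "\<dots> = (\<Sum>b\<in>Basis. \<gamma> r y (V y) (\<lambda>q. \<phi> q \<bullet> b) *\<^sub>R g y (V' y) (chart_tvec A U \<phi> y b))"
      by (rule lin_on_sum[OF g_lin[OF w] subspace_tangent_space[OF tangent_carrier[OF w]] chart_tvec_in[OF cy]])
    finally show ?thesis by simp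
  qed
  have "open (UNIV \<times> W :: (real \<times> 'm) set)" "(r, x) \<in> UNIV \<times> W"
    using W by (auto intro: open_Times)
  then have "\<forall>\<^sub>F z in nhds (r, x). z \<in> UNIV \<times> W" by (auto simp: eventually_nhds)
  then have "\<forall>\<^sub>F z in nhds (r, x). (\<Sum>b\<in>Basis. (case z of (r, y) \<Rightarrow> \<gamma> r y (V y) (\<lambda>q. \<phi> q \<bullet> b)) *
      (case z of (r, y) \<Rightarrow> g y (V' y) (chart_tvec A U \<phi> y b))) = (case z of (r, y) \<Rightarrow> g y (\<gamma> r y (V y)) (V' y))"
    by eventually_elim (auto simp: e)
  with sm show ?thesis by (rule RA.smooth_at_cong)
qed

text \<open>Through this formula the derivative of \<gamma> enters the connection: the r-derivative
  of g(\<gamma>(r) V, V') at 0 is 2 g(S V, V'). The neighbouring summand 2 a a' comes from the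
  factor r in d(rt), and the t-derivative sees only the factor t^2.\<close>

lemma amb_G_Q:
  assumes V: "vfield x V" and V': "vfield x V'" and v: "v \<in> TM x" and t: "t > 0"
  shows "amb A \<delta> (t, 0, x) \<alpha> \<beta> v (\<lambda>z. G z (Q a b V z) (Q a' b' V' z)) =
    2 * \<alpha> * t * (a * b' + b * a' + g x (V x) (V' x))
    + \<beta> * t\<^sup>2 * (2 * (a * a') + 2 * g x (S x (V x)) (V' x)) + t\<^sup>2 * v (\<lambda>y. g y (V y) (V' y))"
proof -
  have x: "x \<in> carrier A" using tangent_carrier[OF v] .
  have q: "(t, 0, x) \<in> carrier N" by (rule carrier_N_0[OF t x])
  define F where "F = (\<lambda>(t, r, y). t\<^sup>2 * (2 * r * (a * a') + (a * b' + b * a') + g y (\<gamma> r y (V y)) (V' y)))"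
  have "smooth_at N (t, 0, x) (\<lambda>z. ((case z of (t, r, y) \<Rightarrow> t) * (case z of (t, r, y) \<Rightarrow> t)) *
     (2 * (case z of (t, r, y) \<Rightarrow> r) * (a * a') + (a * b' + b * a') +
       (case z of (t, z) \<Rightarrow> case z of (r, y) \<Rightarrow> g y (\<gamma> r y (V y)) (V' y))))"
    by (intro N.smooth_at_mult N.smooth_at_add N.smooth_at_const smooth_at_fst smooth_at_snd q
        smooth_at_RA_N[OF \<gamma>_g_smooth[OF V V']])
  then have sm: "smooth_at N (t, 0, x) F"
    by (rule N.smooth_at_cong) (simp add: F_def case_prod_beta' power2_eq_square)
  have ev: "\<forall>\<^sub>F z in nhds (t, 0, x). G z (Q a b V z) (Q a' b' V' z) = F z"
    using eventually_field[OF V q] eventually_field[OF V' q]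
    by eventually_elim (auto simp: G_Q F_def)
  have "amb A \<delta> (t, 0, x) \<alpha> \<beta> v (\<lambda>z. G z (Q a b V z) (Q a' b' V' z)) = amb A \<delta> (t, 0, x) \<alpha> \<beta> v F"
    by (rule N.tangent_cong[OF amb_in[OF v q] ev])
  also have "\<dots> = \<alpha> * deriv (\<lambda>s. F (s, 0, x)) t + \<beta> * deriv (\<lambda>s. F (t, s, x)) 0 + v (\<lambda>y. F (t, 0, y))"
    using sm by (simp add: amb_def)
  also have "deriv (\<lambda>s. F (s, 0, x)) t = 2 * t * (a * b' + b * a' + g x (V x) (V' x))"
    unfolding F_def by (rule DERIV_imp_deriv) (auto intro!: derivative_eq_intros simp: \<gamma>_0[OF vfield_in[OF V]])
  also have "deriv (\<lambda>s. F (t, s, x)) 0 = t\<^sup>2 * (2 * (a * a') + 2 * g x (S x (V x)) (V' x))"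
    unfolding F_def
    by (rule DERIV_imp_deriv)
      (auto intro!: derivative_eq_intros \<gamma>_g_deriv vfield_in[OF V] vfield_in[OF V']
        simp: g_S[OF vfield_in[OF V] vfield_in[OF V']])
  also have "v (\<lambda>y. F (t, 0, y)) = t\<^sup>2 * v (\<lambda>y. g y (V y) (V' y))"
  proof -
    have "\<forall>\<^sub>F y in nhds x. F (t, 0, y) = t\<^sup>2 * ((a * b' + b * a') + g y (V y) (V' y))"
      using vfield_tangent[OF V] by eventually_elim (simp add: F_def \<gamma>_0)
    from tangent_cong[OF v this]
    show ?thesis
      by (simp add: tangent_cmult[OF v smooth_at_add[OF smooth_at_const[OF x] g_smooth[OF V V']]]
          tangent_add[OF v smooth_at_const[OF x] g_smooth[OF V V']] tangent_const[OF v])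
  qed
  finally show ?thesis by (simp add: algebra_simps)
qed

text \<open>Both sides are paired with an arbitrary vector, extended to a field of the same type, so
  that \<open>amb_G_Q\<close> and \<open>bracket_Q\<close> evaluate all six terms of the Koszul
  formula. The common factor t^2 splits off, and the two pairings agree for every test
  vector.\<close>

lemma Damb_Q:
  assumes V: "vfield x V" and V': "vfield x V'" and t: "t > 0"
  shows "Damb (t, 0, x) (Q a b V (t, 0, x)) (Q a' b' V') =
    amb A \<delta> (t, 0, x) (t * (a * a' - g x (S x (V x)) (V' x))) (a * b' + b * a' - g x (V x) (V' x))
      (D x (V x) V' + (a *\<^sub>R V' x + (a' *\<^sub>R V x + (b *\<^sub>R S x (V' x) + b' *\<^sub>R S x (V x)))))" (is "?L = ?R")
proof -
  have x: "x \<in> carrier A" using section_near_carrier[OF V] .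
  note Sp = subspace_tangent_space[OF x]
  have q: "(t, 0, x) \<in> carrier N" by (rule carrier_N_0[OF t x])
  note T = vfield_in[OF V] vfield_in[OF V']
  have w: "D x (V x) V' + (a *\<^sub>R V' x + (a' *\<^sub>R V x + (b *\<^sub>R S x (V' x) + b' *\<^sub>R S x (V x)))) \<in> TM x"
    by (intro subspace_add subspace_scale Sp D_in S_in T V')
  have L: "?L \<in> tangent_space N (t, 0, x)"
    by (rule N.D_in[OF Q_vfield[OF V' q] Q_in[OF V q]])
  show ?thesis
  proof (rule G_0_nondeg[OF t L amb_in[OF w q]])
    fix a3 b3 z assume z: "z \<in> TM x"
    obtain Z where Z: "vfield x Z" "Z x = z" using vfield_exists[OF z] .
    \<comment> \<open>\<open>Q\<close> multiplies its first coefficient by t, so the test vector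
      with \<partial>_t-coefficient \<open>a3\<close> needs the constant a3 / t.\<close>
    have Qz: "amb A \<delta> (t, 0, x) a3 b3 z = Q (a3 / t) b3 Z (t, 0, x)"
      using t Z by (simp add: Q_def)
    define a'' where "a'' = a3 / t"
    have a3: "a3 = a'' * t" using t by (simp add: a''_def)
    note Zx = vfield_in[OF Z(1)]
    have K: "2 * G (t, 0, x) ?L (Q a'' b3 Z (t, 0, x)) =
      Q a b V (t, 0, x) (\<lambda>q. G q (Q a' b' V' q) (Q a'' b3 Z q))
      + Q a' b' V' (t, 0, x) (\<lambda>q. G q (Q a b V q) (Q a'' b3 Z q))
      - Q a'' b3 Z (t, 0, x) (\<lambda>q. G q (Q a b V q) (Q a' b' V' q))
      + G (t, 0, x) (Q a'' b3 Z (t, 0, x)) (lie_bracket N (Q a b V) (Q a' b' V') (t, 0, x))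
      - G (t, 0, x) (Q a' b' V' (t, 0, x)) (lie_bracket N (Q a b V) (Q a'' b3 Z) (t, 0, x))
      - G (t, 0, x) (Q a b V (t, 0, x)) (lie_bracket N (Q a' b' V') (Q a'' b3 Z) (t, 0, x))"
      by (rule N.koszul[OF Q_vfield[OF V q] Q_vfield[OF V' q] Q_vfield[OF Z(1) q] G_0_sym_lin[OF t]])
    have e1: "Q a b V (t, 0, x) (\<lambda>q. G q (Q a' b' V' q) (Q a'' b3 Z q)) =
        2 * (a * t) * t * (a' * b3 + b' * a'' + g x (V' x) (Z x))
        + b * t\<^sup>2 * (2 * (a' * a'') + 2 * g x (S x (V' x)) (Z x)) + t\<^sup>2 * V x (\<lambda>y. g y (V' y) (Z y))"
      using amb_G_Q[OF V' Z(1) T(1) t, of "a * t" b] by (simp add: Q_def)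
    have e2: "Q a' b' V' (t, 0, x) (\<lambda>q. G q (Q a b V q) (Q a'' b3 Z q)) =
        2 * (a' * t) * t * (a * b3 + b * a'' + g x (V x) (Z x))
        + b' * t\<^sup>2 * (2 * (a * a'') + 2 * g x (S x (V x)) (Z x)) + t\<^sup>2 * V' x (\<lambda>y. g y (V y) (Z y))"
      using amb_G_Q[OF V Z(1) T(2) t, of "a' * t" b'] by (simp add: Q_def)
    have e3: "Q a'' b3 Z (t, 0, x) (\<lambda>q. G q (Q a b V q) (Q a' b' V' q)) =
        2 * (a'' * t) * t * (a * b' + b * a' + g x (V x) (V' x))
        + b3 * t\<^sup>2 * (2 * (a * a') + 2 * g x (S x (V x)) (V' x)) + t\<^sup>2 * Z x (\<lambda>y. g y (V y) (V' y))"
      using amb_G_Q[OF V V' Zx t, of "a'' * t" b3] by (simp add: Q_def)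
    have e4: "G (t, 0, x) (Q a'' b3 Z (t, 0, x)) (lie_bracket N (Q a b V) (Q a' b' V') (t, 0, x)) =
        t\<^sup>2 * g x (Z x) (lie_bracket A V V' x)"
      unfolding bracket_Q[OF V V' q] by (simp add: Q_def G_amb_0[OF t Zx bracket_in[OF V V']])
    have e5: "G (t, 0, x) (Q a' b' V' (t, 0, x)) (lie_bracket N (Q a b V) (Q a'' b3 Z) (t, 0, x)) =
        t\<^sup>2 * g x (V' x) (lie_bracket A V Z x)"
      unfolding bracket_Q[OF V Z(1) q] by (simp add: Q_def G_amb_0[OF t T(2) bracket_in[OF V Z(1)]])
    have e6: "G (t, 0, x) (Q a b V (t, 0, x)) (lie_bracket N (Q a' b' V') (Q a'' b3 Z) (t, 0, x)) =
        t\<^sup>2 * g x (V x) (lie_bracket A V' Z x)"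
      unfolding bracket_Q[OF V' Z(1) q] by (simp add: Q_def G_amb_0[OF t T(1) bracket_in[OF V' Z(1)]])
    have 1: "2 * G (t, 0, x) ?L (Q a'' b3 Z (t, 0, x)) = t\<^sup>2 * (
        2 * a * (a' * b3 + b' * a'' + g x (V' x) (Z x)) + b * (2 * (a' * a'') + 2 * g x (S x (V' x)) (Z x))
        + 2 * a' * (a * b3 + b * a'' + g x (V x) (Z x)) + b' * (2 * (a * a'') + 2 * g x (S x (V x)) (Z x))
        - 2 * a'' * (a * b' + b * a' + g x (V x) (V' x)) - b3 * (2 * (a * a') + 2 * g x (S x (V x)) (V' x))
        + (V x (\<lambda>y. g y (V' y) (Z y)) + V' x (\<lambda>y. g y (V y) (Z y)) - Z x (\<lambda>y. g y (V y) (V' y))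
        + g x (Z x) (lie_bracket A V V' x) - g x (V' x) (lie_bracket A V Z x) - g x (V x) (lie_bracket A V' Z x)))"
      unfolding K e1 e2 e3 e4 e5 e6 by (simp add: algebra_simps power2_eq_square)
    \<comment> \<open>The terms free of the constants form the Koszul expression of g for V, V' and
      Z; they become the horizontal connection D.\<close>
    have e7: "V x (\<lambda>y. g y (V' y) (Z y)) + V' x (\<lambda>y. g y (V y) (Z y)) - Z x (\<lambda>y. g y (V y) (V' y))
        + g x (Z x) (lie_bracket A V V' x) - g x (V' x) (lie_bracket A V Z x) - g x (V x) (lie_bracket A V' Z x)
        = 2 * g x (D x (V x) V') (Z x)"
      by (rule koszul[OF V V' Z(1) g_sym g_lin, symmetric])
    have "2 * G (t, 0, x) ?L (Q a'' b3 Z (t, 0, x)) = 2 * (t\<^sup>2 * (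
        (a * b' + b * a' - g x (V x) (V' x)) * a'' + (a * a' - g x (S x (V x)) (V' x)) * b3
        + (g x (D x (V x) V') (Z x) + (a * g x (V' x) (Z x) + (a' * g x (V x) (Z x)
          + (b * g x (S x (V' x)) (Z x) + b' * g x (S x (V x)) (Z x)))))))"
      unfolding 1 e7 by (simp add: algebra_simps)
    moreover have "G (t, 0, x) ?R (Q a'' b3 Z (t, 0, x)) = t\<^sup>2 * (
        (a * b' + b * a' - g x (V x) (V' x)) * a'' + (a * a' - g x (S x (V x)) (V' x)) * b3
        + (g x (D x (V x) V') (Z x) + (a * g x (V' x) (Z x) + (a' * g x (V x) (Z x)
          + (b * g x (S x (V' x)) (Z x) + b' * g x (S x (V x)) (Z x))))))"
    proof -
      have "g x (D x (V x) V' + (a *\<^sub>R V' x + (a' *\<^sub>R V x + (b *\<^sub>R S x (V' x) + b' *\<^sub>R S x (V x))))) (Z x) =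
         g x (D x (V x) V') (Z x) + (a * g x (V' x) (Z x) + (a' * g x (V x) (Z x)
          + (b * g x (S x (V' x)) (Z x) + b' * g x (S x (V x)) (Z x))))"
        by (simp add: g_add2 g_scaleR2 T Zx S_in D_in V' subspace_add[OF Sp] subspace_scale[OF Sp])
      then show ?thesis
        unfolding Q_def by (simp add: G_amb_0[OF t w Zx]) (simp add: algebra_simps power2_eq_square)
    qed
    ultimately show "G (t, 0, x) ?L (amb A \<delta> (t, 0, x) a3 b3 z) = G (t, 0, x) ?R (amb A \<delta> (t, 0, x) a3 b3 z)"
      unfolding Qz a''_def[symmetric] by simp
  qed
qed

end

section \<open>The tractor connection induced on the pullback bundle\<close>

text \<open>The hypotheses are those of \<open>smooth_at_map\<close>; the components of the image
  vector are the derivative of the chart expression \<open>H\<close> of F in the direction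
  w.\<close>

lemma differential_in:
  assumes "manifold A" "manifold B"
    and c: "(U, \<phi>) \<in> A" "p \<in> U" and d: "(V, \<theta>) \<in> B"
    and W: "open W" "\<phi> p \<in> W" "W \<subseteq> \<phi> ` U" "\<And>y. y \<in> W \<Longrightarrow> F (inv_into U \<phi> y) \<in> V"
      "smooth_on W (\<lambda>y. \<theta> (F (inv_into U \<phi> y)))"
    and X: "X \<in> tangent_space A p"
  shows "differential B F p X \<in> tangent_space B (F p)"
proof -
  interpret A: manifold A by fact
  interpret B: manifold B by fact
  define H where "H = (\<lambda>y. \<theta> (F (inv_into U \<phi> y)))"
  obtain w where w: "X = chart_tvec A U \<phi> p w" using X A.tangent_space_chart[OF c] by blast
  have Fp: "F p \<in> V" using W(2,4) A.chart_inv[OF c] by force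
  have H: "(H has_derivative frechet_derivative H (at (\<phi> p))) (at (\<phi> p))"
    using smooth_on_has_derivative[OF W(5,2)] by (simp add: H_def)
  have "differential B F p X = chart_tvec B V \<theta> (F p) (frechet_derivative H (at (\<phi> p)) w)"
  proof
    fix f
    show "differential B F p X f = chart_tvec B V \<theta> (F p) (frechet_derivative H (at (\<phi> p)) w) f"
    proof (cases "smooth_at B (F p) f")
      case f: True
      have "smooth_at A p (\<lambda>q. f (F q))" by (rule smooth_at_map[OF assms(1,2) c d W f])
      then have 1: "differential B F p X f = frechet_derivative ((\<lambda>q. f (F q)) \<circ> inv_into U \<phi>) (at (\<phi> p)) w"
        using f by (simp add: differential_def smooth_near_eq w chart_tvec_def comp_def)
      have "H (\<phi> p) = \<theta> (F p)" by (simp add: H_def A.chart_inv[OF c])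
      then have f': "((f \<circ> inv_into V \<theta>) has_derivative frechet_derivative (f \<circ> inv_into V \<theta>) (at (\<theta> (F p)))) (at (H (\<phi> p)))"
        using B.chart_comp_has_derivative[OF d Fp f] by simp
      have "frechet_derivative ((\<lambda>q. f (F q)) \<circ> inv_into U \<phi>) (at (\<phi> p)) =
          frechet_derivative (\<lambda>y. (f \<circ> inv_into V \<theta>) (H y)) (at (\<phi> p))"
        by (rule frechet_derivative_cong_open[OF W(1,2)]) (simp add: H_def B.chart_inv[OF d W(4)])
      also have "\<dots> = (\<lambda>v. frechet_derivative (f \<circ> inv_into V \<theta>) (at (\<theta> (F p))) (frechet_derivative H (at (\<phi> p)) v))"
        by (rule frechet_derivative_eqI[OF has_derivative_compose[OF H f']])
      finally show ?thesis using f by (simp add: 1 chart_tvec_def)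
    qed (simp add: differential_def smooth_near_eq chart_tvec_def)
  qed
  then show ?thesis using B.chart_tvec_in[OF d Fp] by simp
qed

lemma (in manifold) smooth_at_Pair:
  assumes "smooth_at A p f" "smooth_at A p h" shows "smooth_at A p (\<lambda>q. (f q, h q))"
proof -
  have "smooth_at A p (\<lambda>q. (f q, 0) + (0, h q))"
    by (intro smooth_at_add smooth_at_linear[of "\<lambda>y. (y, 0)"] smooth_at_linear[of "\<lambda>y. (0, y)"] assms
        bounded_linear_Pair bounded_linear_ident bounded_linear_zero)
  then show ?thesis by simp
qed

lemma (in ambient) triv_amb:
  assumes v: "v \<in> tangent_space A x" and q: "(t, r, x) \<in> carrier N" and c: "(U, \<phi>) \<in> A" "x \<in> U"
  shows "(\<Sum>\<beta>\<in>Basis. amb A \<delta> (t, r, x) a b v (\<lambda>z. chart_map \<phi> z \<bullet> \<beta>) *\<^sub>R \<beta>) =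
    (a, b, \<Sum>\<beta>\<in>Basis. v (\<lambda>y. \<phi> y \<bullet> \<beta>) *\<^sub>R \<beta>)"
proof -
  define w where "w = (\<Sum>\<beta>\<in>Basis. v (\<lambda>y. \<phi> y \<bullet> \<beta>) *\<^sub>R \<beta>)"
  have "v = chart_tvec A U \<phi> x w" unfolding w_def by (rule tangent_chart_tvec[OF c v])
  then have vw: "v (\<lambda>y. \<phi> y \<bullet> \<beta>) = w \<bullet> \<beta>" for \<beta> by (metis chart_tvec_coord[OF c])
  have "amb A \<delta> (t, r, x) a b v (\<lambda>z. chart_map \<phi> z \<bullet> \<beta>) = (a, b, w) \<bullet> \<beta>" for \<beta> :: "real \<times> real \<times> 'e"
    by (cases \<beta>) (simp add: amb_coord[OF v q c] vw)
  then show ?thesis by (simp add: euclidean_representation flip: w_def)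
qed

section \<open>The pullback bundle, its rescaled frame and the induced connection\<close>

locale ambient_pullback = ambient_space A \<delta> g D \<gamma> Damb c
  for A :: "('m::{t2_space, second_countable_topology}, 'e::euclidean_space) atlas" and \<delta> g D \<gamma> Damb c +
  fixes u :: "'m \<Rightarrow> real"
    and Du :: "'m \<Rightarrow> 'm tvec \<Rightarrow> ('m \<Rightarrow> (real \<times> real \<times> 'm) tvec) \<Rightarrow> (real \<times> real \<times> 'm) tvec"
  assumes u: "smooth_fun A (carrier A) u"
    and pb: "is_pullback_connection A (ambient_atlas A \<delta>) (Psi u) (tangent_bundle (ambient_atlas A \<delta>)) Damb Du"
begin

abbreviation "B \<equiv> pullback_bundle A (Psi u) (tangent_bundle N)"

abbreviation "h \<equiv> \<lambda>p. G (Psi u p)"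

lemma u_smooth: "p \<in> carrier A \<Longrightarrow> smooth_at A p u"
  using smooth_fun_iff[OF open_carrier] u by blast

lemma Psi_carrier: "p \<in> carrier A \<Longrightarrow> Psi u p \<in> carrier N"
  by (simp add: Psi_def carrier_N_0)

lemma Du_conn: "is_connection A B Du"
  using pb by (simp add: is_pullback_connection_def)

lemma fib_B [simp]: "fib B p = tangent_space N (Psi u p)"
  by (simp add: pullback_bundle_def)

lemma trivs_B: "trivs B = (\<lambda>(U, \<phi>). (U, \<lambda>p X. \<Sum>\<beta>\<in>Basis. X (\<lambda>q. chart_map \<phi> q \<bullet> \<beta>) *\<^sub>R \<beta>)) ` A"
proof -
  have 1: "trivs B = (\<lambda>(V, \<Theta>). (Psi u -` V \<inter> carrier A, \<lambda>p. \<Theta> (Psi u p))) ` trivs (tangent_bundle N)"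
    by (auto simp: pullback_bundle_def)
  have 2: "trivs (tangent_bundle N) = (\<lambda>(V, \<theta>). (V, \<lambda>p X. \<Sum>\<beta>\<in>Basis. X (\<lambda>q. \<theta> q \<bullet> \<beta>) *\<^sub>R \<beta>)) ` N"
    by (auto simp: trivs_tangent_bundle)
  have 3: "N = (\<lambda>(U, \<phi>). (chart_dom U, chart_map \<phi>)) ` A"
    by (auto simp: N_eq)
  \<comment> \<open>The immersion has t positive and r = 0 inside the interval, so it meets a
    product chart exactly over \<open>U\<close>.\<close>
  have 4: "Psi u -` chart_dom U \<inter> carrier A = U" if "(U, \<phi>) \<in> A" for U \<phi>
    using chart_subset_carrier[OF that] \<delta> by (auto simp: Psi_def chart_dom_def)
  show ?thesis
    unfolding 1 2 unfolding 3 image_image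
  proof (rule image_cong[OF refl])
    fix c assume "c \<in> A"
    then obtain U \<phi> where "c = (U, \<phi>)" "(U, \<phi>) \<in> A" by (cases c) auto
    then show "(case case case c of (U, \<phi>) \<Rightarrow> (chart_dom U, chart_map \<phi>) of
          (V, \<theta>) \<Rightarrow> (V, \<lambda>p X. \<Sum>\<beta>\<in>Basis. X (\<lambda>q. \<theta> q \<bullet> \<beta>) *\<^sub>R \<beta>) of
          (V, \<Theta>) \<Rightarrow> (Psi u -` V \<inter> carrier A, \<lambda>p. \<Theta> (Psi u p))) =
        (case c of (U, \<phi>) \<Rightarrow> (U, \<lambda>p X. \<Sum>\<beta>\<in>Basis. X (\<lambda>q. chart_map \<phi> q \<bullet> \<beta>) *\<^sub>R \<beta>))"
      using 4[of U \<phi>] by simp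
  qed
qed

lemma smooth_section_B_iff:
  assumes "open_in A U"
  shows "smooth_section A B U s \<longleftrightarrow> (\<forall>q\<in>U. s q \<in> tangent_space N (Psi u q)) \<and>
    (\<forall>(V, \<phi>)\<in>A. \<forall>q\<in>U \<inter> V. smooth_at A q (\<lambda>q. \<Sum>\<beta>\<in>Basis. s q (\<lambda>z. chart_map \<phi> z \<bullet> \<beta>) *\<^sub>R \<beta>))"
proof -
  have "smooth_section A B U s \<longleftrightarrow> (\<forall>q\<in>U. s q \<in> tangent_space N (Psi u q)) \<and>
    (\<forall>(V, \<phi>)\<in>A. smooth_fun A (U \<inter> V) (\<lambda>q. \<Sum>\<beta>\<in>Basis. s q (\<lambda>z. chart_map \<phi> z \<bullet> \<beta>) *\<^sub>R \<beta>))"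
    unfolding smooth_section_def fib_B trivs_B by (simp add: case_prod_beta')
  moreover have "smooth_fun A (U \<inter> V) f \<longleftrightarrow> (\<forall>q\<in>U \<inter> V. smooth_at A q f)"
    if "(V, \<phi>) \<in> A" for V \<phi> and f :: "'m \<Rightarrow> real \<times> real \<times> 'e"
    using smooth_fun_iff[of "U \<inter> V" f] assms chart_open[OF that] by (auto simp: open_in_def)
  ultimately show ?thesis by fast
qed

text \<open>The rescaled frame makes the metric and the induced connection independent of u.\<close>

definition hat :: "'m \<Rightarrow> real \<Rightarrow> real \<Rightarrow> 'm tvec \<Rightarrow> (real \<times> real \<times> 'm) tvec"
  where "hat p a b z = amb A \<delta> (Psi u p) a (exp (- u p) * b) (exp (- u p) *\<^sub>R z)"

lemma hat_plus: "hat p a b z + hat p a' b' z' = hat p (a + a') (b + b') (z + z')"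
  by (simp add: hat_def amb_plus algebra_simps)

lemma hat_scaleR: "k *\<^sub>R hat p a b z = hat p (k * a) (k * b) (k *\<^sub>R z)"
  by (simp add: hat_def amb_scaleR algebra_simps)

lemma scale_in: "v \<in> TM p \<Longrightarrow> k *\<^sub>R v \<in> TM p"
  by (rule subspace_scale[OF subspace_tangent_space[OF tangent_carrier]])

lemma add_in: "v \<in> TM p \<Longrightarrow> w \<in> TM p \<Longrightarrow> v + w \<in> TM p"
  by (rule subspace_add[OF subspace_tangent_space[OF tangent_carrier]])

lemma zero_in: "p \<in> carrier A \<Longrightarrow> 0 \<in> TM p"
  by (rule subspace_0[OF subspace_tangent_space])

lemma hat_in: "z \<in> TM p \<Longrightarrow> hat p a b z \<in> tangent_space N (Psi u p)"
  unfolding hat_def using Psi_carrier[OF tangent_carrier, of z p]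
  by (simp add: Psi_def amb_in scale_in)

lemma hat_surj:
  assumes "X \<in> tangent_space N (Psi u p)"
  obtains a b z where "z \<in> TM p" "X = hat p a b z"
proof -
  obtain a b v where v: "v \<in> TM p" "X = amb A \<delta> (Psi u p) a b v"
    using amb_surj[of X "exp (u p)" 0 p] assms by (auto simp: Psi_def)
  have "X = hat p a (exp (u p) * b) (exp (u p) *\<^sub>R v)"
    by (simp add: hat_def v mult.assoc[symmetric] exp_minus)
  then show ?thesis using that scale_in[OF v(1)] by blast
qed

text \<open>Along the immersion \<partial>_t and \<partial>_r pair to exp u, and horizontal vectors
  to exp (2 u) g. The factors in \<open>hat\<close> are chosen to cancel precisely these.\<close>

lemma h_hat:
  assumes "z \<in> TM p" "z' \<in> TM p"
  shows "h p (hat p a b z) (hat p a' b' z') = a * b' + b * a' + g p z z'"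
proof -
  have e: "exp (u p) * exp (- u p) = 1" by (simp add: exp_minus)
  have "h p (hat p a b z) (hat p a' b' z') =
      exp (u p) * (exp (- u p) * b * a' + a * (exp (- u p) * b')) + (exp (u p))\<^sup>2 * (exp (- u p) * (exp (- u p) * g p z z'))"
    unfolding hat_def Psi_def using assms by (simp add: G_amb_0 scale_in g_scaleR g_scaleR2)
  also have "\<dots> = (exp (u p) * exp (- u p)) * (b * a' + a * b') + (exp (u p) * exp (- u p))\<^sup>2 * g p z z'"
    by (simp add: algebra_simps power2_eq_square)
  finally show ?thesis by (simp add: e)
qed

lemma hat_inj:
  assumes z: "z \<in> TM p" and z': "z' \<in> TM p" and eq: "hat p a b z = hat p a' b' z'"
  shows "a = a'" "b = b'" "z = z'"
proof -
  have p: "p \<in> carrier A" using tangent_carrier[OF z] .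
  have e: "a * b1 + b * a1 + g p z w = a' * b1 + b' * a1 + g p z' w" if "w \<in> TM p" for a1 b1 w
    using h_hat[OF z that, of a b a1 b1] h_hat[OF z' that, of a' b' a1 b1] eq by simp
  have 0: "g p z 0 = 0" "g p z' 0 = 0"
    using g_scaleR[OF z zero_in[OF p], of 0] g_scaleR[OF z' zero_in[OF p], of 0] by simp_all
  show "a = a'" "b = b'" using e[OF zero_in[OF p], of 1 0] e[OF zero_in[OF p], of 0 1] 0 by simp_all
  show "z = z'" using g_nondeg[OF z z'] e[of _ 0 0] by simp
qed

lemma triv_hat:
  assumes z: "z \<in> TM p" and c: "(U, \<phi>) \<in> A" "p \<in> U"
  shows "(\<Sum>\<beta>\<in>Basis. hat p a b z (\<lambda>y. chart_map \<phi> y \<bullet> \<beta>) *\<^sub>R \<beta>) =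
    (a, exp (- u p) * b, exp (- u p) *\<^sub>R (\<Sum>\<beta>\<in>Basis. z (\<lambda>y. \<phi> y \<bullet> \<beta>) *\<^sub>R \<beta>))"
  using triv_amb[OF scale_in[OF z] Psi_carrier[OF tangent_carrier[OF z], unfolded Psi_def] c]
  unfolding hat_def Psi_def by (simp add: scaleR_fun_apply scaleR_sum_right)

lemma hat_section:
  assumes a: "smooth_at A p a" and b: "smooth_at A p b" and Z: "vfield p Z"
  shows "section_near A B p (\<lambda>q. hat q (a q) (b q) (Z q))"
proof -
  have "\<forall>\<^sub>F q in nhds p. smooth_at A q a \<and> smooth_at A q b \<and> vfield q Z"
    by (intro eventually_conj smooth_at_eventually a b section_near_eventually Z)
  then obtain W where W: "open W" "p \<in> W" "\<And>q. q \<in> W \<Longrightarrow> smooth_at A q a"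
      "\<And>q. q \<in> W \<Longrightarrow> smooth_at A q b" "\<And>q. q \<in> W \<Longrightarrow> vfield q Z"
    unfolding eventually_nhds by blast
  have WA: "W \<subseteq> carrier A" using W(3) smooth_at_carrier by blast
  have o: "open_in A W" using W WA by (simp add: open_in_def)
  have sm: "smooth_at A q (\<lambda>q. \<Sum>\<beta>\<in>Basis. hat q (a q) (b q) (Z q) (\<lambda>z. chart_map \<phi> z \<bullet> \<beta>) *\<^sub>R \<beta>)"
    if c: "(V, \<phi>) \<in> A" "q \<in> V" and q: "q \<in> W" for V \<phi> q
  proof (rule smooth_at_cong)
    have qA: "q \<in> carrier A" using q WA by blast
    show "smooth_at A q (\<lambda>q. (a q, exp (- u q) * b q, exp (- u q) *\<^sub>R (\<Sum>\<beta>\<in>Basis. Z q (\<lambda>y. \<phi> y \<bullet> \<beta>) *\<^sub>R \<beta>)))"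
      by (intro smooth_at_Pair smooth_at_mult smooth_at_scaleR smooth_at_exp smooth_at_minus u_smooth
          smooth_at_components vfield_apply[OF W(5)[OF q]] smooth_at_coord[OF c] W q qA)
    have "\<forall>\<^sub>F y in nhds q. y \<in> V" using chart_open[OF c(1)] c(2) by (auto simp: eventually_nhds)
    with vfield_tangent[OF W(5)[OF q]]
    show "\<forall>\<^sub>F q in nhds q. (a q, exp (- u q) * b q, exp (- u q) *\<^sub>R (\<Sum>\<beta>\<in>Basis. Z q (\<lambda>y. \<phi> y \<bullet> \<beta>) *\<^sub>R \<beta>)) =
        (\<Sum>\<beta>\<in>Basis. hat q (a q) (b q) (Z q) (\<lambda>z. chart_map \<phi> z \<bullet> \<beta>) *\<^sub>R \<beta>)"
      by eventually_elim (rule triv_hat[OF _ c(1), symmetric])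
  qed
  have "smooth_section A B W (\<lambda>q. hat q (a q) (b q) (Z q))"
    unfolding smooth_section_B_iff[OF o] using sm hat_in[OF vfield_in[OF W(5)]] by blast
  then show ?thesis using o W(2) by (auto simp: section_near_def)
qed

text \<open>Together with \<open>hat_section\<close> this identifies germs of sections of the
  pullback bundle with triples of two functions and a vector field. Connection, metric and curvature
  are computed on such triples.\<close>

lemma section_hat:
  assumes s: "section_near A B p s"
  obtains a b Z where "smooth_at A p a" "smooth_at A p b" "vfield p Z"
    "\<forall>\<^sub>F q in nhds p. s q = hat q (a q) (b q) (Z q)"
proof -
  obtain W where W: "open_in A W" "p \<in> W" "smooth_section A B W s"
    using s by (auto simp: section_near_def)
  have p: "p \<in> carrier A" using section_near_carrier[OF s] .
  obtain U \<phi> where c: "(U, \<phi>) \<in> A" "p \<in> U" using chart_at p by blast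
  define w where "w q = (\<Sum>\<beta>\<in>Basis. s q (\<lambda>z. chart_map \<phi> z \<bullet> \<beta>) *\<^sub>R \<beta>)" for q
  have "\<forall>(V, \<phi>)\<in>A. \<forall>q\<in>W \<inter> V. smooth_at A q (\<lambda>q. \<Sum>\<beta>\<in>Basis. s q (\<lambda>z. chart_map \<phi> z \<bullet> \<beta>) *\<^sub>R \<beta>)"
    and sin: "\<And>q. q \<in> W \<Longrightarrow> s q \<in> tangent_space N (Psi u q)"
    using W(3) unfolding smooth_section_B_iff[OF W(1)] by blast+
  from bspec[OF this(1) c(1)] have w: "smooth_at A p w"
    using W(2) c(2) by (simp add: w_def[abs_def])
  have "\<forall>q. \<exists>a b z. q \<in> W \<longrightarrow> z \<in> TM q \<and> s q = hat q a b z"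
    using sin hat_surj by metis
  then obtain a b Z where Z: "\<And>q. q \<in> W \<Longrightarrow> Z q \<in> TM q"
    and sq: "\<And>q. q \<in> W \<Longrightarrow> s q = hat q (a q) (b q) (Z q)" by metis
  have ev: "\<forall>\<^sub>F q in nhds p. q \<in> W \<inter> U"
    using W(1,2) c(2) chart_open[OF c(1)] unfolding open_in_def eventually_nhds by blast
  have wq: "w q = (a q, exp (- u q) * b q, exp (- u q) *\<^sub>R (\<Sum>\<beta>\<in>Basis. Z q (\<lambda>y. \<phi> y \<bullet> \<beta>) *\<^sub>R \<beta>))"
    if "q \<in> W \<inter> U" for q
    unfolding w_def using that sq triv_hat[OF Z c(1)] by simp
  \<comment> \<open>The trivialization sees b and Z with the factor exp (- u); since u is smooth,
    multiplication by exp u recovers them smoothly.\<close>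
  have e1: "exp (u q) * (exp (- u q) * k) = k" for q k
    by (simp add: mult.assoc[symmetric] exp_minus)
  have sa: "smooth_at A p a"
    by (rule smooth_at_cong[OF smooth_at_linear[OF bounded_linear_fst w]])
      (use ev in eventually_elim, simp add: wq)
  have sb: "smooth_at A p b"
    by (rule smooth_at_cong[OF smooth_at_mult[OF smooth_at_exp[OF u_smooth[OF p]]
            smooth_at_linear[OF bounded_linear_compose[OF bounded_linear_fst bounded_linear_snd] w]]])
      (use ev in eventually_elim, simp add: wq e1)
  have sZ: "smooth_at A p (\<lambda>q. Z q (\<lambda>y. \<phi> y \<bullet> \<beta>))" if "\<beta> \<in> Basis" for \<beta>
    by (rule smooth_at_cong[OF smooth_at_mult[OF smooth_at_exp[OF u_smooth[OF p]]
            smooth_at_linear[OF bounded_linear_compose[OF bounded_linear_inner_left[of \<beta>]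
                bounded_linear_compose[OF bounded_linear_snd bounded_linear_snd]] w]]])
      (use ev in eventually_elim,
        simp add: wq e1 inner_sum_left inner_Basis if_distrib that cong: if_cong)
  have "vfield p Z"
    unfolding vfield_iff[OF c] using sZ ev by (auto elim!: eventually_mono intro: Z)
  moreover have "\<forall>\<^sub>F q in nhds p. s q = hat q (a q) (b q) (Z q)"
    using ev by eventually_elim (simp add: sq)
  ultimately show ?thesis using that sa sb by blast
qed

text \<open>The three data of \<open>amb_surj\<close> are the derivatives along v of the components
  exp u, 0 and the identity of the immersion.\<close>

lemma differential_Psi:
  assumes v: "v \<in> TM p"
  shows "differential N (Psi u) p v = amb A \<delta> (Psi u p) (exp (u p) * v u) 0 v"
proof -
  have p: "p \<in> carrier A" using tangent_carrier[OF v] .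
  have q: "(exp (u p), 0, p) \<in> carrier N" using Psi_carrier[OF p] by (simp add: Psi_def)
  obtain U \<phi> where c: "(U, \<phi>) \<in> A" "p \<in> U" using chart_at p by blast
  obtain W where W: "open W" "\<phi> p \<in> W" "W \<subseteq> \<phi> ` U" "smooth_on W ((\<lambda>q. exp (u q)) \<circ> inv_into U \<phi>)"
    using smooth_atE[OF smooth_at_exp[OF u_smooth[OF p]] c] .
  let ?X = "differential N (Psi u) p v"
  have X: "?X \<in> tangent_space N (Psi u p)"
  proof (rule differential_in[OF manifold_axioms manifold_N c chart_N[OF c(1)] W(1-3) _ _ v])
    show "Psi u (inv_into U \<phi> y) \<in> chart_dom U" if "y \<in> W" for y
      using that W(3) chart_inv_mem[of y \<phi> U] \<delta> by (auto simp: Psi_def chart_dom_def)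
    have "smooth_on W (\<lambda>y. (((\<lambda>q. exp (u q)) \<circ> inv_into U \<phi>) y, 0, y))"
      by (intro smooth_on_Pair W smooth_on_const smooth_on_id)
    then show "smooth_on W (\<lambda>y. chart_map \<phi> (Psi u (inv_into U \<phi> y)))"
      by (rule smooth_on_cong[OF W(1), rotated]) (use W(3) chart_inv2[of _ \<phi> U] in \<open>auto simp: Psi_def\<close>)
  qed
  have 1: "?X (\<lambda>(t, r, x). t) = exp (u p) * v u"
    using smooth_at_fst[OF Psi_carrier[OF p]]
    by (simp add: differential_def smooth_near_eq comp_def Psi_def tangent_exp[OF v u_smooth[OF p]])
  have 2: "?X (\<lambda>(t, r, x). r) = 0"
    using smooth_at_snd[OF Psi_carrier[OF p]]
    by (simp add: differential_def smooth_near_eq comp_def Psi_def tangent_const[OF v])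
  have 3: "differential A (\<lambda>(t, r, x). x) (exp (u p), 0, p) ?X = v"
  proof
    show "differential A (\<lambda>(t, r, x). x) (exp (u p), 0, p) ?X f = v f" for f
      using smooth_at_proj[OF _ q, of f] tangent_not_smooth[OF v, of f]
      by (simp add: differential_def smooth_near_eq comp_def Psi_def case_prod_beta')
  qed
  show ?thesis
    using amb_surj(2)[OF X[unfolded Psi_def[of u p]]] unfolding 1 2 3 by (simp only: Psi_def)
qed

text \<open>The pullback property speaks only of restrictions of ambient fields. The section here is
  exp (- u) times the restriction of \<open>Q a b Z\<close>, and the pushed-forward direction is
  \<open>Q (v u) 0 V\<close>. Its Euler part contributes multiples of v u, which the derivative of
  exp (- u) in the Leibniz rule cancels.\<close>

lemma Du_hat_const:
  assumes v: "v \<in> TM p" and Z: "vfield p Z"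
  shows "Du p v (\<lambda>q. hat q a b (Z q)) =
    hat p (- g p (S p v) (Z p)) (- g p v (Z p)) (D p v Z + (a *\<^sub>R v + b *\<^sub>R S p v))"
proof -
  have p: "p \<in> carrier A" using tangent_carrier[OF v] .
  obtain V where V: "vfield p V" "V p = v" using vfield_exists[OF v] .
  have q: "(exp (u p), 0, p) \<in> carrier N" using Psi_carrier[OF p] by (simp add: Psi_def)
  have e: "exp (- u q) * (exp (u q) * k) = k" for q k
    by (simp add: mult.assoc[symmetric] exp_minus)
  have e': "exp (- u q) * (k * exp (u q)) = k" for q k
    using e[of q k] by (simp add: mult.commute)
  have e'': "exp (- u q) * exp (u q) = 1" for q by (simp add: exp_minus)
  have QP: "Q a b Z (Psi u q) = hat q (exp (u q) * a) (exp (u q) * b) (exp (u q) *\<^sub>R Z q)" for q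
    by (simp add: hat_def Q_def Psi_def e e'' mult.commute[of a])
  have sQ: "section_near A B p (\<lambda>q. Q a b Z (Psi u q))"
    unfolding QP by (intro hat_section smooth_at_mult smooth_at_exp u_smooth smooth_at_const p vfield_scaleR Z)
  have hQ: "hat q a b (Z q) = exp (- u q) *\<^sub>R Q a b Z (Psi u q)" for q
    by (simp add: hat_def Q_def Psi_def amb_scaleR e')
  have sm: "smooth_at A p (\<lambda>q. exp (- u q))" by (intro smooth_at_exp smooth_at_minus u_smooth p)
  have ve: "v (\<lambda>q. exp (- u q)) = - (exp (- u p) * v u)"
    using tangent_exp[OF v smooth_at_minus[OF u_smooth[OF p]]] by (simp add: tangent_minus[OF v u_smooth[OF p]])
  have d: "differential N (Psi u) p v = Q (v u) 0 V (Psi u p)"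
    by (simp add: differential_Psi[OF v] Q_def Psi_def V mult.commute)
  have "Du p v (\<lambda>q. Q a b Z (Psi u q)) = Damb (Psi u p) (differential N (Psi u) p v) (Q a b Z)"
    using pb Q_vfield[OF Z q, of a b] p v
    unfolding is_pullback_connection_def Psi_def by blast
  also have "\<dots> = amb A \<delta> (Psi u p) (exp (u p) * (v u * a - g p (S p v) (Z p))) (v u * b - g p v (Z p))
      (D p v Z + (v u *\<^sub>R Z p + (a *\<^sub>R v + b *\<^sub>R S p v)))"
    unfolding d Psi_def using Damb_Q[OF V(1) Z, of "exp (u p)" "v u" 0 a b] by (simp add: V(2))
  finally have DQ: "Du p v (\<lambda>q. Q a b Z (Psi u q)) = amb A \<delta> (Psi u p) (exp (u p) * (v u * a - g p (S p v) (Z p)))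
      (v u * b - g p v (Z p)) (D p v Z + (v u *\<^sub>R Z p + (a *\<^sub>R v + b *\<^sub>R S p v)))" .
  have Qp: "Q a b Z (Psi u p) = amb A \<delta> (Psi u p) (a * exp (u p)) b (Z p)"
    by (simp add: Q_def Psi_def)
  have "Du p v (\<lambda>q. hat q a b (Z q)) = v (\<lambda>q. exp (- u q)) *\<^sub>R Q a b Z (Psi u p)
      + exp (- u p) *\<^sub>R Du p v (\<lambda>q. Q a b Z (Psi u q))"
    unfolding hQ by (rule connection_scaleR[OF Du_conn sQ v sm])
  also have "\<dots> = amb A \<delta> (Psi u p)
      (- (exp (- u p) * v u) * (a * exp (u p)) + exp (- u p) * (exp (u p) * (v u * a - g p (S p v) (Z p))))
      (- (exp (- u p) * v u) * b + exp (- u p) * (v u * b - g p v (Z p)))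
      ((- (exp (- u p) * v u)) *\<^sub>R Z p + exp (- u p) *\<^sub>R (D p v Z + (v u *\<^sub>R Z p + (a *\<^sub>R v + b *\<^sub>R S p v))))"
    unfolding ve DQ Qp by (simp only: amb_scaleR amb_plus)
  also have "- (exp (- u p) * v u) * (a * exp (u p)) + exp (- u p) * (exp (u p) * (v u * a - g p (S p v) (Z p)))
      = - g p (S p v) (Z p)"
    by (simp add: exp_minus field_simps)
  also have "- (exp (- u p) * v u) * b + exp (- u p) * (v u * b - g p v (Z p)) = exp (- u p) * - g p v (Z p)"
    by (simp add: algebra_simps)
  also have "(- (exp (- u p) * v u)) *\<^sub>R Z p + exp (- u p) *\<^sub>R (D p v Z + (v u *\<^sub>R Z p + (a *\<^sub>R v + b *\<^sub>R S p v)))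
      = exp (- u p) *\<^sub>R (D p v Z + (a *\<^sub>R v + b *\<^sub>R S p v))"
    by (simp add: scaleR_add_right)
  finally show ?thesis by (simp add: hat_def)
qed

lemma Du_hat:
  assumes v: "v \<in> TM p" and a: "smooth_at A p a" and b: "smooth_at A p b" and Z: "vfield p Z"
  shows "Du p v (\<lambda>q. hat q (a q) (b q) (Z q)) =
    hat p (v a - g p (S p v) (Z p)) (v b - g p v (Z p)) (D p v Z + (a p *\<^sub>R v + b p *\<^sub>R S p v))"
proof -
  have p: "p \<in> carrier A" using tangent_carrier[OF v] .
  note z = zero_in[OF p] and vz = vfield_zero[OF p]
  \<comment> \<open>The vector field Z could vary from the start. The coefficients a and b become
    functions by the Leibniz rule, applied to the constant frame sections.\<close>
  have e: "hat q (a q) (b q) (Z q) = (a q *\<^sub>R hat q 1 0 0 + b q *\<^sub>R hat q 0 1 0) + hat q 0 0 (Z q)" for q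
    by (simp add: hat_scaleR hat_plus)
  note c = smooth_at_const[OF p]
  have s1: "section_near A B p (\<lambda>q. hat q 1 0 0)" by (rule hat_section[OF c c vz])
  have s2: "section_near A B p (\<lambda>q. hat q 0 1 0)" by (rule hat_section[OF c c vz])
  have s3: "section_near A B p (\<lambda>q. hat q 0 0 (Z q))" by (rule hat_section[OF c c Z])
  have s1a: "section_near A B p (\<lambda>q. a q *\<^sub>R hat q 1 0 0)"
    using hat_section[OF a c[of 0] vz] by (simp add: hat_scaleR)
  have s2b: "section_near A B p (\<lambda>q. b q *\<^sub>R hat q 0 1 0)"
    using hat_section[OF c[of 0] b vz] by (simp add: hat_scaleR)
  have s12: "section_near A B p (\<lambda>q. a q *\<^sub>R hat q 1 0 0 + b q *\<^sub>R hat q 0 1 0)"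
    using hat_section[OF a b vz] by (simp add: hat_scaleR hat_plus)
  have D0: "D p v (\<lambda>q. 0) = 0" using D_cscaleR[OF vz v, of 0] by simp
  have g0: "g p w 0 = 0" if "w \<in> TM p" for w
    using g_scaleR[OF that z, of 0] by simp
  have 1: "Du p v (\<lambda>q. hat q 1 0 0) = hat p 0 0 v"
    using Du_hat_const[OF v vz, of 1 0] by (simp add: D0 g0 v S_in)
  have 2: "Du p v (\<lambda>q. hat q 0 1 0) = hat p 0 0 (S p v)"
    using Du_hat_const[OF v vz, of 0 1] by (simp add: D0 g0 v S_in)
  have 3: "Du p v (\<lambda>q. hat q 0 0 (Z q)) = hat p (- g p (S p v) (Z p)) (- g p v (Z p)) (D p v Z)"
    using Du_hat_const[OF v Z, of 0 0] by simp
  have "Du p v (\<lambda>q. hat q (a q) (b q) (Z q)) =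
      (v a *\<^sub>R hat p 1 0 0 + a p *\<^sub>R hat p 0 0 v) + (v b *\<^sub>R hat p 0 1 0 + b p *\<^sub>R hat p 0 0 (S p v))
      + hat p (- g p (S p v) (Z p)) (- g p v (Z p)) (D p v Z)"
    unfolding e connection_add[OF Du_conn s12 v s3] connection_add[OF Du_conn s1a v s2b]
      connection_scaleR[OF Du_conn s1 v a] connection_scaleR[OF Du_conn s2 v b] 1 2 3 ..
  then show ?thesis by (simp add: hat_scaleR hat_plus add.commute add.left_commute)
qed

section \<open>Second derivatives and the curvature of the induced connection\<close>

definition dS :: "'m \<Rightarrow> 'm tvec \<Rightarrow> ('m \<Rightarrow> 'm tvec) \<Rightarrow> 'm tvec"
  where "dS p v W = D p v (\<lambda>q. S q (W q)) - S p (D p v W)"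

lemma dS_in:
  assumes v: "v \<in> TM p" and W: "vfield p W" shows "dS p v W \<in> TM p"
  unfolding dS_def
  by (rule subspace_diff[OF subspace_tangent_space[OF tangent_carrier[OF v]] D_in[OF S_vfield[OF W] v] S_in[OF D_in[OF W v]]])

text \<open>\<open>dS\<close> is the covariant derivative of S, and the derivatives of f cancel
  between its two terms. The curvature of the pullback bundle contains it, so its independence of
  the extension is what makes that curvature well defined.\<close>

lemma dS_tensorial:
  assumes v: "v \<in> TM p" and W: "vfield p W" and W': "vfield p W'" and eq: "W p = W' p"
  shows "dS p v W = dS p v W'"
proof (rule tensorial_eqI[of p "dS p v"])
  have p: "p \<in> carrier A" using tangent_carrier[OF v] .
  show "dS p v (\<lambda>q. V q + W q) = dS p v V + dS p v W" if V: "vfield p V" and W: "vfield p W" for V W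
  proof -
    have "\<forall>\<^sub>F q in nhds p. S q (V q) + S q (W q) = S q (V q + W q)"
      using vfield_tangent[OF V] vfield_tangent[OF W]
      by eventually_elim (simp add: lin_on_add[OF S_lin[OF tangent_carrier]])
    then have "D p v (\<lambda>q. S q (V q + W q)) = D p v (\<lambda>q. S q (V q) + S q (W q))"
      by (rule D_cong[OF vfield_add[OF S_vfield[OF V] S_vfield[OF W]] v])
    then show ?thesis
      by (simp add: dS_def D_add[OF S_vfield[OF V] v S_vfield[OF W]] D_add[OF V v W]
          lin_on_add[OF S_lin[OF p] D_in[OF V v] D_in[OF W v]])
  qed
  show "dS p v (\<lambda>q. f q *\<^sub>R V q) = f p *\<^sub>R dS p v V" if f: "smooth_at A p f" and V: "vfield p V" for f V
  proof -
    have "\<forall>\<^sub>F q in nhds p. f q *\<^sub>R S q (V q) = S q (f q *\<^sub>R V q)"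
      using vfield_tangent[OF V]
      by eventually_elim (simp add: lin_on_scaleR[OF S_lin[OF tangent_carrier]])
    then have "D p v (\<lambda>q. S q (f q *\<^sub>R V q)) = D p v (\<lambda>q. f q *\<^sub>R S q (V q))"
      by (rule D_cong[OF vfield_scaleR[OF f S_vfield[OF V]] v])
    then show ?thesis
      by (simp add: dS_def D_scaleR[OF S_vfield[OF V] v f] D_scaleR[OF V v f]
          lin_on_add[OF S_lin[OF p] scale_in[OF vfield_in[OF V]] scale_in[OF D_in[OF V v]]]
          lin_on_scaleR[OF S_lin[OF p]] vfield_in[OF V] D_in[OF V v] scaleR_diff_right)
  qed
  show "dS p v V = dS p v W" if V: "vfield p V" and W: "vfield p W" and e: "\<forall>\<^sub>F q in nhds p. V q = W q" for V W
  proof -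
    have "\<forall>\<^sub>F q in nhds p. S q (V q) = S q (W q)" using e by eventually_elim simp
    then have "D p v (\<lambda>q. S q (W q)) = D p v (\<lambda>q. S q (V q))" by (rule D_cong[OF S_vfield[OF V] v])
    then show ?thesis using D_cong[OF V v e] by (simp add: dS_def)
  qed
qed (fact W W' eq)+

text \<open>The Cotton tensor if S is the Schouten endomorphism. It takes fields because
  \<open>dS\<close> differentiates its last argument.\<close>

definition cotton :: "'m \<Rightarrow> ('m \<Rightarrow> 'm tvec) \<Rightarrow> ('m \<Rightarrow> 'm tvec) \<Rightarrow> 'm tvec"
  where "cotton p V W = dS p (V p) W - dS p (W p) V"

text \<open>The Weyl tensor if S is the Schouten endomorphism: R corrected by the Kulkarni-Nomizu
  product of g with g(S -, -).\<close>

definition weyl :: "'m \<Rightarrow> 'm tvec \<Rightarrow> 'm tvec \<Rightarrow> 'm tvec \<Rightarrow> 'm tvec"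
  where "weyl p v w z = Rm p v w z - g p (S p w) z *\<^sub>R v + g p (S p v) z *\<^sub>R w
    - g p w z *\<^sub>R S p v + g p v z *\<^sub>R S p w"

lemma minus_in: "v \<in> TM p \<Longrightarrow> w \<in> TM p \<Longrightarrow> v - w \<in> TM p"
  by (rule subspace_diff[OF subspace_tangent_space[OF tangent_carrier]])

lemma weyl_in:
  "v \<in> TM p \<Longrightarrow> w \<in> TM p \<Longrightarrow> z \<in> TM p \<Longrightarrow> weyl p v w z \<in> TM p"
  unfolding weyl_def by (intro add_in minus_in scale_in Rm_in S_in)

lemma weyl_scaleR:
  assumes "v \<in> TM p" "w \<in> TM p" "z \<in> TM p"
  shows "weyl p v w (k *\<^sub>R z) = k *\<^sub>R weyl p v w z"
  using assms lin_on_scaleR[OF Rm_lin_on(2)[OF assms(1,2)] assms(3), of k]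
  by (simp add: weyl_def g_scaleR S_in scaleR_add_right scaleR_diff_right)

text \<open>This is \<open>Du_hat\<close> applied twice. The inner derivative is taken at every q
  near p, so the section and its expression in the frame must agree near each such q and not only
  near p; \<open>eventually_eventually\<close> supplies this.\<close>

lemma Du_Du:
  assumes v: "v \<in> TM p" and W: "vfield p W"
    and a: "smooth_at A p a" and b: "smooth_at A p b" and Z: "vfield p Z"
    and s: "section_near A B p s" and e: "\<forall>\<^sub>F q in nhds p. s q = hat q (a q) (b q) (Z q)"
  shows "Du p v (\<lambda>q. Du q (W q) s) = hat p
    (v (\<lambda>q. W q a) - (g p (D p v (\<lambda>q. S q (W q))) (Z p) + g p (S p (W p)) (D p v Z))
      - g p (S p v) (D p (W p) Z + (a p *\<^sub>R W p + b p *\<^sub>R S p (W p))))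
    (v (\<lambda>q. W q b) - (g p (D p v W) (Z p) + g p (W p) (D p v Z))
      - g p v (D p (W p) Z + (a p *\<^sub>R W p + b p *\<^sub>R S p (W p))))
    (D p v (\<lambda>q. D q (W q) Z) + ((v a *\<^sub>R W p + a p *\<^sub>R D p v W)
      + (v b *\<^sub>R S p (W p) + b p *\<^sub>R D p v (\<lambda>q. S q (W q))))
      + ((W p a - g p (S p (W p)) (Z p)) *\<^sub>R v + (W p b - g p (W p) (Z p)) *\<^sub>R S p v))"
proof -
  define a1 where "a1 q = W q a - g q (S q (W q)) (Z q)" for q
  define b1 where "b1 q = W q b - g q (W q) (Z q)" for q
  define Z1 where "Z1 q = D q (W q) Z + (a q *\<^sub>R W q + b q *\<^sub>R S q (W q))" for q
  have a1: "smooth_at A p a1"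
    unfolding a1_def[abs_def] by (rule smooth_at_diff[OF vfield_apply[OF W a] g_smooth[OF S_vfield[OF W] Z]])
  have b1: "smooth_at A p b1"
    unfolding b1_def[abs_def] by (rule smooth_at_diff[OF vfield_apply[OF W b] g_smooth[OF W Z]])
  have Z1: "vfield p Z1"
    unfolding Z1_def[abs_def] by (rule vfield_add[OF D_vfield[OF W Z] vfield_add[OF vfield_scaleR[OF a W] vfield_scaleR[OF b S_vfield[OF W]]]])
  have "\<forall>\<^sub>F q in nhds p. \<forall>\<^sub>F q' in nhds q. s q' = hat q' (a q') (b q') (Z q')"
    using e by (simp add: eventually_eventually)
  with vfield_tangent[OF W] smooth_at_eventually[OF a] smooth_at_eventually[OF b]
    section_near_eventually[OF Z] section_near_eventually[OF s]
  have "\<forall>\<^sub>F q in nhds p. Du q (W q) s = hat q (a1 q) (b1 q) (Z1 q)"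
  proof eventually_elim
    case (elim q)
    have "Du q (W q) s = Du q (W q) (\<lambda>q'. hat q' (a q') (b q') (Z q'))"
      by (rule connection_cong[OF Du_conn elim(5,1) hat_section[OF elim(2-4)] elim(6)])
    then show ?case by (simp only: Du_hat[OF elim(1-4)] a1_def b1_def Z1_def)
  qed
  then have "Du p v (\<lambda>q. Du q (W q) s) = Du p v (\<lambda>q. hat q (a1 q) (b1 q) (Z1 q))"
    by (intro connection_cong[OF Du_conn section_near_connection[OF Du_conn W s] v hat_section[OF a1 b1 Z1]])
  also have "\<dots> = hat p (v a1 - g p (S p v) (Z1 p)) (v b1 - g p v (Z1 p)) (D p v Z1 + (a1 p *\<^sub>R v + b1 p *\<^sub>R S p v))"
    by (rule Du_hat[OF v a1 b1 Z1])
  also have "v a1 = v (\<lambda>q. W q a) - (g p (D p v (\<lambda>q. S q (W q))) (Z p) + g p (S p (W p)) (D p v Z))"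
    unfolding a1_def[abs_def]
    by (simp add: tangent_diff[OF v vfield_apply[OF W a] g_smooth[OF S_vfield[OF W] Z]]
        metric_derivative[OF v S_vfield[OF W] Z])
  also have "v b1 = v (\<lambda>q. W q b) - (g p (D p v W) (Z p) + g p (W p) (D p v Z))"
    unfolding b1_def[abs_def]
    by (simp add: tangent_diff[OF v vfield_apply[OF W b] g_smooth[OF W Z]] metric_derivative[OF v W Z])
  also have "D p v Z1 = D p v (\<lambda>q. D q (W q) Z) + ((v a *\<^sub>R W p + a p *\<^sub>R D p v W)
      + (v b *\<^sub>R S p (W p) + b p *\<^sub>R D p v (\<lambda>q. S q (W q))))"
    unfolding Z1_def[abs_def]
    by (simp only: D_add[OF D_vfield[OF W Z] v vfield_add[OF vfield_scaleR[OF a W] vfield_scaleR[OF b S_vfield[OF W]]]]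
        D_add[OF vfield_scaleR[OF a W] v vfield_scaleR[OF b S_vfield[OF W]]]
        D_scaleR[OF W v a] D_scaleR[OF S_vfield[OF W] v b])
  finally show ?thesis by (simp only: a1_def b1_def Z1_def)
qed

lemma hat_minus: "hat p a b z - hat p a' b' z' = hat p (a - a') (b - b') (z - z')"
proof -
  have "hat p a b z - hat p a' b' z' = hat p a b z + (- 1) *\<^sub>R hat p a' b' z'" by simp
  then show ?thesis unfolding hat_scaleR hat_plus by simp
qed

text \<open>The second component vanishes because D is torsion-free and both g and g(S -, -) are
  symmetric. With S inserted the same symmetries leave only the Cotton term in the first component.
  All terms with the coefficient a cancel, so a section of the line is annihilated.\<close>

lemma Du_curv:
  assumes V: "vfield p V" and W: "vfield p W"
    and a: "smooth_at A p a" and b: "smooth_at A p b" and Z: "vfield p Z"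
    and s: "section_near A B p s" and e: "\<forall>\<^sub>F q in nhds p. s q = hat q (a q) (b q) (Z q)"
  shows "Du p (V p) (\<lambda>q. Du q (W q) s) - Du p (W p) (\<lambda>q. Du q (V q) s) - Du p (lie_bracket A V W p) s
    = hat p (- g p (cotton p V W) (Z p)) 0 (weyl p (V p) (W p) (Z p) + b p *\<^sub>R cotton p V W)"
proof -
  have p: "p \<in> carrier A" using section_near_carrier[OF V] .
  note T = vfield_in[OF V] vfield_in[OF W] vfield_in[OF Z]
  note bi = bracket_in[OF V W]
  note mem = T S_in add_in minus_in scale_in D_in V W Z S_vfield
  have "Du p (lie_bracket A V W p) s = Du p (lie_bracket A V W p) (\<lambda>q. hat q (a q) (b q) (Z q))"
    by (rule connection_cong[OF Du_conn s bi hat_section[OF a b Z] e])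
  then have 3: "Du p (lie_bracket A V W p) s = hat p
      (lie_bracket A V W p a - g p (S p (lie_bracket A V W p)) (Z p))
      (lie_bracket A V W p b - g p (lie_bracket A V W p) (Z p))
      (D p (lie_bracket A V W p) Z + (a p *\<^sub>R lie_bracket A V W p + b p *\<^sub>R S p (lie_bracket A V W p)))"
    unfolding Du_hat[OF bi a b Z] .
  have SB: "S p (lie_bracket A V W p) = S p (D p (V p) W) - S p (D p (W p) V)"
    unfolding torsion[OF V W]
    by (rule lin_on_diff[OF S_lin[OF p] subspace_tangent_space[OF p] D_in[OF W T(1)] D_in[OF V T(2)]])
  have sy: "g p (S p (V p)) (W p) = g p (S p (W p)) (V p)" "g p (S p (V p)) (S p (W p)) = g p (S p (W p)) (S p (V p))"
    "g p (V p) (S p (W p)) = g p (S p (W p)) (V p)" "g p (W p) (S p (V p)) = g p (S p (V p)) (W p)"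
    "g p (V p) (W p) = g p (W p) (V p)"
    using S_sym[OF T(1,2)] g_sym[OF S_in[OF T(1)] S_in[OF T(2)]] g_sym[OF T(1) S_in[OF T(2)]]
      g_sym[OF T(2) S_in[OF T(1)]] g_sym[OF T(1,2)] by simp_all
  have cv: "Rm p (V p) (W p) (Z p) = D p (V p) (\<lambda>q. D q (W q) Z) - D p (W p) (\<lambda>q. D q (V q) Z) - D p (lie_bracket A V W p) Z"
    unfolding curvature_eq[OF V W Z] curv_def ..
  show ?thesis
    unfolding Du_Du[OF T(1) W a b Z s e] Du_Du[OF T(2) V a b Z s e] 3 hat_minus
  proof (rule arg_cong3[where f = "hat p"])
    show "V p (\<lambda>q. W q a) - (g p (D p (V p) (\<lambda>q. S q (W q))) (Z p) + g p (S p (W p)) (D p (V p) Z))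
        - g p (S p (V p)) (D p (W p) Z + (a p *\<^sub>R W p + b p *\<^sub>R S p (W p)))
      - (W p (\<lambda>q. V q a) - (g p (D p (W p) (\<lambda>q. S q (V q))) (Z p) + g p (S p (V p)) (D p (W p) Z))
        - g p (S p (W p)) (D p (V p) Z + (a p *\<^sub>R V p + b p *\<^sub>R S p (V p))))
      - (lie_bracket A V W p a - g p (S p (lie_bracket A V W p)) (Z p))
      = - g p (cotton p V W) (Z p)"
      unfolding bracket_apply[OF a] SB cotton_def dS_def
      by (simp add: g_add g_scaleR g_diff2 mem sy)
    show "V p (\<lambda>q. W q b) - (g p (D p (V p) W) (Z p) + g p (W p) (D p (V p) Z))
        - g p (V p) (D p (W p) Z + (a p *\<^sub>R W p + b p *\<^sub>R S p (W p)))
      - (W p (\<lambda>q. V q b) - (g p (D p (W p) V) (Z p) + g p (V p) (D p (W p) Z))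
        - g p (W p) (D p (V p) Z + (a p *\<^sub>R V p + b p *\<^sub>R S p (V p))))
      - (lie_bracket A V W p b - g p (lie_bracket A V W p) (Z p)) = 0"
      unfolding bracket_apply[OF b] unfolding torsion[OF V W]
      by (simp add: g_add g_scaleR g_diff2 mem sy)
    show "D p (V p) (\<lambda>q. D q (W q) Z) + ((V p a *\<^sub>R W p + a p *\<^sub>R D p (V p) W)
        + (V p b *\<^sub>R S p (W p) + b p *\<^sub>R D p (V p) (\<lambda>q. S q (W q))))
        + ((W p a - g p (S p (W p)) (Z p)) *\<^sub>R V p + (W p b - g p (W p) (Z p)) *\<^sub>R S p (V p))
      - (D p (W p) (\<lambda>q. D q (V q) Z) + ((W p a *\<^sub>R V p + a p *\<^sub>R D p (W p) V)
        + (W p b *\<^sub>R S p (V p) + b p *\<^sub>R D p (W p) (\<lambda>q. S q (V q))))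
        + ((V p a - g p (S p (V p)) (Z p)) *\<^sub>R W p + (V p b - g p (V p) (Z p)) *\<^sub>R S p (W p)))
      - (D p (lie_bracket A V W p) Z + (a p *\<^sub>R lie_bracket A V W p + b p *\<^sub>R S p (lie_bracket A V W p)))
      = weyl p (V p) (W p) (Z p) + b p *\<^sub>R cotton p V W"
      unfolding weyl_def cv SB cotton_def dS_def
      by (simp only: torsion[OF V W] scaleR_add_right scaleR_diff_right scaleR_diff_left) (simp add: algebra_simps)
  qed
qed

text \<open>Other extensions change the expression of \<open>Du_curv\<close> only through their
  values at p and through \<open>cotton\<close>. The values are fixed by injectivity of the frame,
  and \<open>dS_tensorial\<close> takes care of \<open>cotton\<close>.\<close>

lemma curvature_B:
  assumes V: "vfield p V" and W: "vfield p W" and z: "z \<in> TM p"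
  shows "curvature A B Du p (V p) (W p) (hat p a b z) =
    hat p (- g p (cotton p V W) z) 0 (weyl p (V p) (W p) z + b *\<^sub>R cotton p V W)"
  unfolding curvature_def
proof (rule the_equality)
  have p: "p \<in> carrier A" using section_near_carrier[OF V] .
  note c = smooth_at_const[OF p]
  obtain Z where Z: "vfield p Z" "Z p = z" using vfield_exists[OF z] .
  have s: "section_near A B p (\<lambda>q. hat q a b (Z q))" by (rule hat_section[OF c c Z(1)])
  show "\<exists>V' W' s. section_near A (tangent_bundle A) p V' \<and> V' p = V p \<and>
      section_near A (tangent_bundle A) p W' \<and> W' p = W p \<and> section_near A B p s \<and> s p = hat p a b z \<and>
      hat p (- g p (cotton p V W) z) 0 (weyl p (V p) (W p) z + b *\<^sub>R cotton p V W) =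
      Du p (V p) (\<lambda>q. Du q (W' q) s) - Du p (W p) (\<lambda>q. Du q (V' q) s) - Du p (lie_bracket A V' W' p) s"
    by (rule exI[of _ V], rule exI[of _ W], rule exI[of _ "\<lambda>q. hat q a b (Z q)"])
      (simp add: Du_curv[OF V W c[of a] c[of b] Z(1) s] V W s Z(2))
  fix y
  assume "\<exists>V' W' s. section_near A (tangent_bundle A) p V' \<and> V' p = V p \<and>
      section_near A (tangent_bundle A) p W' \<and> W' p = W p \<and> section_near A B p s \<and> s p = hat p a b z \<and>
      y = Du p (V p) (\<lambda>q. Du q (W' q) s) - Du p (W p) (\<lambda>q. Du q (V' q) s) - Du p (lie_bracket A V' W' p) s"
  then obtain V' W' s where V': "vfield p V'" "V' p = V p" and W': "vfield p W'" "W' p = W p"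
    and s: "section_near A B p s" "s p = hat p a b z"
    and y: "y = Du p (V' p) (\<lambda>q. Du q (W' q) s) - Du p (W' p) (\<lambda>q. Du q (V' q) s) - Du p (lie_bracket A V' W' p) s"
    by (elim exE conjE) simp
  obtain a' b' Z' where h: "smooth_at A p a'" "smooth_at A p b'" "vfield p Z'"
    "\<forall>\<^sub>F q in nhds p. s q = hat q (a' q) (b' q) (Z' q)"
    using section_hat[OF s(1)] .
  have "hat p (a' p) (b' p) (Z' p) = hat p a b z"
    using eventually_nhds_x_imp_x[OF h(4)] s(2) by simp
  from hat_inj[OF vfield_in[OF h(3)] z this] have eq: "b' p = b" "Z' p = z" by simp_all
  have "cotton p V' W' = cotton p V W"
    unfolding cotton_def V'(2) W'(2)
    using dS_tensorial[OF vfield_in[OF V] W'(1) W W'(2)] dS_tensorial[OF vfield_in[OF W] V'(1) V V'(2)] by simp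
  then show "y = hat p (- g p (cotton p V W) z) 0 (weyl p (V p) (W p) z + b *\<^sub>R cotton p V W)"
    unfolding y Du_curv[OF V'(1) W'(1) h(1-3) s(1) h(4)] by (simp add: eq V'(2) W'(2))
qed

text \<open>On the orthogonal complement of the line, where b = 0, the Cotton tensor appears only in
  the coefficient along the line. Normality looks at the curvature modulo that line, so the term can
  be hidden in k.\<close>

lemma curvature_B_line:
  assumes v: "v \<in> TM p" and w: "w \<in> TM p" and z: "z \<in> TM p"
  obtains k where "curvature A B Du p v w (hat p a 0 z) = hat p k 0 (weyl p v w z)" "z = 0 \<Longrightarrow> k = 0"
proof -
  obtain V where V: "vfield p V" "V p = v" using vfield_exists[OF v] .
  obtain W where W: "vfield p W" "W p = w" using vfield_exists[OF w] .
  have C: "cotton p V W \<in> TM p"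
    unfolding cotton_def by (intro minus_in dS_in vfield_in V W)
  show ?thesis
  proof (rule that)
    show "curvature A B Du p v w (hat p a 0 z) = hat p (- g p (cotton p V W) z) 0 (weyl p v w z)"
      using curvature_B[OF V(1) W(1) z, of a 0] V(2) W(2) by simp
    show "- g p (cotton p V W) z = 0" if "z = 0"
      using g_scaleR[OF C z, of 0] that by simp
  qed
qed

end

section \<open>The standard conformal tractor bundle\<close>

context manifold begin

lemma
  assumes c: "(U, \<phi>) \<in> A" "p \<in> U"
  shows bij_betw_triv: "bij_betw (\<lambda>X. \<Sum>b\<in>Basis. X (\<lambda>q. \<phi> q \<bullet> b) *\<^sub>R b) (TM p) UNIV"
    and inv_triv: "inv_into (TM p) (\<lambda>X. \<Sum>b\<in>Basis. X (\<lambda>q. \<phi> q \<bullet> b) *\<^sub>R b) = chart_tvec A U \<phi> p"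
proof -
  let ?T = "\<lambda>X. \<Sum>b\<in>Basis. X (\<lambda>q. \<phi> q \<bullet> b) *\<^sub>R b"
  have 1: "?T (chart_tvec A U \<phi> p y) = y" for y
    by (simp add: chart_tvec_coord[OF c] euclidean_representation)
  have 2: "chart_tvec A U \<phi> p (?T X) = X" if "X \<in> TM p" for X
    using tangent_chart_tvec[OF c that] by simp
  show bij: "bij_betw ?T (TM p) UNIV"
    by (rule bij_betw_byWitness[of _ "chart_tvec A U \<phi> p"]) (use 1 2 chart_tvec_in[OF c] in auto)
  show "inv_into (TM p) ?T = chart_tvec A U \<phi> p"
  proof
    show "inv_into (TM p) ?T y = chart_tvec A U \<phi> p y" for y
      by (rule inv_into_f_eq) (use bij 1 chart_tvec_in[OF c] in \<open>auto simp: bij_betw_def\<close>)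
  qed
qed

end

lemma lin_on_triv: "lin_on S (\<lambda>X. \<Sum>b\<in>Basis. X (\<psi> b) *\<^sub>R b)"
  for S :: "('a \<Rightarrow> real) set" and \<psi> :: "'b::euclidean_space \<Rightarrow> 'a"
  by (simp add: lin_on_def scaleR_fun_apply scaleR_add_left sum.distrib scaleR_sum_right)

lemma span_ray: "span (ray \<xi> p) = range (\<lambda>a. a *\<^sub>R \<xi> p)"
proof -
  have "ray \<xi> p \<subseteq> span {\<xi> p}" by (auto simp: ray_def intro: span_scale span_base)
  moreover have "\<xi> p \<in> ray \<xi> p" by (auto simp: ray_def intro!: exI[of _ 1])
  ultimately have "span (ray \<xi> p) = span {\<xi> p}"
    by (intro span_eq[THEN iffD2]) (auto intro: span_base)
  then show ?thesis by (simp add: span_singleton)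
qed

section \<open>The line of \<xi>, its sections and the map beta in the rescaled frame\<close>

context ambient_pullback begin

abbreviation "\<xi> \<equiv> xi A \<delta> u"

abbreviation "L \<equiv> ray (xi A \<delta> u)"

lemma xi_hat: "\<xi> p = hat p (exp (u p)) 0 0"
proof -
  have "ambient_dt A \<delta> (Psi u p) = amb A \<delta> (Psi u p) 1 0 0"
    by (simp add: Psi_def ambient_dt_def amb_def smooth_near_eq fun_eq_iff)
  then show ?thesis by (simp add: xi_def hat_def amb_scaleR)
qed

lemma span_L: "span (L p) = range (\<lambda>a. hat p a 0 0)"
proof -
  have "a *\<^sub>R \<xi> p = hat p (a * exp (u p)) 0 0" for a by (simp add: xi_hat hat_scaleR)
  moreover have "range (\<lambda>a. hat p (a * exp (u p)) 0 0) = range (\<lambda>a. hat p a 0 0)"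
  proof (intro equalityI image_subsetI)
    show "hat p (a * exp (u p)) 0 0 \<in> range (\<lambda>a. hat p a 0 0)" for a by blast
    show "hat p a 0 0 \<in> range (\<lambda>a. hat p (a * exp (u p)) 0 0)" for a
      by (rule image_eqI[of _ _ "a / exp (u p)"]) auto
  qed
  ultimately show ?thesis by (simp add: span_ray)
qed

lemma L_hat: "x \<in> L p \<Longrightarrow> \<exists>a. x = hat p a 0 0"
  by (auto simp: ray_def xi_hat hat_scaleR)

lemma line_coset_hat: "line_coset L p (hat p a b z) = range (\<lambda>k. hat p k b z)"
proof -
  have "hat p (a + k) b z = hat p a b z + hat p k 0 0" for k by (simp add: hat_plus)
  then have "line_coset L p (hat p a b z) = range (\<lambda>k. hat p (a + k) b z)"
    unfolding line_coset_def span_L by auto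
  also have "\<dots> = range (\<lambda>k. hat p k b z)"
  proof (intro equalityI image_subsetI)
    show "hat p (a + k) b z \<in> range (\<lambda>k. hat p k b z)" for k by blast
    show "hat p k b z \<in> range (\<lambda>k. hat p (a + k) b z)" for k
      by (rule image_eqI[of _ _ "k - a"]) auto
  qed
  finally show ?thesis .
qed

lemma line_coset_eq_iff:
  assumes "z \<in> TM p" "z' \<in> TM p"
  shows "line_coset L p (hat p a b z) = line_coset L p (hat p a' b' z') \<longleftrightarrow> b = b' \<and> z = z'"
proof
  assume "line_coset L p (hat p a b z) = line_coset L p (hat p a' b' z')"
  then have "hat p a b z \<in> range (\<lambda>k. hat p k b' z')" unfolding line_coset_hat by blast
  then obtain k where "hat p a b z = hat p k b' z'" by blast
  from hat_inj[OF assms this] show "b = b' \<and> z = z'" by blast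
qed (simp add: line_coset_hat)

lemma line_section_hat:
  assumes U: "open_in A U" "p \<in> U" and \<sigma>: "line_section A B L U \<sigma>"
  obtains f where "smooth_at A p f" "\<forall>\<^sub>F q in nhds p. \<sigma> q = hat q (f q) 0 0"
proof -
  have s: "section_near A B p \<sigma>" using U \<sigma> by (auto simp: section_near_def line_section_def)
  obtain a b Z where h: "smooth_at A p a" "smooth_at A p b" "vfield p Z"
    "\<forall>\<^sub>F q in nhds p. \<sigma> q = hat q (a q) (b q) (Z q)"
    using section_hat[OF s] .
  have "\<forall>\<^sub>F q in nhds p. q \<in> U" using U by (auto simp: open_in_def eventually_nhds)
  with h(4) vfield_tangent[OF h(3)] have "\<forall>\<^sub>F q in nhds p. \<sigma> q = hat q (a q) 0 0"
  proof eventually_elim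
    case (elim q)
    have "\<sigma> q \<in> span (L q)" using \<sigma> elim(3) unfolding line_section_def by blast
    then obtain k where k: "\<sigma> q = hat q k 0 0" by (auto simp: span_L)
    then show ?case
      using hat_inj[OF elim(2) zero_in[OF tangent_carrier[OF elim(2)]], of "a q" "b q" k 0] elim(1) by simp
  qed
  then show ?thesis using that h(1) by blast
qed

text \<open>A section of the line is a function f in this frame. The derivative of f stays inside
  the line, so modulo the line v is sent to f(p) v. Bijectivity of beta, the metric f^2 g and the
  identification of the Weyl endomorphism all rest on this.\<close>

lemma Du_line:
  assumes v: "v \<in> TM p" and U: "open_in A U" "p \<in> U" and \<sigma>: "line_section A B L U \<sigma>"
    and f: "smooth_at A p f" and e: "\<forall>\<^sub>F q in nhds p. \<sigma> q = hat q (f q) 0 0"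
  shows "Du p v \<sigma> = hat p (v f) 0 (f p *\<^sub>R v)"
proof -
  have p: "p \<in> carrier A" using tangent_carrier[OF v] .
  have s: "section_near A B p \<sigma>" using U \<sigma> by (auto simp: section_near_def line_section_def)
  note c = smooth_at_const[OF p, of 0] and vz = vfield_zero[OF p]
  have "Du p v \<sigma> = Du p v (\<lambda>q. hat q (f q) 0 0)"
    by (rule connection_cong[OF Du_conn s v hat_section[OF f c vz] e])
  moreover have "D p v (\<lambda>q. 0) = 0" using D_cscaleR[OF vz v, of 0] by simp
  moreover have "g p w 0 = 0" if "w \<in> TM p" for w
    using g_scaleR[OF that zero_in[OF p], of 0] by simp
  ultimately show ?thesis
    using Du_hat[OF v f c vz] by (simp add: v S_in tangent_const[OF v])
qed

lemma smooth_section_BI: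
  assumes U: "open_in A U" and s: "\<And>p. p \<in> U \<Longrightarrow> section_near A B p s"
  shows "smooth_section A B U s"
  unfolding smooth_section_B_iff[OF U]
proof (intro conjI ballI, goal_cases)
  case (1 q)
  then show ?case using section_near_fib[OF s[OF 1]] by simp
next
  case (2 c)
  obtain V \<phi> where c: "c = (V, \<phi>)" by (cases c)
  have "smooth_at A q (\<lambda>q. \<Sum>\<beta>\<in>Basis. s q (\<lambda>z. chart_map \<phi> z \<bullet> \<beta>) *\<^sub>R \<beta>)" if q: "q \<in> U \<inter> V" for q
  proof -
    obtain W where W: "open_in A W" "q \<in> W" "smooth_section A B W s"
      using s[of q] q by (auto simp: section_near_def)
    have "\<forall>(V, \<phi>)\<in>A. \<forall>q\<in>W \<inter> V. smooth_at A q (\<lambda>q. \<Sum>\<beta>\<in>Basis. s q (\<lambda>z. chart_map \<phi> z \<bullet> \<beta>) *\<^sub>R \<beta>)"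
      using W(3) unfolding smooth_section_B_iff[OF W(1)] by (rule conjunct2)
    from bspec[OF this 2] show ?thesis using W(2) q by (simp add: c)
  qed
  then show ?case by (simp add: c)
qed

lemma hat_line_section:
  assumes U: "open_in A U" and f: "\<And>p. p \<in> U \<Longrightarrow> smooth_at A p f"
  shows "line_section A B L U (\<lambda>q. hat q (f q) 0 0)"
proof -
  have "section_near A B p (\<lambda>q. hat q (f q) 0 0)" if "p \<in> U" for p
  proof -
    have p: "p \<in> carrier A" using that U by (auto simp: open_in_def)
    show ?thesis by (rule hat_section[OF f[OF that] smooth_at_const[OF p] vfield_zero[OF p]])
  qed
  then show ?thesis
    unfolding line_section_def span_L using smooth_section_BI[OF U] by blast
qed

lemma carrier_open_in: "open_in A (carrier A)"
  by (simp add: open_in_def open_carrier)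

lemma line_perp_hat:
  assumes p: "p \<in> carrier A"
  shows "line_perp B L h p = {hat p a 0 z |a z. z \<in> TM p}"
proof (intro equalityI subsetI)
  fix x assume x: "x \<in> line_perp B L h p"
  then have "x \<in> tangent_space N (Psi u p)" by (simp add: line_perp_def)
  then obtain a b z where z: "z \<in> TM p" "x = hat p a b z" by (rule hat_surj)
  have "h p x (hat p 1 0 0) = 0" using x by (simp add: line_perp_def span_L)
  then have "b = 0"
    using h_hat[OF z(1) zero_in[OF p], of a b 1 0] g_scaleR[OF z(1) zero_in[OF p], of 0] z(2) by simp
  then show "x \<in> {hat p a 0 z |a z. z \<in> TM p}" using z by blast
next
  fix x assume "x \<in> {hat p a 0 z |a z. z \<in> TM p}"
  then obtain a z where z: "z \<in> TM p" "x = hat p a 0 z" by blast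
  have "h p x (hat p k 0 0) = 0" for k
    using h_hat[OF z(1) zero_in[OF p], of a 0 k 0] g_scaleR[OF z(1) zero_in[OF p], of 0] z(2) by simp
  then show "x \<in> line_perp B L h p" using z hat_in by (auto simp: line_perp_def span_L)
qed

text \<open>By \<open>Du_line\<close> the coset depends on the section only through its coefficient
  at p, so the union in \<open>tractor_beta\<close> runs over a single coset. A section with
  constant coefficient shows that there is one.\<close>

lemma tractor_beta_hat:
  assumes v: "v \<in> TM p"
  shows "tractor_beta A B L Du p v (hat p k 0 0) = line_coset L p (hat p 0 0 (k *\<^sub>R v))"
proof -
  have p: "p \<in> carrier A" using tangent_carrier[OF v] .
  have 1: "line_coset L p (Du p v \<sigma>) = line_coset L p (hat p 0 0 (k *\<^sub>R v))"
    if U: "open_in A U" "p \<in> U" and \<sigma>: "line_section A B L U \<sigma>" "\<sigma> p = hat p k 0 0" for U \<sigma>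
  proof -
    obtain f where f: "smooth_at A p f" "\<forall>\<^sub>F q in nhds p. \<sigma> q = hat q (f q) 0 0"
      using line_section_hat[OF U \<sigma>(1)] .
    have "hat p (f p) 0 0 = hat p k 0 0" using eventually_nhds_x_imp_x[OF f(2)] \<sigma>(2) by simp
    then have "f p = k" using hat_inj(1)[OF zero_in[OF p] zero_in[OF p]] by blast
    then show ?thesis
      using Du_line[OF v U \<sigma>(1) f] line_coset_eq_iff[OF scale_in[OF v] scale_in[OF v]] by simp
  qed
  have "line_section A B L (carrier A) (\<lambda>q. hat q k 0 0)"
    by (rule hat_line_section[OF carrier_open_in smooth_at_const])
  then have 2: "line_coset L p (Du p v (\<lambda>q. hat q k 0 0)) \<in> {line_coset L p (Du p v \<sigma>) |\<sigma> U.
      open_in A U \<and> p \<in> U \<and> line_section A B L U \<sigma> \<and> \<sigma> p = hat p k 0 0}"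
    using carrier_open_in p by blast
  have "{line_coset L p (Du p v \<sigma>) |\<sigma> U. open_in A U \<and> p \<in> U \<and> line_section A B L U \<sigma> \<and> \<sigma> p = hat p k 0 0}
      = {line_coset L p (hat p 0 0 (k *\<^sub>R v))}" (is "?S = _")
  proof -
    have "?S \<subseteq> {line_coset L p (hat p 0 0 (k *\<^sub>R v))}" using 1 by blast
    then show ?thesis using 2 by blast
  qed
  then show ?thesis unfolding tractor_beta_def by simp
qed

lemma tractor_beta_empty: "y \<notin> span (L p) \<Longrightarrow> tractor_beta A B L Du p v y = {}"
proof -
  assume y: "y \<notin> span (L p)"
  have "{line_coset L p (Du p v \<sigma>) |\<sigma> U. open_in A U \<and> p \<in> U \<and> line_section A B L U \<sigma> \<and> \<sigma> p = y} = {}"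
    using y unfolding line_section_def by blast
  then show ?thesis unfolding tractor_beta_def by (simp only: Union_empty)
qed

text \<open>The line is spanned by \<open>hat p 1 0 0\<close>, so a homomorphism on it is determined
  by the coset of its value there. The horizontal part of that value is the tangent vector
  sought.\<close>

lemma bij_tractor_beta:
  assumes p: "p \<in> carrier A"
  shows "bij_betw (tractor_beta A B L Du p) (TM p) (line_quotient_hom B L h p)"
  unfolding bij_betw_def
proof (intro conjI equalityI subsetI inj_onI)
  fix v w assume v: "v \<in> TM p" and w: "w \<in> TM p"
    and eq: "tractor_beta A B L Du p v = tractor_beta A B L Du p w"
  have "line_coset L p (hat p 0 0 (1 *\<^sub>R v)) = line_coset L p (hat p 0 0 (1 *\<^sub>R w))"
    using tractor_beta_hat[OF v, of 1] tractor_beta_hat[OF w, of 1] eq by simp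
  then show "v = w" using line_coset_eq_iff[OF v w] by simp
next
  \<comment> \<open>The coordinate on the line with respect to \<open>hat p 1 0 0\<close>; it turns
    v into the linear lift required by \<open>line_quotient_hom\<close>.\<close>
  define k where "k y = (THE a. y = hat p a 0 0)" for y
  have k: "k (hat p a 0 0) = a" for a
    unfolding k_def using hat_inj(1)[OF zero_in[OF p] zero_in[OF p]] by blast
  fix F assume "F \<in> tractor_beta A B L Du p ` TM p"
  then obtain v where v: "v \<in> TM p" and F: "F = tractor_beta A B L Du p v" by blast
  have F1: "F = (\<lambda>y. if y \<in> span (L p) then line_coset L p (hat p 0 0 (k y *\<^sub>R v)) else {})"
  proof
    fix y
    show "F y = (if y \<in> span (L p) then line_coset L p (hat p 0 0 (k y *\<^sub>R v)) else {})"
    proof (cases "y \<in> span (L p)")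
      case True
      then obtain a where "y = hat p a 0 0" by (auto simp: span_L)
      then show ?thesis using True by (simp add: F k tractor_beta_hat[OF v])
    qed (simp add: F tractor_beta_empty)
  qed
  have F2: "lin_on (span (L p)) (\<lambda>y. hat p 0 0 (k y *\<^sub>R v))"
    by (auto simp: lin_on_def span_L hat_plus hat_scaleR k scaleR_add_left)
  have F3: "(\<lambda>y. hat p 0 0 (k y *\<^sub>R v)) ` span (L p) \<subseteq> line_perp B L h p"
    unfolding line_perp_hat[OF p] using scale_in[OF v] by blast
  show "F \<in> line_quotient_hom B L h p"
    unfolding line_quotient_hom_def mem_Collect_eq
    by (rule exI[of _ "\<lambda>y. hat p 0 0 (k y *\<^sub>R v)"]) (intro conjI F1 F2 F3)
next
  fix F assume "F \<in> line_quotient_hom B L h p"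
  then obtain F0 where F: "F = (\<lambda>y. if y \<in> span (L p) then line_coset L p (F0 y) else {})"
    and lin: "lin_on (span (L p)) F0" and im: "F0 ` span (L p) \<subseteq> line_perp B L h p"
    unfolding line_quotient_hom_def by blast
  have 1: "hat p 1 0 0 \<in> span (L p)" by (simp add: span_L)
  then obtain a v where v: "v \<in> TM p" "F0 (hat p 1 0 0) = hat p a 0 v"
    using im unfolding line_perp_hat[OF p] by blast
  have "F = tractor_beta A B L Du p v"
  proof
    fix y
    show "F y = tractor_beta A B L Du p v y"
    proof (cases "y \<in> span (L p)")
      case True
      then obtain k where y: "y = hat p k 0 0" by (auto simp: span_L)
      have "F0 (k *\<^sub>R hat p 1 0 0) = k *\<^sub>R F0 (hat p 1 0 0)"
        by (rule lin_on_scaleR[OF lin 1])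
      then have "F0 y = hat p (k * a) 0 (k *\<^sub>R v)" by (simp add: y v(2) hat_scaleR)
      then show ?thesis
        using True line_coset_eq_iff[OF scale_in[OF v(1)] scale_in[OF v(1)]]
        by (simp add: F y tractor_beta_hat[OF v(1)])
    qed (simp add: F tractor_beta_empty)
  qed
  then show "F \<in> tractor_beta A B L Du p ` TM p" using v(1) by blast
qed

text \<open>On triples the metric is a b' + b a' + g(Z, Z'), so the product rule and metric
  compatibility of D give the derivative. The terms with v and S v that \<open>Du_hat\<close> adds
  cancel in pairs between the two sections.\<close>

lemma metric_connection_B: "metric_connection A B h Du"
  unfolding metric_connection_def
proof (intro conjI ballI allI impI Du_conn)
  fix p v s s' assume p: "p \<in> carrier A" and v: "v \<in> TM p"
    and "section_near A B p s \<and> section_near A B p s'"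
  then have s: "section_near A B p s" and s': "section_near A B p s'" by auto
  obtain a b Z where h: "smooth_at A p a" "smooth_at A p b" "vfield p Z"
    and e: "\<forall>\<^sub>F q in nhds p. s q = hat q (a q) (b q) (Z q)"
    using section_hat[OF s] .
  obtain a' b' Z' where h': "smooth_at A p a'" "smooth_at A p b'" "vfield p Z'"
    and e': "\<forall>\<^sub>F q in nhds p. s' q = hat q (a' q) (b' q) (Z' q)"
    using section_hat[OF s'] .
  note T = vfield_in[OF h(3)] vfield_in[OF h'(3)]
  have D: "Du p v s = hat p (v a - g p (S p v) (Z p)) (v b - g p v (Z p)) (D p v Z + (a p *\<^sub>R v + b p *\<^sub>R S p v))"
    using connection_cong[OF Du_conn s v hat_section[OF h] e] Du_hat[OF v h] by simp
  have D': "Du p v s' = hat p (v a' - g p (S p v) (Z' p)) (v b' - g p v (Z' p)) (D p v Z' + (a' p *\<^sub>R v + b' p *\<^sub>R S p v))"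
    using connection_cong[OF Du_conn s' v hat_section[OF h'] e'] Du_hat[OF v h'] by simp
  have "\<forall>\<^sub>F q in nhds p. h q (s q) (s' q) = (a q * b' q + b q * a' q) + g q (Z q) (Z' q)"
    using e e' vfield_tangent[OF h(3)] vfield_tangent[OF h'(3)]
    by eventually_elim (simp add: h_hat)
  then have "v (\<lambda>q. h q (s q) (s' q)) = v (\<lambda>q. (a q * b' q + b q * a' q) + g q (Z q) (Z' q))"
    by (rule tangent_cong[OF v])
  also have "\<dots> = (a p * v b' + v a * b' p + (b p * v a' + v b * a' p)) + (g p (D p v Z) (Z' p) + g p (Z p) (D p v Z'))"
    by (simp only: tangent_add[OF v smooth_at_add[OF smooth_at_mult[OF h(1) h'(2)] smooth_at_mult[OF h(2) h'(1)]] g_smooth[OF h(3) h'(3)]]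
      tangent_add[OF v smooth_at_mult[OF h(1) h'(2)] smooth_at_mult[OF h(2) h'(1)]]
      tangent_mult[OF v h(1) h'(2)] tangent_mult[OF v h(2) h'(1)] metric_derivative[OF v h(3) h'(3)])
  also have "\<dots> = h p (Du p v s) (s' p) + h p (s p) (Du p v s')"
    unfolding D D' eventually_nhds_x_imp_x[OF e] eventually_nhds_x_imp_x[OF e']
    by (simp add: h_hat g_add g_add2 g_scaleR g_scaleR2 T v D_in h h' S_in add_in scale_in
        g_sym[OF T(1) v] g_sym[OF T(1) S_in[OF v]] algebra_simps)
  finally show "v (\<lambda>q. h q (s q) (s' q)) = h p (Du p v s) (s' p) + h p (s p) (Du p v s')" .
qed

section \<open>The axioms of a standard conformal tractor bundle\<close>

lemma vector_bundle_B: "vector_bundle A B"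
proof -
  let ?\<Theta> = "\<lambda>(\<phi> :: 'm \<Rightarrow> 'e) X. \<Sum>\<beta>\<in>Basis. X (\<lambda>q. chart_map \<phi> q \<bullet> \<beta>) *\<^sub>R (\<beta> :: real \<times> real \<times> 'e)"
  have P: "Psi u p \<in> chart_dom U" if "(U, \<phi>) \<in> A" "p \<in> U" for U \<phi> p
    using that \<delta> by (auto simp: Psi_def chart_dom_def)
  have sm: "smooth_fun A (U \<inter> V) (\<lambda>p. ?\<Theta> \<psi> (inv_into (fib B p) (?\<Theta> \<phi>) y))"
    if c: "(U, \<phi>) \<in> A" and d: "(V, \<psi>) \<in> A" for U \<phi> V \<psi> and y :: "real \<times> real \<times> 'e"
  proof -
    obtain y1 y2 y3 where y: "y = (y1, y2, y3)" by (cases y) auto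
    \<comment> \<open>A change of charts fixes the two real components and acts on the third as in
      the tangent bundle.\<close>
    have e: "?\<Theta> \<psi> (inv_into (fib B p) (?\<Theta> \<phi>) y) =
        (y1, y2, \<Sum>\<beta>\<in>Basis. chart_tvec A U \<phi> p y3 (\<lambda>y. \<psi> y \<bullet> \<beta>) *\<^sub>R \<beta>)" if p: "p \<in> U" "p \<in> V" for p
    proof -
      have pA: "p \<in> carrier A" using chart_subset_carrier[OF c] p by blast
      have "inv_into (fib B p) (?\<Theta> \<phi>) y = chart_tvec N (chart_dom U) (chart_map \<phi>) (Psi u p) (y1, y2, y3)"
        using N.inv_triv[OF chart_N[OF c] P[OF c p(1)]] by (simp add: y)
      also have "\<dots> = amb A \<delta> (exp (u p), 0, p) y1 y2 (chart_tvec A U \<phi> p y3)"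
        using amb_chart[OF c p(1), of "exp (u p)" 0 y1 y2 y3] \<delta> by (simp add: Psi_def)
      finally show ?thesis
        using triv_amb[OF chart_tvec_in[OF c p(1)] Psi_carrier[OF pA, unfolded Psi_def] d p(2)] by simp
    qed
    have o: "open (U \<inter> V)" using chart_open[OF c] chart_open[OF d] by blast
    show ?thesis
      unfolding smooth_fun_iff[OF o]
    proof
      fix p assume p: "p \<in> U \<inter> V \<inter> carrier A"
      show "smooth_at A p (\<lambda>p. ?\<Theta> \<psi> (inv_into (fib B p) (?\<Theta> \<phi>) y))"
      proof (rule smooth_at_cong)
        show "smooth_at A p (\<lambda>p. (y1, y2, \<Sum>\<beta>\<in>Basis. chart_tvec A U \<phi> p y3 (\<lambda>y. \<psi> y \<bullet> \<beta>) *\<^sub>R \<beta>))"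
          using p by (intro smooth_at_Pair smooth_at_const smooth_at_components vfield_apply[OF vfield_coord[OF c]]
              smooth_at_coord[OF d]) auto
        have "\<forall>\<^sub>F q in nhds p. q \<in> U \<inter> V" using o p by (auto simp: eventually_nhds)
        then show "\<forall>\<^sub>F p in nhds p. (y1, y2, \<Sum>\<beta>\<in>Basis. chart_tvec A U \<phi> p y3 (\<lambda>y. \<psi> y \<bullet> \<beta>) *\<^sub>R \<beta>) =
            ?\<Theta> \<psi> (inv_into (fib B p) (?\<Theta> \<phi>) y)"
          by eventually_elim (rule e[symmetric], auto)
      qed
    qed
  qed
  show ?thesis
    unfolding vector_bundle_def
  proof (intro conjI)
    show "\<forall>p\<in>carrier A. subspace (fib B p)"
      using N.subspace_tangent_space[OF Psi_carrier] by simp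
    show "(\<Union>(U, \<Theta>)\<in>trivs B. U) = carrier A"
      by (auto simp: trivs_B carrier_def)
    show "\<forall>(U, \<Theta>)\<in>trivs B. open U \<and> (\<forall>p\<in>U. lin_on (fib B p) (\<Theta> p) \<and> bij_betw (\<Theta> p) (fib B p) UNIV)"
      unfolding trivs_B
    proof clarsimp
      fix U \<phi> assume c: "(U, \<phi>) \<in> A"
      have "bij_betw (?\<Theta> \<phi>) (tangent_space N (Psi u p)) UNIV" if "p \<in> U" for p
        by (rule N.bij_betw_triv[OF chart_N[OF c] P[OF c that]])
      then show "open U \<and> (\<forall>p\<in>U. lin_on (tangent_space N (Psi u p)) (?\<Theta> \<phi>) \<and> bij_betw (?\<Theta> \<phi>) (tangent_space N (Psi u p)) UNIV)"
        by (intro conjI ballI chart_open[OF c] lin_on_triv)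
    qed
    show "\<forall>(U, \<Theta>)\<in>trivs B. \<forall>(V, \<Theta>')\<in>trivs B. \<forall>y. smooth_fun A (U \<inter> V) (\<lambda>p. \<Theta>' p (inv_into (fib B p) (\<Theta> p) y))"
      unfolding trivs_B using sm by (simp add: case_prod_beta')
  qed
qed

lemma lorentzian_B: "lorentzian_bundle_metric A B h"
  unfolding lorentzian_bundle_metric_def bundle_metric_def
proof (intro conjI ballI allI impI)
  fix p x assume p: "p \<in> carrier A" and x: "x \<in> fib B p"
  have x': "x \<in> tangent_space N (exp (u p), 0, p)" using x by (simp add: Psi_def)
  show "lin_on (fib B p) (h p x)"
    using G_0_sym_lin(2)[OF _ x'] by (simp add: Psi_def)
  show "h p x y = h p y x" if "y \<in> fib B p" for y
    using G_0_sym_lin(1)[OF _ x', of y] that by (simp add: Psi_def)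
  obtain a b z where z: "z \<in> TM p" "x = hat p a b z"
    using x[unfolded fib_B] by (rule hat_surj)
  note 0 = zero_in[OF p]
  assume x0: "\<forall>y\<in>fib B p. h p x y = 0"
  have e: "a * b1 + b * a1 + g p z w = 0" if "w \<in> TM p" for a1 b1 w
    using x0 hat_in[OF that] h_hat[OF z(1) that, of a b a1 b1] z(2) by simp
  have g0: "g p z 0 = 0" using g_scaleR[OF z(1) 0, of 0] by simp
  have "a = 0" "b = 0" using e[OF 0, of 0 1] e[OF 0, of 1 0] g0 by simp_all
  moreover have "z = 0" using e[OF z(1), of 0 0] g_pos[OF z(1)] by fastforce
  ultimately have "x = 0 *\<^sub>R x" by (simp add: z(2) hat_scaleR)
  then show "x = 0" by simp
next
  fix U s s' assume "open_in A U \<and> smooth_section A B U s \<and> smooth_section A B U s'"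
  then have U: "open_in A U" and s: "smooth_section A B U s" and s': "smooth_section A B U s'" by auto
  have o: "open U" using U by (simp add: open_in_def)
  show "smooth_fun A U (\<lambda>p. h p (s p) (s' p))"
    unfolding smooth_fun_iff[OF o]
  proof
    fix p assume p: "p \<in> U \<inter> carrier A"
    then have n: "section_near A B p s" and n': "section_near A B p s'"
      using U s s' by (auto simp: section_near_def)
    obtain a b Z where h: "smooth_at A p a" "smooth_at A p b" "vfield p Z"
      and e: "\<forall>\<^sub>F q in nhds p. s q = hat q (a q) (b q) (Z q)"
      using section_hat[OF n] .
    obtain a' b' Z' where h': "smooth_at A p a'" "smooth_at A p b'" "vfield p Z'"
      and e': "\<forall>\<^sub>F q in nhds p. s' q = hat q (a' q) (b' q) (Z' q)"
      using section_hat[OF n'] .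
    have "\<forall>\<^sub>F q in nhds p. (a q * b' q + b q * a' q) + g q (Z q) (Z' q) = h q (s q) (s' q)"
      using e e' vfield_tangent[OF h(3)] vfield_tangent[OF h'(3)]
      by eventually_elim (simp add: h_hat)
    then show "smooth_at A p (\<lambda>p. h p (s p) (s' p))"
      by (rule smooth_at_cong[OF smooth_at_add[OF smooth_at_add[OF smooth_at_mult[OF h(1) h'(2)] smooth_at_mult[OF h(2) h'(1)]] g_smooth[OF h(3) h'(3)]]])
  qed
next
  fix p assume p: "p \<in> carrier A"
  note 0 = zero_in[OF p]
  have g0: "g p 0 z = 0" if "z \<in> TM p" for z
    using g_scaleR2[OF 0 that, of 0] by simp
  show "\<exists>x\<in>fib B p. h p x x < 0 \<and> (\<forall>y\<in>fib B p. h p x y = 0 \<and> y \<noteq> 0 \<longrightarrow> h p y y > 0)"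
  \<comment> \<open>In the hyperbolic plane this vector has square -2. Its orthogonal complement
    consists of the vectors with b = a, whose squares are 2 a^2 + g(z, z).\<close>
  proof (intro bexI[of _ "hat p 1 (- 1) 0"] conjI ballI impI)
    show "hat p 1 (- 1) 0 \<in> fib B p" using hat_in[OF 0] by simp
    show "h p (hat p 1 (- 1) 0) (hat p 1 (- 1) 0) < 0" by (simp add: h_hat[OF 0 0] g0 0)
    fix y assume y: "y \<in> fib B p" and "h p (hat p 1 (- 1) 0) y = 0 \<and> y \<noteq> 0"
    then have y0: "h p (hat p 1 (- 1) 0) y = 0" "y \<noteq> 0" by auto
    obtain a b z where z: "z \<in> TM p" "y = hat p a b z"
      using y[unfolded fib_B] by (rule hat_surj)
    have ab: "b = a" using y0(1) by (simp add: z(2) h_hat[OF 0 z(1)] g0[OF z(1)])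
    have "a \<noteq> 0 \<or> z \<noteq> 0"
    proof (rule ccontr)
      assume "\<not> (a \<noteq> 0 \<or> z \<noteq> 0)"
      then have "y = 0 *\<^sub>R y" by (simp add: z(2) ab hat_scaleR)
      then show False using y0(2) by simp
    qed
    moreover have "g p z z \<ge> 0" using g_pos[OF z(1)] g0[OF 0] by (cases "z = 0") auto
    ultimately have "a * a + a * a + g p z z > 0"
      using g_pos[OF z(1)] by (cases "a = 0") (auto intro!: add_pos_nonneg simp: zero_less_mult_iff)
    then show "h p y y > 0" by (simp add: z(2) ab h_hat[OF z(1) z(1)])
  qed
qed

text \<open>A section of the line with coefficient f induces the metric f^2 g. The class c is given
  relative to some reference metric \<open>g0\<close>, so g and g' are compared through it.\<close>

lemma standard_B:
  assumes c: "conformal_structure A c"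
  shows "standard_conformal_tractor_bundle A c B L h Du"
  unfolding standard_conformal_tractor_bundle_def conformal_tractor_bundle_def tractor_connection_def
proof (intro conjI vector_bundle_B lorentzian_B metric_connection_B ballI allI impI)
  show "DIM(real \<times> real \<times> 'e) = DIM('e) + 2" by simp
  show "oriented_line_subbundle A B L"
    unfolding oriented_line_subbundle_def
  proof
    fix p assume "p \<in> carrier A"
    have "smooth_section A B (carrier A) \<xi>"
      using hat_line_section[OF carrier_open_in smooth_at_exp[OF u_smooth]]
      unfolding line_section_def xi_hat[abs_def] by blast
    moreover have "\<xi> q \<noteq> 0 \<and> L q = {a *\<^sub>R \<xi> q |a. a > 0}" if q: "q \<in> carrier A" for q
    proof
      note 0 = zero_in[OF q]
      have "hat q 0 0 0 = 0 *\<^sub>R \<xi> q" by (simp add: xi_hat hat_scaleR)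
      then show "\<xi> q \<noteq> 0" using hat_inj(1)[OF 0 0, of "exp (u q)" 0 0 0] by (auto simp: xi_hat)
      show "L q = {a *\<^sub>R \<xi> q |a. a > 0}" by (simp add: ray_def)
    qed
    ultimately show "\<exists>U \<sigma>. open_in A U \<and> p \<in> U \<and> smooth_section A B U \<sigma> \<and>
        (\<forall>q\<in>U. \<sigma> q \<noteq> 0 \<and> L q = {a *\<^sub>R \<sigma> q |a. a > 0})"
      using carrier_open_in \<open>p \<in> carrier A\<close> by (intro exI[of _ "carrier A"] exI[of _ \<xi>]) auto
  qed
  show "h p x x = 0" if p: "p \<in> carrier A" and x: "x \<in> L p" for p x
  proof -
    note 0 = zero_in[OF p]
    obtain a where "x = hat p a 0 0" using L_hat[OF x] by blast
    then show ?thesis using g_scaleR[OF 0 0, of 0] by (simp add: h_hat[OF 0 0])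
  qed
  show "bij_betw (tractor_beta A B L Du p) (TM p) (line_quotient_hom B L h p)"
    if "p \<in> carrier A" for p
    by (rule bij_tractor_beta[OF that])
  fix U \<sigma> g'
  assume "open_in A U \<and> line_section A B L U \<sigma> \<and> (\<forall>p\<in>U. \<sigma> p \<noteq> 0)"
  then have U: "open_in A U" and \<sigma>: "line_section A B L U \<sigma>" and nz: "\<And>p. p \<in> U \<Longrightarrow> \<sigma> p \<noteq> 0" by auto
  assume g': "g' \<in> c"
  have o: "open U" "U \<subseteq> carrier A" using U by (auto simp: open_in_def)
  obtain g0 where "riemannian_metric A g0"
    and c0: "c = {g'. riemannian_metric A g' \<and> conformal_on A (carrier A) g0 g'}"
    using c unfolding conformal_structure_def by blast
  obtain f1 where f1: "smooth_fun A (carrier A) f1"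
    and g1: "\<And>p v w. p \<in> carrier A \<Longrightarrow> v \<in> TM p \<Longrightarrow> w \<in> TM p \<Longrightarrow>
      g p v w = exp (2 * f1 p) * g0 p v w"
    using gc unfolding c0 conformal_on_def by blast
  obtain f2 where f2: "smooth_fun A (carrier A) f2"
    and g2: "\<And>p v w. p \<in> carrier A \<Longrightarrow> v \<in> TM p \<Longrightarrow> w \<in> TM p \<Longrightarrow>
      g' p v w = exp (2 * f2 p) * g0 p v w"
    using g' unfolding c0 conformal_on_def by blast
  have "\<forall>p. \<exists>k. p \<in> U \<longrightarrow> \<sigma> p = hat p k 0 0"
    using \<sigma> by (auto simp: line_section_def span_L)
  then obtain f where f: "\<And>p. p \<in> U \<Longrightarrow> \<sigma> p = hat p (f p) 0 0" by metis
  have evU: "\<forall>\<^sub>F q in nhds p. q \<in> U" if "p \<in> U" for p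
    using that o(1) by (auto simp: eventually_nhds)
  have fs: "smooth_at A p f" if p: "p \<in> U" for p
  proof -
    obtain f' where f': "smooth_at A p f'" "\<forall>\<^sub>F q in nhds p. \<sigma> q = hat q (f' q) 0 0"
      using line_section_hat[OF U p \<sigma>] .
    have "\<forall>\<^sub>F q in nhds p. f' q = f q"
      using f'(2) evU[OF p]
    proof eventually_elim
      case (elim q)
      have 0: "0 \<in> TM q" using zero_in o(2) elim(2) by blast
      show ?case using hat_inj(1)[OF 0 0, of "f' q" 0 "f q" 0] f[OF elim(2)] elim(1) by simp
    qed
    then show ?thesis by (rule smooth_at_cong[OF f'(1)])
  qed
  have fnz: "f p \<noteq> 0" if p: "p \<in> U" for p
  proof
    assume "f p = 0"
    then have "\<sigma> p = 0 *\<^sub>R \<sigma> p" by (simp add: f[OF p] hat_scaleR)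
    then show False using nz[OF p] by simp
  qed
  have s1: "smooth_at A p f1" "smooth_at A p f2" if "p \<in> carrier A" for p
    using f1 f2 smooth_fun_iff[OF open_carrier] that by blast+
  \<comment> \<open>f may be negative, so half of the logarithm of its square is used. The exponents
    \<open>f1\<close> and \<open>f2\<close> of g and g' over \<open>g0\<close> convert f^2 g into a
    multiple of g'.\<close>
  define F where "F p = 1 / 2 * ln (f p * f p) + f1 p - f2 p" for p
  show "conformal_on A U g' (tractor_metric h Du \<sigma>)"
    unfolding conformal_on_def
  proof (intro exI[of _ F] conjI ballI)
    show "smooth_fun A U F"
      unfolding smooth_fun_iff[OF o(1)] F_def[abs_def]
    proof
      fix p assume p: "p \<in> U \<inter> carrier A"
      have "f p * f p > 0" using fnz[of p] p by (auto simp: zero_less_mult_iff)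
      then show "smooth_at A p (\<lambda>p. 1 / 2 * ln (f p * f p) + f1 p - f2 p)"
        using p by (intro smooth_at_diff smooth_at_add smooth_at_cmult smooth_at_ln smooth_at_mult fs s1) auto
    qed
    fix p v w assume p: "p \<in> U" and v: "v \<in> TM p" and w: "w \<in> TM p"
    have pA: "p \<in> carrier A" using o p by blast
    have ev: "\<forall>\<^sub>F q in nhds p. \<sigma> q = hat q (f q) 0 0" using evU[OF p] by eventually_elim (rule f)
    have "tractor_metric h Du \<sigma> p v w = f p * f p * g p v w"
      unfolding tractor_metric_def Du_line[OF v U p \<sigma> fs[OF p] ev] Du_line[OF w U p \<sigma> fs[OF p] ev]
      by (simp add: h_hat scale_in v w g_scaleR g_scaleR2)
    also have "f p * f p = exp (2 * F p) * exp (2 * f2 p) / exp (2 * f1 p)"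
    proof -
      have pos: "f p * f p > 0" using fnz[OF p] by (auto simp: zero_less_mult_iff)
      have "exp (2 * F p) * exp (2 * f2 p) = exp (ln (f p * f p) + 2 * f1 p)"
        unfolding F_def exp_add[symmetric] by (rule arg_cong[where f = exp]) (simp add: algebra_simps)
      then show ?thesis using pos by (simp add: exp_add)
    qed
    finally show "tractor_metric h Du \<sigma> p v w = exp (2 * F p) * g' p v w"
      using g1[OF pA v w] g2[OF pA v w] by simp
  qed
qed

text \<open>For a section of the line with coefficient f both cosets carry the factor f(p), once
  from beta of y and once from beta of z. It is nonzero and cancels, which gives uniqueness and
  independence of the section together.\<close>

lemma tractor_weyl_eq:
  assumes v: "v \<in> TM p" and w: "w \<in> TM p" and z: "z \<in> TM p"
  shows "tractor_weyl A B L Du p v w z = weyl p v w z"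
  unfolding tractor_weyl_def
proof (rule the_equality)
  have p: "p \<in> carrier A" using tangent_carrier[OF v] .
  have main: "line_coset L p (Du p y \<sigma>) = line_coset L p (curvature A B Du p v w (Du p z \<sigma>)) \<longleftrightarrow>
      f p *\<^sub>R y = f p *\<^sub>R weyl p v w z"
    if U: "open_in A U" "p \<in> U" and \<sigma>: "line_section A B L U \<sigma>" and f: "smooth_at A p f"
      and e: "\<forall>\<^sub>F q in nhds p. \<sigma> q = hat q (f q) 0 0" and y: "y \<in> TM p" for U \<sigma> f y
  proof -
    obtain k where k: "curvature A B Du p v w (hat p (z f) 0 (f p *\<^sub>R z)) = hat p k 0 (weyl p v w (f p *\<^sub>R z))"
      using curvature_B_line[OF v w scale_in[OF z]] .
    show ?thesis
      unfolding Du_line[OF y U \<sigma> f e] Du_line[OF z U \<sigma> f e] k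
        line_coset_eq_iff[OF scale_in[OF y] weyl_in[OF v w scale_in[OF z]]]
      by (simp add: weyl_scaleR[OF v w z])
  qed
  let ?\<sigma> = "\<lambda>q. hat q 1 0 0"
  note 0 = zero_in[OF p]
  have l: "line_section A B L (carrier A) ?\<sigma>"
    by (rule hat_line_section[OF carrier_open_in smooth_at_const])
  have "hat p 1 0 0 \<noteq> 0"
  proof
    assume "hat p 1 0 0 = 0"
    then have "hat p 1 0 0 = hat p 0 0 0" using hat_scaleR[of 0 p 1 0 0] by simp
    then show False using hat_inj(1)[OF 0 0] by fastforce
  qed
  moreover have "line_coset L p (Du p (weyl p v w z) ?\<sigma>) = line_coset L p (curvature A B Du p v w (Du p z ?\<sigma>))"
    using main[OF carrier_open_in p l smooth_at_const[OF p, of 1] _ weyl_in[OF v w z]] by simp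
  ultimately show "weyl p v w z \<in> TM p \<and> (\<exists>U \<sigma>. open_in A U \<and> p \<in> U \<and> line_section A B L U \<sigma> \<and>
      \<sigma> p \<noteq> 0 \<and> line_coset L p (Du p (weyl p v w z) \<sigma>) = line_coset L p (curvature A B Du p v w (Du p z \<sigma>)))"
    using carrier_open_in p l weyl_in[OF v w z] by blast
  fix y
  assume "y \<in> TM p \<and> (\<exists>U \<sigma>. open_in A U \<and> p \<in> U \<and> line_section A B L U \<sigma> \<and>
      \<sigma> p \<noteq> 0 \<and> line_coset L p (Du p y \<sigma>) = line_coset L p (curvature A B Du p v w (Du p z \<sigma>)))"
  then obtain U \<sigma> where y: "y \<in> TM p" and U: "open_in A U" "p \<in> U" and \<sigma>: "line_section A B L U \<sigma>"
    "\<sigma> p \<noteq> 0" and eq: "line_coset L p (Du p y \<sigma>) = line_coset L p (curvature A B Du p v w (Du p z \<sigma>))"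
    by blast
  obtain f where f: "smooth_at A p f" "\<forall>\<^sub>F q in nhds p. \<sigma> q = hat q (f q) 0 0"
    using line_section_hat[OF U \<sigma>(1)] .
  have "f p \<noteq> 0"
  proof
    assume "f p = 0"
    then have "\<sigma> p = 0 *\<^sub>R \<sigma> p" using eventually_nhds_x_imp_x[OF f(2)] by (simp add: hat_scaleR)
    then show False using \<sigma>(2) by simp
  qed
  then show "y = weyl p v w z" using main[OF U \<sigma>(1) f y] eq by simp
qed

lemma curvature_line:
  assumes v: "v \<in> TM p" and w: "w \<in> TM p" and x: "x \<in> span (L p)"
  shows "curvature A B Du p v w x \<in> span (L p)"
proof -
  have 0: "0 \<in> TM p" by (rule zero_in[OF tangent_carrier[OF v]])
  obtain a where a: "x = hat p a 0 0" using x by (auto simp: span_L)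
  obtain k where "curvature A B Du p v w (hat p a 0 0) = hat p k 0 (weyl p v w 0)"
    using curvature_B_line[OF v w 0] .
  moreover have "weyl p v w 0 = 0" using weyl_scaleR[OF v w 0, of 0] by simp
  ultimately show ?thesis by (simp add: a span_L)
qed

end

section \<open>Traces and normality\<close>

context manifold begin

text \<open>C is the very basis selected in \<open>trace_on\<close>, the same one for every F, so
  that traces of different endomorphisms can be added and compared.\<close>

lemma trace_basis:
  assumes p: "p \<in> carrier A"
  obtains C where "independent C" "span C = TM p" "finite C" "card C = DIM('e)"
    "\<And>F. trace_on (TM p) F = (\<Sum>b\<in>C. representation C (F b) b)"
proof -
  define C where "C = (SOME C. independent C \<and> span C = TM p)"
  have "\<exists>C. independent C \<and> span C = TM p"
    using basis_exists[of "TM p"] span_minimal[OF _ subspace_tangent_space[OF p]]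
    by (metis subset_antisym)
  then have C: "independent C \<and> span C = TM p"
    unfolding C_def by (rule someI_ex)
  then have C': "independent C" "span C = TM p" by auto
  show ?thesis
    by (rule that[OF C' tangent_basis_card[OF p C']]) (simp add: trace_on_def Let_def C_def)
qed

context
  fixes p assumes p: "p \<in> carrier A"
begin

lemma trace_cong:
  assumes "\<And>v. v \<in> TM p \<Longrightarrow> F v = F' v"
  shows "trace_on (TM p) F = trace_on (TM p) F'"
proof -
  obtain C where C: "independent C" "span C = TM p" "finite C" "card C = DIM('e)"
    and t: "\<And>F. trace_on (TM p) F = (\<Sum>b\<in>C. representation C (F b) b)"
    using trace_basis[OF p] by blast
  have "F b = F' b" if "b \<in> C" for b using assms C(2) span_base[OF that] by blast
  then show ?thesis by (simp add: t)
qed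

lemma trace_add:
  assumes "\<And>v. v \<in> TM p \<Longrightarrow> F v \<in> TM p"
    "\<And>v. v \<in> TM p \<Longrightarrow> F' v \<in> TM p"
  shows "trace_on (TM p) (\<lambda>v. F v + F' v) =
    trace_on (TM p) F + trace_on (TM p) F'"
proof -
  obtain C where C: "independent C" "span C = TM p" "finite C" "card C = DIM('e)"
    and t: "\<And>F. trace_on (TM p) F = (\<Sum>b\<in>C. representation C (F b) b)"
    using trace_basis[OF p] by blast
  have "representation C (F b + F' b) b = representation C (F b) b + representation C (F' b) b" if "b \<in> C" for b
    using representation_add[OF C(1)] assms C(2) span_base[OF that] by auto
  then show ?thesis by (simp add: t sum.distrib)
qed

lemma trace_scaleR:
  assumes "\<And>v. v \<in> TM p \<Longrightarrow> F v \<in> TM p"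
  shows "trace_on (TM p) (\<lambda>v. k *\<^sub>R F v) = k * trace_on (TM p) F"
proof -
  obtain C where C: "independent C" "span C = TM p" "finite C" "card C = DIM('e)"
    and t: "\<And>F. trace_on (TM p) F = (\<Sum>b\<in>C. representation C (F b) b)"
    using trace_basis[OF p] by blast
  have "representation C (k *\<^sub>R F b) b = k * representation C (F b) b" if "b \<in> C" for b
    using representation_scale[OF C(1)] assms C(2) span_base[OF that] by auto
  then show ?thesis by (simp add: t sum_distrib_left)
qed

lemma trace_id: "trace_on (TM p) (\<lambda>v. v) = real DIM('e)"
proof -
  obtain C where C: "independent C" "span C = TM p" "finite C" "card C = DIM('e)"
    and t: "\<And>F. trace_on (TM p) F = (\<Sum>b\<in>C. representation C (F b) b)"
    using trace_basis[OF p] by blast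
  show ?thesis using C(4) by (simp add: t representation_basis[OF C(1)])
qed

text \<open>Expand w in the basis and apply \<alpha>. Of the four correction terms in
  \<open>weyl\<close>, two have rank one in the first argument; the other two are multiples of the
  identity and of S.\<close>

lemma trace_rank_one:
  fixes \<alpha> :: "'m tvec \<Rightarrow> real"
  assumes \<alpha>: "lin_on (TM p) \<alpha>" and w: "w \<in> TM p"
  shows "trace_on (TM p) (\<lambda>v. \<alpha> v *\<^sub>R w) = \<alpha> w"
proof -
  obtain C where C: "independent C" "span C = TM p" "finite C" "card C = DIM('e)"
    and t: "\<And>F. trace_on (TM p) F = (\<Sum>b\<in>C. representation C (F b) b)"
    using trace_basis[OF p] by blast
  have CT: "b \<in> TM p" if "b \<in> C" for b using span_base[OF that] C(2) by simp
  have "\<alpha> w = \<alpha> (\<Sum>b\<in>C. representation C w b *\<^sub>R b)"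
    using sum_representation_eq[OF C(1) _ C(3) order_refl, of w] w C(2) by simp
  also have "\<dots> = (\<Sum>b\<in>C. representation C w b *\<^sub>R \<alpha> b)"
    by (rule lin_on_sum[OF \<alpha> subspace_tangent_space[OF p] CT])
  also have "\<dots> = trace_on (TM p) (\<lambda>v. \<alpha> v *\<^sub>R w)"
    using w C(2) by (simp add: t representation_scale[OF C(1)] mult.commute)
  finally show ?thesis ..
qed

end

end

section \<open>Scalar curvature, and curvature in dimension two\<close>

context riemannian_manifold begin

text \<open>By nondegeneracy of g, the vector described in \<open>scalar_curvature\<close> is Q v
  for any endomorphism Q that represents the Ricci form.\<close>

lemma scalar_curvature_eq:
  assumes p: "p \<in> carrier A"
    and Q: "\<And>v. v \<in> TM p \<Longrightarrow> Q v \<in> TM p"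
    and ric: "\<And>v z. v \<in> TM p \<Longrightarrow> z \<in> TM p \<Longrightarrow> ricci A D p v z = g p (Q v) z"
  shows "scalar_curvature A g D p = trace_on (TM p) Q"
  unfolding scalar_curvature_def
proof (rule trace_cong[OF p])
  fix v assume v: "v \<in> TM p"
  show "(THE w. w \<in> TM p \<and> (\<forall>z\<in>TM p. g p w z = ricci A D p v z)) = Q v"
  proof (rule the_equality)
    show "Q v \<in> TM p \<and> (\<forall>z\<in>TM p. g p (Q v) z = ricci A D p v z)"
      using Q[OF v] ric[OF v] by simp
    show "w = Q v" if w: "w \<in> TM p \<and> (\<forall>z\<in>TM p. g p w z = ricci A D p v z)" for w
      by (rule g_nondeg) (use w Q[OF v] ric[OF v] in auto)
  qed
qed

lemma g_lin2:
  assumes z: "z \<in> TM p" shows "lin_on (TM p) (\<lambda>v. g p v z)"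
  using z by (simp add: lin_on_def g_add2 g_scaleR2)

lemma dim_2_basis:
  assumes n: "DIM('e) = 2" and p: "p \<in> carrier A"
  obtains e1 e2 where "e1 \<in> TM p" "e2 \<in> TM p"
    "\<And>v. v \<in> TM p \<Longrightarrow> \<exists>a b. v = a *\<^sub>R e1 + b *\<^sub>R e2"
    "g p e1 e1 * g p e2 e2 - g p e1 e2 * g p e1 e2 > 0"
proof -
  note T = subspace_tangent_space[OF p]
  obtain C where C: "independent C" "span C = TM p" "finite C" "card C = DIM('e)"
    by (rule trace_basis[OF p], rule that)
  then have "card C = 2" using n by simp
  then obtain e1 e2 where e: "C = {e1, e2}" "e1 \<noteq> e2" unfolding card_2_iff by blast
  have e1: "e1 \<in> TM p" and e2: "e2 \<in> TM p"
    using span_base[of _ C] C(2) e(1) by auto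
  have "independent (insert e2 {e1})" using C(1) e(1) by (simp add: insert_commute)
  then have ns: "e2 \<notin> span {e1}" and ind: "independent {e1}"
    using e(2) by (auto simp: independent_insert split: if_splits)
  have "e1 \<noteq> 0" using ind dependent_zero[of "{e1}"] by auto
  then have p11: "g p e1 e1 > 0" by (rule g_pos[OF e1])
  \<comment> \<open>Gram-Schmidt: f is the part of e2 orthogonal to e1, and g(e1, e1) g(f, f) is the
    Gram determinant.\<close>
  define k where "k = g p e1 e2 / g p e1 e1"
  define f where "f = e2 - k *\<^sub>R e1"
  have f: "f \<in> TM p"
    unfolding f_def by (rule subspace_diff[OF T e2 subspace_scale[OF T e1]])
  have "k *\<^sub>R e1 \<in> span {e1}" by (intro span_scale span_base) simp
  then have "f \<noteq> 0" using ns by (auto simp: f_def)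
  then have "g p f f > 0" by (rule g_pos[OF f])
  moreover have "g p f f = g p e2 e2 - k * g p e1 e2 - k * (g p e1 e2 - k * g p e1 e1)"
    unfolding f_def
    by (simp add: g_diff g_diff2 g_scaleR g_scaleR2 e1 e2 subspace_scale[OF T e1] subspace_diff[OF T]
        g_sym[OF e2 e1] algebra_simps)
  moreover have "k * g p e1 e1 = g p e1 e2" using p11 by (simp add: k_def)
  ultimately have "g p e2 e2 - k * g p e1 e2 > 0" by simp
  then have "g p e1 e1 * (g p e2 e2 - k * g p e1 e2) > 0" using p11 by simp
  then have "g p e1 e1 * g p e2 e2 - g p e1 e2 * g p e1 e2 > 0"
    using p11 by (simp add: k_def right_diff_distrib)
  moreover have "\<exists>a b. v = a *\<^sub>R e1 + b *\<^sub>R e2" if "v \<in> TM p" for v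
  proof -
    have "v \<in> span (insert e1 {e2})" using that C(2) e(1) by simp
    then obtain a where "v - a *\<^sub>R e1 \<in> span {e2}" by (rule span_breakdown_eq[THEN iffD1, THEN exE])
    then obtain b where "v - a *\<^sub>R e1 = b *\<^sub>R e2" by (auto simp: span_singleton)
    then have "v = a *\<^sub>R e1 + b *\<^sub>R e2" by (simp add: algebra_simps)
    then show ?thesis by blast
  qed
  ultimately show ?thesis using that e1 e2 by blast
qed

text \<open>The curvature as a form in four arguments is skew in the first pair and in the last
  pair. In dimension two such a form is determined by one number, so it is a multiple of the
  corresponding expression in g. This also shows that the description in
  \<open>gauss_curvature\<close> has a unique solution.\<close>

lemma curvature_dim_2:
  assumes n: "DIM('e) = 2"
    and v: "v \<in> TM p" and w: "w \<in> TM p" and x: "x \<in> TM p"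
  shows "Rm p v w x = gauss_curvature A g D p *\<^sub>R (g p w x *\<^sub>R v - g p v x *\<^sub>R w)"
proof -
  have p: "p \<in> carrier A" using tangent_carrier[OF v] .
  note T = subspace_tangent_space[OF p]
  obtain e1 e2 where e1: "e1 \<in> TM p" and e2: "e2 \<in> TM p"
    and ex: "\<And>v. v \<in> TM p \<Longrightarrow> \<exists>a b. v = a *\<^sub>R e1 + b *\<^sub>R e2"
    and pos: "g p e1 e1 * g p e2 e2 - g p e1 e2 * g p e1 e2 > 0"
    using dim_2_basis[OF n p] by blast
  define \<Delta> where "\<Delta> = g p e1 e1 * g p e2 e2 - g p e1 e2 * g p e1 e2"
  define t where "t v w x y = g p (Rm p v w x) y" for v w x y
  define K where "K = t e1 e2 e2 e1 / \<Delta>"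
  have swap: "t w v x y = - t v w x y"
    if "v \<in> TM p" "w \<in> TM p" "x \<in> TM p" "y \<in> TM p" for v w x y
    using Rm_swap[OF that(1-3)] g_minus2[OF Rm_in[OF that(1-3)] that(4)] by (simp add: t_def)
  have skew: "t v w y x = - t v w x y"
    if "v \<in> TM p" "w \<in> TM p" "x \<in> TM p" "y \<in> TM p" for v w x y
    using Rm_skew[OF that(1,2,4,3)] by (simp add: t_def)
  have l1: "t (a *\<^sub>R e1 + b *\<^sub>R e2) w x y = a * t e1 w x y + b * t e2 w x y"
    if "w \<in> TM p" "x \<in> TM p" "y \<in> TM p" for a b w x y
    using that lin_on_add[OF Rm_lin_on(1)[OF that(1,2)] subspace_scale[OF T e1] subspace_scale[OF T e2], of a b]
      lin_on_scaleR[OF Rm_lin_on(1)[OF that(1,2)]]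
    by (simp add: t_def g_add2 g_scaleR2 Rm_in e1 e2 subspace_scale[OF T])
  have m: "a *\<^sub>R e1 + b *\<^sub>R e2 \<in> TM p" for a b
    by (intro subspace_add subspace_scale T e1 e2)
  have l2: "t v (a *\<^sub>R e1 + b *\<^sub>R e2) x y = a * t v e1 x y + b * t v e2 x y"
    if "v \<in> TM p" "x \<in> TM p" "y \<in> TM p" for a b v x y
    using l1[OF that, of a b] swap[OF m that, of a b] swap[OF e1 that] swap[OF e2 that] by simp
  have l4: "t v w x (a *\<^sub>R e1 + b *\<^sub>R e2) = a * t v w x e1 + b * t v w x e2"
    if "v \<in> TM p" "w \<in> TM p" "x \<in> TM p" for a b v w x
    using that by (simp add: t_def g_add g_scaleR Rm_in e1 e2 subspace_scale[OF T])
  have l3: "t v w (a *\<^sub>R e1 + b *\<^sub>R e2) y = a * t v w e1 y + b * t v w e2 y"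
    if "v \<in> TM p" "w \<in> TM p" "y \<in> TM p" for a b v w y
    using l4[OF that, of a b] skew[OF that(1,2) m that(3), of a b] skew[OF that(1,2) e1 that(3)]
      skew[OF that(1,2) e2 that(3)] by simp
  have eq: "t v w x y = K * (g p w x * g p v y - g p v x * g p w y)"
    if vwxy: "v \<in> TM p" "w \<in> TM p" "x \<in> TM p" "y \<in> TM p" for v w x y
  proof -
    obtain v1 v2 w1 w2 x1 x2 y1 y2 where e: "v = v1 *\<^sub>R e1 + v2 *\<^sub>R e2" "w = w1 *\<^sub>R e1 + w2 *\<^sub>R e2"
      "x = x1 *\<^sub>R e1 + x2 *\<^sub>R e2" "y = y1 *\<^sub>R e1 + y2 *\<^sub>R e2"
      using ex vwxy by metis
    have z: "t e1 e1 x y = 0" "t e2 e2 x y = 0" "t e2 e1 x y = - t e1 e2 x y"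
      if "x \<in> TM p" "y \<in> TM p" for x y
      using swap[OF e1 e1 that] swap[OF e2 e2 that] swap[OF e1 e2 that] by simp_all
    have z': "t e1 e2 e1 e1 = 0" "t e1 e2 e2 e2 = 0"
      using skew[OF e1 e2 e1 e1] skew[OF e1 e2 e2 e2] by simp_all
    have "t v w x y = (v1 * w2 - v2 * w1) * (x2 * y1 - x1 * y2) * t e1 e2 e2 e1"
      unfolding e
      by (simp add: l1 l2 l3 l4 m e1 e2 z z' skew[OF e1 e2 e2 e1]) (simp add: algebra_simps)
    also have "t e1 e2 e2 e1 = K * \<Delta>" using pos by (simp add: K_def \<Delta>_def)
    \<comment> \<open>The product of the two coefficient determinants with the Gram determinant
      \<Delta> is the determinant of the pairings of v, w with x, y.\<close>
    also have "(v1 * w2 - v2 * w1) * (x2 * y1 - x1 * y2) * (K * \<Delta>) = K * (g p w x * g p v y - g p v x * g p w y)"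
      unfolding e \<Delta>_def
      by (simp add: g_add g_add2 g_scaleR g_scaleR2 e1 e2 subspace_scale[OF T] subspace_add[OF T] g_sym[OF e2 e1])
        (simp add: algebra_simps)
    finally show ?thesis .
  qed
  have "gauss_curvature A g D p = K"
    unfolding gauss_curvature_def
  proof (rule the_equality)
    show "\<forall>v\<in>TM p. \<forall>w\<in>TM p.
        g p (Rm p v w w) v = K * (g p v v * g p w w - (g p v w)\<^sup>2)"
    proof (intro ballI)
      fix v w assume v: "v \<in> TM p" and w: "w \<in> TM p"
      show "g p (Rm p v w w) v = K * (g p v v * g p w w - (g p v w)\<^sup>2)"
        using eq[OF v w w v] by (simp add: t_def power2_eq_square g_sym[OF w v] mult.commute)
    qed
    fix k assume "\<forall>v\<in>TM p. \<forall>w\<in>TM p.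
        g p (Rm p v w w) v = k * (g p v v * g p w w - (g p v w)\<^sup>2)"
    then have "t e1 e2 e2 e1 = k * \<Delta>" using e1 e2 by (simp add: t_def \<Delta>_def power2_eq_square)
    then show "k = K" using pos by (simp add: K_def \<Delta>_def)
  qed
  moreover have "Rm p v w x = K *\<^sub>R (g p w x *\<^sub>R v - g p v x *\<^sub>R w)"
  proof (rule g_nondeg[OF Rm_in[OF v w x]])
    show "K *\<^sub>R (g p w x *\<^sub>R v - g p v x *\<^sub>R w) \<in> TM p"
      by (intro subspace_scale subspace_diff T v w)
    show "g p (Rm p v w x) y = g p (K *\<^sub>R (g p w x *\<^sub>R v - g p v x *\<^sub>R w)) y" if y: "y \<in> TM p" for y
      using eq[OF v w x y]
      by (simp add: t_def g_scaleR2 g_diff2 v w y subspace_scale[OF T] subspace_diff[OF T])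
  qed
  ultimately show ?thesis by simp
qed

lemma ricci_dim_2:
  assumes n: "DIM('e) = 2" and w: "w \<in> TM p" and z: "z \<in> TM p"
  shows "ricci A D p w z = gauss_curvature A g D p * g p w z"
proof -
  have p: "p \<in> carrier A" using tangent_carrier[OF w] .
  note T = subspace_tangent_space[OF p]
  let ?K = "gauss_curvature A g D p"
  have "ricci A D p w z = trace_on (TM p) (\<lambda>v. (?K * g p w z) *\<^sub>R v + (- ?K) *\<^sub>R (g p v z *\<^sub>R w))"
    unfolding ricci_def
    by (rule trace_cong[OF p]) (simp add: curvature_dim_2[OF n _ w z] scaleR_diff_right)
  also have "\<dots> = (?K * g p w z) * real DIM('e) + (- ?K) * g p w z"
    by (simp only: trace_add[OF p] trace_scaleR[OF p] trace_id[OF p] trace_rank_one[OF p g_lin2[OF z] w]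
        subspace_scale[OF T] w)
  finally show ?thesis using n by (simp add: algebra_simps)
qed

end

section \<open>The trace condition and its two forms\<close>

context ambient_pullback begin

text \<open>The identity contributes -n g(S w, z), each of the two rank one terms contributes g(S w,
  z), and this produces the factor n - 2. The remaining term brings in the trace of S.\<close>

lemma trace_weyl:
  assumes w: "w \<in> TM p" and z: "z \<in> TM p"
  shows "trace_on (TM p) (\<lambda>v. weyl p v w z) =
    ricci A D p w z - ((real DIM('e) - 2) * g p (S p w) z + trace_on (TM p) (S p) * g p w z)"
proof -
  have p: "p \<in> carrier A" using tangent_carrier[OF w] .
  have lS: "lin_on (TM p) (\<lambda>v. g p (S p v) z)"
    using z lin_on_add[OF S_lin[OF p]] lin_on_scaleR[OF S_lin[OF p]]
    by (simp add: lin_on_def g_add2 g_scaleR2 S_in)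
  have "trace_on (TM p) (\<lambda>v. weyl p v w z) = trace_on (TM p) (\<lambda>v. Rm p v w z
      + ((- g p (S p w) z) *\<^sub>R v + (g p (S p v) z *\<^sub>R w + ((- g p w z) *\<^sub>R S p v + g p v z *\<^sub>R S p w))))"
    by (rule trace_cong[OF p]) (simp add: weyl_def)
  also have "\<dots> = ricci A D p w z + ((- g p (S p w) z) * real DIM('e)
      + (g p (S p w) z + ((- g p w z) * trace_on (TM p) (S p) + g p (S p w) z)))"
    by (simp only: trace_add[OF p] trace_scaleR[OF p] trace_id[OF p] trace_rank_one[OF p g_lin2[OF z] S_in[OF w]]
        trace_rank_one[OF p lS w] Rm_in scale_in add_in S_in w z ricci_def)
  finally show ?thesis by (simp add: algebra_simps)
qed

text \<open>Standardness and the invariance of the line hold for every admissible family, so only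
  the trace condition distinguishes the normal ones.\<close>

lemma normal_iff:
  assumes c: "conformal_structure A c"
  shows "normal_conformal_tractor_bundle A c B L h Du \<longleftrightarrow>
    (\<forall>p\<in>carrier A. \<forall>w\<in>TM p. \<forall>z\<in>TM p.
      ricci A D p w z = (real DIM('e) - 2) * g p (S p w) z + trace_on (TM p) (S p) * g p w z)"
proof -
  have "trace_on (TM p) (\<lambda>v. tractor_weyl A B L Du p v w z) =
      trace_on (TM p) (\<lambda>v. weyl p v w z)"
    if "p \<in> carrier A" "w \<in> TM p" "z \<in> TM p" for p w z
    by (rule trace_cong[OF that(1)]) (rule tractor_weyl_eq[OF _ that(2,3)])
  then show ?thesis
    unfolding normal_conformal_tractor_bundle_def
    using standard_B[OF c] curvature_line by (simp add: trace_weyl)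
qed

lemma trace_family_deriv:
  assumes p: "p \<in> carrier A"
  shows "trace_on (TM p) (family_deriv \<gamma> 0 p) = 2 * trace_on (TM p) (S p)"
proof -
  have "trace_on (TM p) (family_deriv \<gamma> 0 p) = trace_on (TM p) (\<lambda>v. 2 *\<^sub>R S p v)"
    by (rule trace_cong[OF p]) (simp add: S_def)
  then show ?thesis using trace_scaleR[OF p S_in] by simp
qed

lemma exists_tangent_nonzero: assumes "p \<in> carrier A" shows "\<exists>v\<in>TM p. v \<noteq> 0"
proof -
  obtain U \<phi> where c: "(U, \<phi>) \<in> A" "p \<in> U" using chart_at assms by blast
  obtain b :: 'e where b: "b \<in> Basis" using nonempty_Basis by blast
  have "chart_tvec A U \<phi> p b (\<lambda>q. \<phi> q \<bullet> b) = 1" using chart_tvec_coord[OF c] b by simp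
  then have "chart_tvec A U \<phi> p b \<noteq> 0" by auto
  then show ?thesis using chart_tvec_in[OF c] by blast
qed

text \<open>Both sides are multiples of g here, so a nonzero vector, on which g is positive,
  compares the two factors.\<close>

lemma ricci_iff_gauss:
  assumes n: "DIM('e) = 2" and p: "p \<in> carrier A"
  shows "(\<forall>w\<in>TM p. \<forall>z\<in>TM p.
      ricci A D p w z = (real DIM('e) - 2) * g p (S p w) z + trace_on (TM p) (S p) * g p w z)
    \<longleftrightarrow> trace_on (TM p) (family_deriv \<gamma> 0 p) = 2 * gauss_curvature A g D p"
proof -
  obtain v where v: "v \<in> TM p" "v \<noteq> 0" using exists_tangent_nonzero[OF p] by blast
  have "g p v v \<noteq> 0" using g_pos[OF v] by simp
  then show ?thesis
    using v(1) by (auto simp: ricci_dim_2[OF n] trace_family_deriv[OF p] n)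
qed

lemma ricci_iff_schouten:
  assumes n: "DIM('e) \<ge> 3" and p: "p \<in> carrier A"
  shows "(\<forall>w\<in>TM p. \<forall>z\<in>TM p.
      ricci A D p w z = (real DIM('e) - 2) * g p (S p w) z + trace_on (TM p) (S p) * g p w z)
    \<longleftrightarrow> (\<forall>v\<in>TM p. \<forall>w\<in>TM p.
      g p (family_deriv \<gamma> 0 p v) w = 2 * schouten A g D p v w)"
    (is "?R \<longleftrightarrow> ?P")
proof -
  let ?n = "real DIM('e)" and ?s = "scalar_curvature A g D p" and ?t = "trace_on (TM p) (S p)"
  have n': "?n \<ge> 3" using n by simp
  \<comment> \<open>The trace of the Ricci endomorphism (n - 2) S + k id. Two constants k occur, the
    trace of S on the side of normality and scal / (2 (n - 1)) on the side of P; this trace identity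
    shows that they coincide.\<close>
  have scal: "?s = (?n - 2) * ?t + k * ?n"
    if "\<And>v z. v \<in> TM p \<Longrightarrow> z \<in> TM p \<Longrightarrow>
      ricci A D p v z = (?n - 2) * g p (S p v) z + k * g p v z" for k
  proof -
    have "?s = trace_on (TM p) (\<lambda>v. (?n - 2) *\<^sub>R S p v + k *\<^sub>R v)"
      by (rule scalar_curvature_eq[OF p])
        (simp_all add: that g_add2 g_scaleR2 S_in scale_in add_in)
    also have "\<dots> = (?n - 2) * ?t + k * ?n"
      by (simp only: trace_add[OF p] trace_scaleR[OF p] trace_id[OF p] S_in scale_in)
    finally show ?thesis .
  qed
  have P: "?P \<longleftrightarrow> (\<forall>v\<in>TM p. \<forall>w\<in>TM p.
      ricci A D p v w = (?n - 2) * g p (S p v) w + ?s / (2 * (?n - 1)) * g p v w)"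
  proof -
    have e: "2 * x = 2 * (1 / (?n - 2) * (r - m * k)) \<longleftrightarrow> r = (?n - 2) * x + m * k" for x r m k :: real
      using n' by (auto simp: field_simps)
    have "g p (family_deriv \<gamma> 0 p v) w = 2 * schouten A g D p v w \<longleftrightarrow>
        ricci A D p v w = (?n - 2) * g p (S p v) w + ?s / (2 * (?n - 1)) * g p v w"
      if "v \<in> TM p" "w \<in> TM p" for v w
      unfolding g_S[OF that, symmetric] schouten_def by (rule e)
    then show ?thesis by (intro ball_cong refl)
  qed
  show ?thesis
  proof
    assume R: ?R
    then have "?s = (?n - 2) * ?t + ?t * ?n" using scal by blast
    then have "?s / (2 * (?n - 1)) = ?t" using n' by (simp add: field_simps)
    then show ?P using R unfolding P by simp
  next
    assume ?P
    then have R: "\<And>v w. v \<in> TM p \<Longrightarrow> w \<in> TM p \<Longrightarrow>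
      ricci A D p v w = (?n - 2) * g p (S p v) w + ?s / (2 * (?n - 1)) * g p v w"
      unfolding P by blast
    define k where "k = ?s / (2 * (?n - 1))"
    have "?s = (?n - 2) * ?t + k * ?n" using scal R unfolding k_def by blast
    moreover have "?s = 2 * (?n - 1) * k" using n' by (simp add: k_def)
    ultimately have "(?n - 2) * (k - ?t) = 0" by (simp add: algebra_simps)
    then have "k = ?t" using n' by simp
    then show ?R using R unfolding k_def by simp
  qed
qed

end

theorem corollary5p2:
  fixes A :: "('m::{t2_space, second_countable_topology}, 'e::euclidean_space) atlas"
    and c :: "('m \<Rightarrow> 'm tvec \<Rightarrow> 'm tvec \<Rightarrow> real) set"
    and g :: "'m \<Rightarrow> 'm tvec \<Rightarrow> 'm tvec \<Rightarrow> real"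
    and \<gamma> :: "real \<Rightarrow> 'm \<Rightarrow> 'm tvec \<Rightarrow> 'm tvec"
    and \<delta> :: real
    and u :: "'m \<Rightarrow> real"
    and D :: "'m \<Rightarrow> 'm tvec \<Rightarrow> ('m \<Rightarrow> 'm tvec) \<Rightarrow> 'm tvec"
    and D_amb :: "real \<times> real \<times> 'm \<Rightarrow> (real \<times> real \<times> 'm) tvec \<Rightarrow>
        (real \<times> real \<times> 'm \<Rightarrow> (real \<times> real \<times> 'm) tvec) \<Rightarrow> (real \<times> real \<times> 'm) tvec"
    and D_u :: "'m \<Rightarrow> 'm tvec \<Rightarrow> ('m \<Rightarrow> (real \<times> real \<times> 'm) tvec) \<Rightarrow> (real \<times> real \<times> 'm) tvec"
  assumes "smooth_manifold A" and "connected (carrier A)" and "DIM('e) \<ge> 2"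
    and "conformal_structure A c" and "g \<in> c"
    and "admissible_family A c \<gamma> \<delta>"
    and "smooth_fun A (carrier A) u"
    and "levi_civita A g D"
    and "levi_civita (ambient_atlas A \<delta>) (ambient_metric A g \<gamma>) D_amb"
    and "is_pullback_connection A (ambient_atlas A \<delta>) (Psi u)
           (tangent_bundle (ambient_atlas A \<delta>)) D_amb D_u"
  shows "normal_conformal_tractor_bundle A c
           (pullback_bundle A (Psi u) (tangent_bundle (ambient_atlas A \<delta>)))
           (ray (xi A \<delta> u))
           (\<lambda>p. ambient_metric A g \<gamma> (Psi u p))
           D_u
         \<longleftrightarrow>
         (DIM('e) = 2 \<longrightarrow> (\<forall>p\<in>carrier A.
            trace_on (tangent_space A p) (family_deriv \<gamma> 0 p) = 2 * gauss_curvature A g D p)) \<and>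
         (DIM('e) \<ge> 3 \<longrightarrow> (\<forall>p\<in>carrier A. \<forall>v\<in>tangent_space A p. \<forall>w\<in>tangent_space A p.
            g p (family_deriv \<gamma> 0 p v) w = 2 * schouten A g D p v w))"
proof -
  have g: "riemannian_metric A g"
    using assms(4,5) unfolding conformal_structure_def by blast
  have \<delta>: "\<delta> > 0" using assms(6) unfolding admissible_family_def by blast
  interpret ambient_pullback A \<delta> g D \<gamma> D_amb c u D_u
    by unfold_locales (use assms g \<delta> in simp_all)
  \<comment> \<open>In each case one of the two implications of the conclusion is vacuous.\<close>
  consider "DIM('e) = 2" | "DIM('e) \<ge> 3" using assms(3) by linarith
  then show ?thesis
  proof cases
    case 1
    then show ?thesis using ricci_iff_gauss[OF 1] by (simp add: normal_iff[OF assms(4)])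
  next
    case 2
    then show ?thesis using ricci_iff_schouten[OF 2] by (simp add: normal_iff[OF assms(4)])
  qed
qed

end
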